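(* Let $n\ge2$ and let $\lambda$ be a weight of $sl(n,\mathbb{C})$ with $\lambda(h_i)=\lambda_i\in\mathbb{C}$, $i=1,\dots,n-1$. The space of solutions $z\in\mathcal{A}_1$ of the system $d_i(z)=0$, $i=1,\dots,n-1$, is spanned by $\{\sigma(1)\mid\sigma\in S_n\}$. Moreover, $\{\sigma(1)\mid\sigma\in S_n\}$ are all the weighted solutions of this system in $\mathcal{A}_1$ up to scalar multiples. In particular, there are exactly $n!$ singular vectors up to scalar multiples in the Verma module $M_\lambda$ when the weight $\lambda$ is dominant integral (i.e. $\lambda_i\in\mathbb{N}$ for all $i$).
   Context: Let $\mathbb{N}$ be the set of nonnegative integers. Let $H=\sum_{i=1}^{n-1}\mathbb{C}h_i$ with $h_i=E_{i,i}-E_{i+1,i+1}$ be the Cartan subalgebra of $sl(n,\mathbb{C})$; a weight is a linear function on $H$. The positive root vectors are $E_{i,j}$, $i<j$. $M_\lambda$ is the Verma module of highest weight $\lambda$ (highest-weight vector $v_\lambda$). A singular vector in $M_\lambda$ is a nonzero weight vector $u$ with $E_{i,i+1}(u)=0$ for $i=1,\dots,n-1$. Variables: $x_{i,j}$ for $1\le j<i\le n$, with $\partial_{i,j}=\partial/\partial x_{i,j}$. Let $\mathcal{A}_0=\mathbb{C}[x_{i,j}\mid 1\le j\le i-2\le n-2]$. For $\vec a=(a_1,\dots,a_{n-1})\in\mathbb{C}^{n-1}$ put $x^{\vec a}=\prod_{i=1}^{n-1}x_{i+1,i}^{a_i}$. The space of truncated-up formal power series is $$\mathcal{A}_1=\Big\{\sum_{\vec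 j\in\mathbb{N}^{n-1}}\sum_{i=1}^p f_{\vec a^i-\vec j}\,x^{\vec a^i-\vec j}\ \Big|\ 1\le p\in\mathbb{N},\ \vec a^i\in\mathbb{C}^{n-1},\ f_{\vec a^i-\vec j}\in\mathcal{A}_0\Big\},$$ with the usual formal action of the $x_{i,j}$, of complex powers of the $x_{i+1,i}$, and of the $\partial_{i,j}$ (so $\partial_{i+1,i}x_{i+1,i}^{a}=a\,x_{i+1,i}^{a-1}$). Differential operators on $\mathcal{A}_1$, for $i=1,\dots,n-1$: $$d_i=\Big(\lambda_i-\sum_{j=i+1}^n x_{j,i}\partial_{j,i}+\sum_{j=i+2}^n x_{j,i+1}\partial_{j,i+1}\Big)\partial_{i+1,i}+\sum_{j=1}^{i-1}x_{i,j}\partial_{i+1,j}-\sum_{j=i+2}^n x_{j,i+1}\partial_{j,i},$$ $$\zeta_i=\lambda_i+\sum_{p=1}^{i-1}(x_{i,p}\partial_{i,p}-x_{i+1,p}\partial_{i+1,p})+\sum_{j=i+2}^n(x_{j,i+1}\partial_{j,i+1}-x_{j,i}\partial_{j,i})-2x_{i+1,i}\partial_{i+1,i},$$ and, for $a\in\mathbb{C}$, with $\langle a\rangle_p=a(a-1)\cdots(a-p+1)$, $$\eta_i^a=\sum_{p=0}^\infty\frac{\langle a\rangle_p}{p!}\,x_{i+1,i}^{a-p}\Big(\sum_{j=1}^{i-1}x_{i+1,j}\partial_{i,j}\Big)^p .$$ A function $f$ is weighted if there are constants $\mu_1,\dots,\mu_{n-1}$ with $\zeta_i(f)=\mu_i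 f$ for all $i$. Any $f\in\mathcal{A}_1$ can be written as $f=\sum_{j\in\mathbb{Z}}f_j$ with each $f_j$ weighted, $\zeta_i(f_j)=\mu_{(j)}(h_i)f_j$, $\mu_{(j)}\in H^*$. Action of $S_n$: let $\sigma_1,\dots,\sigma_{n-1}$ be the standard generators of $S_n$ (relations $\sigma_i\sigma_{i+1}\sigma_i=\sigma_{i+1}\sigma_i\sigma_{i+1}$, $\sigma_r\sigma_s=\sigma_s\sigma_r$ for $|r-s|\ge2$, $\sigma_r^2=1$). $S_n$ acts through $\sigma_i(f)=\sum_{j\in\mathbb{Z}}\eta_i^{\mu_{(j)}(h_i)+1}(f_j)$. For $\sigma=\sigma_{i_1}\sigma_{i_2}\cdots\sigma_{i_r}\in S_n$, $\sigma(1)=\sigma_{i_1}(\sigma_{i_2}(\cdots(\sigma_{i_r}(1))\cdots))$ is the result of $\sigma$ acting on the constant function $1$. *)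

theory Defs
  imports
    Complex_Main
    "HOL-Library.FuncSet"
    "HOL-Library.Function_Algebras"
    "HOL-Library.Poly_Mapping"
    "HOL-Combinatorics.Permutations"
    "Jordan_Normal_Form.Matrix"
begin

section \<open>Formal series with complex exponents\<close>

text \<open>
  A monomial is given by its exponents: \<open>e (i, j)\<close> is the exponent of \<open>x_{i,j}\<close>. A formal series is
  its family of coefficients, indexed by all conceivable exponents; \<open>A1\<close> below cuts out the
  truncated-up series. A weight is represented by its values \<open>lam i\<close> on \<open>h_i\<close>, \<open>1 \<le> i < n\<close>; other
  values of \<open>lam\<close> play no role.
\<close>

type_synonym exponents = "nat \<times> nat \<Rightarrow> complex"
type_synonym series = "exponents \<Rightarrow> complex"

definition fscale :: "complex \<Rightarrow> series \<Rightarrow> series" where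
  "fscale c f = (\<lambda>e. c * f e)"

interpretation formal: vector_space fscale
  by unfold_locales (auto simp: fscale_def plus_fun_def algebra_simps)

definition fmonom :: "exponents \<Rightarrow> series" where
  "fmonom e = (\<lambda>e'. if e' = e then 1 else 0)"

definition fone :: series where
  "fone = fmonom (\<lambda>_. 0)"

text \<open>Multiplication by \<open>x_{i,j}^c\<close> and the partial derivative \<open>\<partial>_{i,j}\<close>, read off on coefficients.\<close>

definition xpow :: "nat \<Rightarrow> nat \<Rightarrow> complex \<Rightarrow> series \<Rightarrow> series" where
  "xpow i j c f = (\<lambda>e. f (e((i, j) := e (i, j) - c)))"

abbreviation xmul :: "nat \<Rightarrow> nat \<Rightarrow> series \<Rightarrow> series" where
  "xmul i j \<equiv> xpow i j 1"

definition dx :: "nat \<Rightarrow> nat \<Rightarrow> series \<Rightarrow> series" where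
  "dx i j f = (\<lambda>e. (e (i, j) + 1) * f (e((i, j) := e (i, j) + 1)))"

definition exponents_of :: "nat \<Rightarrow> exponents set" where
  "exponents_of n =
     {e. (\<forall>i j. \<not> (1 \<le> j \<and> j < i \<and> i \<le> n) \<longrightarrow> e (i, j) = 0) \<and>
         (\<forall>i j. 1 \<le> j \<and> j + 2 \<le> i \<and> i \<le> n \<longrightarrow> e (i, j) \<in> \<nat>)}"

text \<open>
  Second conjunct: the exponents of the \<open>x_{i+1,i}\<close> lie in finitely many sets \<open>a - \<nat>\<^sup>n\<^sup>-\<^sup>1\<close>.
  Third conjunct: the coefficient of each \<open>\<Prod>_i x_{i+1,i}^(b i)\<close> is a polynomial
  in the remaining variables.
\<close>

definition A1 :: "nat \<Rightarrow> series set" where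
  "A1 n =
     {f. {e. f e \<noteq> 0} \<subseteq> exponents_of n \<and>
         (\<exists>A :: (nat \<Rightarrow> complex) set. finite A \<and>
            (\<forall>e. f e \<noteq> 0 \<longrightarrow> (\<exists>a\<in>A. \<forall>i\<in>{1..<n}. a i - e (i + 1, i) \<in> \<nat>))) \<and>
         (\<forall>b :: nat \<Rightarrow> complex. finite {e. f e \<noteq> 0 \<and> (\<forall>i\<in>{1..<n}. e (i + 1, i) = b i)})}"

section \<open>The differential operators\<close>

definition d :: "nat \<Rightarrow> (nat \<Rightarrow> complex) \<Rightarrow> nat \<Rightarrow> series \<Rightarrow> series" where
  "d n lam i z =
     (let y = dx (i + 1) i z in
        fscale (lam i) y
        - (\<Sum>j\<in>{i+1..n}. xmul j i (dx j i y))
        + (\<Sum>j\<in>{i+2..n}. xmul j (i + 1) (dx j (i + 1) y)))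
     + (\<Sum>j\<in>{1..<i}. xmul i j (dx (i + 1) j z))
     - (\<Sum>j\<in>{i+2..n}. xmul j (i + 1) (dx j i z))"

definition zeta :: "nat \<Rightarrow> (nat \<Rightarrow> complex) \<Rightarrow> nat \<Rightarrow> series \<Rightarrow> series" where
  "zeta n lam i f =
     fscale (lam i) f
     + (\<Sum>p\<in>{1..<i}. xmul i p (dx i p f) - xmul (i + 1) p (dx (i + 1) p f))
     + (\<Sum>j\<in>{i+2..n}. xmul j (i + 1) (dx j (i + 1) f) - xmul j i (dx j i f))
     - fscale 2 (xmul (i + 1) i (dx (i + 1) i f))"

text \<open>
  The sum over \<open>p\<close> is taken coefficientwise. On series supported in \<open>exponents_of n\<close> only finitely
  many \<open>p\<close> contribute to a given coefficient: each application of the inner operator raises the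
  total degree in the \<open>x_{i+1,j}\<close>, \<open>j < i\<close>, whose exponents are natural numbers. Note that
  \<open>a gchoose p\<close> is \<open>a (a - 1) \<dots> (a - p + 1) / p!\<close>.
\<close>

definition eta :: "nat \<Rightarrow> complex \<Rightarrow> series \<Rightarrow> series" where
  "eta i a f =
     (\<lambda>e. Sum_any (\<lambda>p. (a gchoose p) *
        xpow (i + 1) i (a - of_nat p)
          (((\<lambda>g. \<Sum>j\<in>{1..<i}. xmul (i + 1) j (dx i j g)) ^^ p) f) e))"

definition weighted :: "nat \<Rightarrow> (nat \<Rightarrow> complex) \<Rightarrow> series \<Rightarrow> bool" where
  "weighted n lam f \<longleftrightarrow> (\<exists>mu :: nat \<Rightarrow> complex. \<forall>i\<in>{1..<n}. zeta n lam i f = fscale (mu i) f)"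

section \<open>The action of the symmetric group\<close>

text \<open>The part of \<open>f\<close> of weight \<open>mu\<close>; each \<open>zeta n lam i\<close> is diagonal on monomials.\<close>

definition wcomp :: "nat \<Rightarrow> (nat \<Rightarrow> complex) \<Rightarrow> (nat \<Rightarrow> complex) \<Rightarrow> series \<Rightarrow> series" where
  "wcomp n lam mu f =
     (\<lambda>e. if \<forall>i\<in>{1..<n}. zeta n lam i (fmonom e) = fscale (mu i) (fmonom e) then f e else 0)"

text \<open>
  \<open>sigma n lam i f\<close> is the sum of \<open>eta i (mu i + 1)\<close> applied to the part of \<open>f\<close> of weight \<open>mu\<close>, over
  all weights \<open>mu\<close>, taken coefficientwise. As \<open>eta i (mu i + 1)\<close> turns weight \<open>mu\<close> into
  \<open>mu - (mu i + 1) \<alpha>_i\<close> and this map of weights is injective, at most one \<open>mu\<close> contributes to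
  a given coefficient. Weights are taken extensional on \<open>{1..<n}\<close> so that none is counted twice.
\<close>

definition sigma :: "nat \<Rightarrow> (nat \<Rightarrow> complex) \<Rightarrow> nat \<Rightarrow> series \<Rightarrow> series" where
  "sigma n lam i f =
     (\<lambda>e. Sum_any (\<lambda>mu. if mu \<in> extensional {1..<n}
                        then eta i (mu i + 1) (wcomp n lam mu f) e else 0))"

definition word_perm :: "nat list \<Rightarrow> nat \<Rightarrow> nat" where
  "word_perm w = foldr (\<lambda>i p. Transposition.transpose i (i + 1) \<circ> p) w id"

text \<open>
  \<open>z\<close> is the result of letting \<open>\<pi>\<close> act on \<open>f\<close> through some expression
  \<open>\<pi> = \<sigma>_{i_1} \<dots> \<sigma>_{i_r}\<close>.
\<close>

definition perm_acts :: "nat \<Rightarrow> (nat \<Rightarrow> complex) \<Rightarrow> (nat \<Rightarrow> nat) \<Rightarrow> series \<Rightarrow> series \<Rightarrow> bool" where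
  "perm_acts n lam \<pi> f z \<longleftrightarrow>
     (\<exists>w. set w \<subseteq> {1..<n} \<and> word_perm w = \<pi> \<and> z = foldr (sigma n lam) w f)"

definition orbit_one :: "nat \<Rightarrow> (nat \<Rightarrow> complex) \<Rightarrow> series set" where
  "orbit_one n lam = {z. \<exists>\<pi>. \<pi> permutes {1..n} \<and> perm_acts n lam \<pi> fone z}"

definition solutions :: "nat \<Rightarrow> (nat \<Rightarrow> complex) \<Rightarrow> series set" where
  "solutions n lam = {z \<in> A1 n. \<forall>i\<in>{1..<n}. d n lam i z = 0}"

section \<open>The Verma module\<close>

text \<open>Matrix entries are indexed from \<open>0\<close>, whereas \<open>E n i j\<close> is indexed from \<open>1\<close>.\<close>

definition sl :: "nat \<Rightarrow> complex mat set" where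
  "sl n = {X \<in> carrier_mat n n. (\<Sum>k<n. X $$ (k, k)) = 0}"

definition E :: "nat \<Rightarrow> nat \<Rightarrow> nat \<Rightarrow> complex mat" where
  "E n i j = mat n n (\<lambda>(r, c). if r + 1 = i \<and> c + 1 = j then 1 else 0)"

definition h :: "nat \<Rightarrow> nat \<Rightarrow> complex mat" where
  "h n i = E n i i - E n (i + 1) (i + 1)"

text \<open>
  With lists as a monoid under concatenation, \<open>complex mat list \<Rightarrow>\<^sub>0 complex\<close> is the free associative
  algebra on the set of matrices.
\<close>

instantiation list :: (type) monoid_add
begin

definition zero_list :: "'a list" where "zero_list = []"

definition plus_list :: "'a list \<Rightarrow> 'a list \<Rightarrow> 'a list" where "plus_list xs ys = xs @ ys"

instance
  by standard (simp_all add: zero_list_def plus_list_def)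

end

type_synonym free_alg = "complex mat list \<Rightarrow>\<^sub>0 complex"

definition gen :: "complex mat \<Rightarrow> free_alg" where
  "gen X = Poly_Mapping.single [X] 1"

definition scal :: "complex \<Rightarrow> free_alg" where
  "scal c = Poly_Mapping.single [] c"

definition T :: "nat \<Rightarrow> free_alg set" where
  "T n = {u. Poly_Mapping.keys u \<subseteq> lists (sl n)}"

text \<open>The two-sided ideal with \<open>T n / U_ideal n\<close> the enveloping algebra \<open>U(sl(n))\<close>.\<close>

inductive_set U_ideal :: "nat \<Rightarrow> free_alg set" for n :: nat where
  linear: "X \<in> sl n \<Longrightarrow> Y \<in> sl n \<Longrightarrow>
    gen (c \<cdot>\<^sub>m X + Y) - (scal c * gen X + gen Y) \<in> U_ideal n"
| bracket: "X \<in> sl n \<Longrightarrow> Y \<in> sl n \<Longrightarrow>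
    gen X * gen Y - gen Y * gen X - gen (X * Y - Y * X) \<in> U_ideal n"
| add: "u \<in> U_ideal n \<Longrightarrow> v \<in> U_ideal n \<Longrightarrow> u + v \<in> U_ideal n"
| mult: "u \<in> U_ideal n \<Longrightarrow> a \<in> T n \<Longrightarrow> b \<in> T n \<Longrightarrow> a * u * b \<in> U_ideal n"

text \<open>
  The preimage in \<open>T n\<close> of the left ideal of \<open>U(sl(n))\<close> generated by the positive root vectors and
  the \<open>h_i - lam i\<close>, that is, of the annihilator of the highest-weight vector.
\<close>

inductive_set verma_ideal :: "nat \<Rightarrow> (nat \<Rightarrow> complex) \<Rightarrow> free_alg set"
  for n :: nat and lam :: "nat \<Rightarrow> complex" where
  U: "u \<in> U_ideal n \<Longrightarrow> u \<in> verma_ideal n lam"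
| pos: "1 \<le> i \<Longrightarrow> i < j \<Longrightarrow> j \<le> n \<Longrightarrow> gen (E n i j) \<in> verma_ideal n lam"
| cartan: "1 \<le> i \<Longrightarrow> i < n \<Longrightarrow> gen (h n i) - scal (lam i) \<in> verma_ideal n lam"
| add: "u \<in> verma_ideal n lam \<Longrightarrow> v \<in> verma_ideal n lam \<Longrightarrow> u + v \<in> verma_ideal n lam"
| mult: "u \<in> verma_ideal n lam \<Longrightarrow> a \<in> T n \<Longrightarrow> a * u \<in> verma_ideal n lam"

definition verma_rel :: "nat \<Rightarrow> (nat \<Rightarrow> complex) \<Rightarrow> (free_alg \<times> free_alg) set" where
  "verma_rel n lam = {(u, v). u \<in> T n \<and> v \<in> T n \<and> u - v \<in> verma_ideal n lam}"

definition verma :: "nat \<Rightarrow> (nat \<Rightarrow> complex) \<Rightarrow> free_alg set set" where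
  "verma n lam = T n // verma_rel n lam"

definition verma_zero :: "nat \<Rightarrow> (nat \<Rightarrow> complex) \<Rightarrow> free_alg set" where
  "verma_zero n lam = verma_rel n lam `` {0}"

text \<open>The action of \<open>T n\<close>, and so of \<open>sl(n)\<close> via \<open>gen\<close> and of scalars via \<open>scal\<close>.\<close>

definition verma_act :: "nat \<Rightarrow> (nat \<Rightarrow> complex) \<Rightarrow> free_alg \<Rightarrow> free_alg set \<Rightarrow> free_alg set" where
  "verma_act n lam a C = verma_rel n lam `` ((\<lambda>u. a * u) ` C)"

definition singular_vectors :: "nat \<Rightarrow> (nat \<Rightarrow> complex) \<Rightarrow> free_alg set set" where
  "singular_vectors n lam =
     {C \<in> verma n lam. C \<noteq> verma_zero n lam \<and>
        (\<exists>mu :: nat \<Rightarrow> complex. \<forall>i\<in>{1..<n}.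
           verma_act n lam (gen (h n i)) C = verma_act n lam (scal (mu i)) C) \<and>
        (\<forall>i\<in>{1..<n}. verma_act n lam (gen (E n i (i + 1))) C = verma_zero n lam)}"

definition proportional ::
    "nat \<Rightarrow> (nat \<Rightarrow> complex) \<Rightarrow> (free_alg set \<times> free_alg set) set" where
  "proportional n lam =
     {(C, D). C \<in> singular_vectors n lam \<and> D \<in> singular_vectors n lam \<and>
        (\<exists>c. c \<noteq> 0 \<and> D = verma_act n lam (scal c) C)}"

end

theory Submission
  imports
    Defs
    "HOL-Computational_Algebra.Polynomial_FPS"
begin

text \<open>
  In the basis of ordered monomials of the Verma module, \<open>E_{i,i+1}\<close> acts as \<open>d_i\<close>, \<open>h_i\<close> as
  \<open>\<zeta>_i\<close>, and \<open>E_{i+1,i}\<close> as \<open>F_i = x_{i+1,i} + \<Sum>_{j<i} x_{i+1,j} \<partial>_{i,j}\<close>, so that \<open>\<eta>_i^a\<close> is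
  the \<open>a\<close>-th power of \<open>F_i\<close>. The whole of gl(n) acts: the module is induced column by column
  (\<open>gl\<close>, \<open>comm_gl\<close>), and since the bracket relations follow from those of the Weyl algebra, they
  hold on series with complex exponents. A solution of the system is therefore annihilated by
  all \<open>E_{i,j}\<close> with \<open>i < j\<close>.

  For a grading in which the \<open>x_{i+1,i}\<close> count twice, the leading part of \<open>E_{i,j}\<close> consists of
  two terms, and these force the top part of a weighted solution to involve only the variables
  \<open>x_{i+1,i}\<close> (\<open>top_pure\<close>). The weight determines this monomial, so two solutions of the same
  weight are proportional (\<open>singular_unique\<close>).

  The traces of the powers of the matrix of the \<open>E_{i,j}\<close> are central. They act on ordinary
  monomials by their values on the constant, and an operator with polynomial coefficients that
  vanishes on ordinary monomials vanishes on complex powers too (\<open>fmonom_dense\<close>). On a singular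
  series of weight \<open>\<mu>\<close> their generating function is computed from \<open>\<mu> + \<rho>\<close>, and it determines the
  entries of \<open>\<mu> + \<rho>\<close> up to order. Hence \<open>\<mu>\<close> lies in the orbit of \<open>\<lambda>\<close> under the dot action of the
  symmetric group (\<open>weight_linkage\<close>).

  If \<open>z\<close> is a solution of weight \<open>\<mu>\<close> and \<open>a = \<mu>(h_i) + 1\<close>, then \<open>\<eta>_i^a z\<close> is a solution of the
  reflected weight: the commutator of \<open>E_{j,j+1}\<close> with \<open>F_i^a\<close> is polynomial in \<open>a\<close>, and for
  natural \<open>a\<close> it is the familiar one from sl(2) (\<open>raising_eta\<close>). Moreover \<open>\<eta>_i^a\<close> keeps the
  leading coefficient, so nothing becomes zero. Thus the \<open>\<sigma>(1)\<close> are, up to scalars, all weighted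
  solutions, and an arbitrary solution is the sum of its components in the finitely many weights
  of the orbit.

  A class in the Verma module is represented by the polynomial that it gives when applied to the
  constant; this is faithful because ordered words span (\<open>T_pbw_spanned\<close>) and act as distinct
  monomials. Singular vectors become polynomial weighted solutions. If \<open>\<lambda>\<close> is dominant integral,
  every permutation can be reached by simple reflections whose exponents \<open>a\<close> are natural
  numbers, so all \<open>n!\<close> weights of the orbit, which are distinct, come from singular vectors.
\<close>

section \<open>Inducing a module from gl(m) to gl(m + 1)\<close>

definition comm :: "'a::ring \<Rightarrow> 'a \<Rightarrow> 'a" where
  "comm a b = a * b - b * a"

lemma comm_add_left: "comm (a + b) c = comm a c + comm b c"
  and comm_add_right: "comm a (b + c) = comm a b + comm a c"
  and comm_diff_left: "comm (a - b) c = comm a c - comm b c"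
  and comm_diff_right: "comm a (b - c) = comm a b - comm a c"
  and comm_mult_left: "comm (a * b) c = a * comm b c + comm a c * b"
  and comm_mult_right: "comm a (b * c) = comm a b * c + b * comm a c"
  and comm_zero_left: "comm 0 a = 0"
  and comm_zero_right: "comm a 0 = 0"
  and comm_self: "comm a a = 0"
  for a b c :: "'a::ring"
  by (simp_all add: comm_def algebra_simps)

lemma comm_swap: "comm a b = - comm b a" for a b :: "'a::ring"
  by (simp add: comm_def)

lemma comm_sum_left: "comm (sum f A) c = (\<Sum>i\<in>A. comm (f i) c)" for c :: "'a::ring"
  by (simp add: comm_def sum_distrib_left sum_distrib_right sum_subtractf)

lemma comm_sum_right: "comm c (sum f A) = (\<Sum>i\<in>A. comm c (f i))" for c :: "'a::ring"
  by (simp add: comm_def sum_distrib_left sum_distrib_right sum_subtractf)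

lemma comm_eq_zero_iff: "comm a b = 0 \<longleftrightarrow> a * b = b * a" for a b :: "'a::ring"
  by (simp add: comm_def)

lemmas comm_simps = comm_add_left comm_add_right comm_diff_left comm_diff_right comm_mult_left comm_mult_right
  comm_sum_left comm_sum_right comm_zero_left comm_zero_right comm_self

text \<open>
  If the \<open>r i j\<close> give a representation of gl(I) on a space \<open>V\<close> and \<open>c\<close> is a scalar, then \<open>V\<close>,
  with one further index \<open>0\<close> whose \<open>E_{0,0}\<close> acts by \<open>c\<close>, induces a module of gl({0} + I) on the
  polynomials in \<open>y_i\<close> with coefficients in \<open>V\<close>. Moving a root vector to the right past the \<open>y\<close>s
  shows that \<open>E_{i,0}\<close> acts as \<open>y i\<close>, \<open>E_{i,j}\<close> as \<open>A i j\<close>, \<open>E_{0,0}\<close> as \<open>L\<close> and \<open>E_{0,j}\<close> as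
  \<open>D j\<close>. The bracket relations between these follow from the Weyl algebra relations alone, so
  they are proved in an arbitrary ring and hold in particular for operators on series with
  complex exponents.
\<close>

locale induced_gl =
  fixes I :: "'i set" and y p :: "'i \<Rightarrow> 'a::ring_1" and r :: "'i \<Rightarrow> 'i \<Rightarrow> 'a" and c :: 'a
  assumes fin: "finite I"
    and yy: "\<And>i j. i \<in> I \<Longrightarrow> j \<in> I \<Longrightarrow> comm (y i) (y j) = 0"
    and pp: "\<And>i j. i \<in> I \<Longrightarrow> j \<in> I \<Longrightarrow> comm (p i) (p j) = 0"
    and py: "\<And>i j. i \<in> I \<Longrightarrow> j \<in> I \<Longrightarrow> comm (p i) (y j) = (if i = j then 1 else 0)"
    and ry: "\<And>i j k. i \<in> I \<Longrightarrow> j \<in> I \<Longrightarrow> k \<in> I \<Longrightarrow> comm (r i j) (y k) = 0"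
    and rp: "\<And>i j k. i \<in> I \<Longrightarrow> j \<in> I \<Longrightarrow> k \<in> I \<Longrightarrow> comm (r i j) (p k) = 0"
    and rr: "\<And>i j k l. i \<in> I \<Longrightarrow> j \<in> I \<Longrightarrow> k \<in> I \<Longrightarrow> l \<in> I \<Longrightarrow>
      comm (r i j) (r k l) = (if j = k then r i l else 0) - (if l = i then r k j else 0)"
    and central: "\<And>a. comm c a = 0"
begin

definition N where "N = (\<Sum>m\<in>I. y m * p m)"
definition A where "A i j = y i * p j + r i j"
definition L where "L = c - N"
definition D where "D j = L * p j - (\<Sum>k\<in>I. r k j * p k)"

lemma yp: "i \<in> I \<Longrightarrow> j \<in> I \<Longrightarrow> comm (y i) (p j) = (if i = j then - 1 else 0)"
  using py[of j i] comm_swap[of "y i" "p j"] by auto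

lemma yr: "i \<in> I \<Longrightarrow> j \<in> I \<Longrightarrow> k \<in> I \<Longrightarrow> comm (y k) (r i j) = 0"
  using ry[of i j k] comm_swap[of "y k" "r i j"] by auto

lemma pr: "i \<in> I \<Longrightarrow> j \<in> I \<Longrightarrow> k \<in> I \<Longrightarrow> comm (p k) (r i j) = 0"
  using rp[of i j k] comm_swap[of "p k" "r i j"] by auto

lemma N_y: "i \<in> I \<Longrightarrow> comm N (y i) = y i"
  by (simp add: N_def comm_simps yy py if_distrib[of "(*) _"] fin cong: if_cong)

lemma N_p: "i \<in> I \<Longrightarrow> comm N (p i) = - p i"
  by (simp add: N_def comm_simps yp pp if_distrib[of "\<lambda>z. z * _"] fin cong: if_cong)

lemma N_r: "i \<in> I \<Longrightarrow> j \<in> I \<Longrightarrow> comm N (r i j) = 0"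
  by (simp add: N_def comm_simps yr pr)

lemma L_y: "i \<in> I \<Longrightarrow> comm L (y i) = - y i"
  by (simp add: L_def comm_simps central N_y)

lemma L_p: "i \<in> I \<Longrightarrow> comm L (p i) = p i"
  by (simp add: L_def comm_simps central N_p)

lemma L_r: "i \<in> I \<Longrightarrow> j \<in> I \<Longrightarrow> comm L (r i j) = 0"
  by (simp add: L_def comm_simps central N_r)

lemma A_y: "i \<in> I \<Longrightarrow> j \<in> I \<Longrightarrow> k \<in> I \<Longrightarrow> comm (A i j) (y k) = (if j = k then y i else 0)"
  by (simp add: A_def comm_simps yy py ry)

lemma A_A: "i \<in> I \<Longrightarrow> j \<in> I \<Longrightarrow> k \<in> I \<Longrightarrow> l \<in> I \<Longrightarrow>
    comm (A i j) (A k l) = (if j = k then A i l else 0) - (if l = i then A k j else 0)"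
  by (auto simp: A_def comm_simps yy py yp pp ry rp yr pr rr algebra_simps)

lemma L_A: "i \<in> I \<Longrightarrow> j \<in> I \<Longrightarrow> comm L (A i j) = 0"
  by (simp add: A_def comm_simps L_y L_p L_r)

lemma L_D: "j \<in> I \<Longrightarrow> comm L (D j) = D j"
  by (simp add: D_def comm_simps L_p L_r)

lemma D_y:
  assumes "j \<in> I" "i \<in> I"
  shows "comm (D j) (y i) = (if j = i then L else 0) - A i j"
proof -
  have "comm (\<Sum>k\<in>I. r k j * p k) (y i) = (\<Sum>k\<in>I. r k j * (if k = i then 1 else 0))"
    using assms unfolding comm_sum_left by (intro sum.cong) (simp_all add: comm_simps ry py)
  also have "\<dots> = r i j"
    using assms by (simp add: if_distrib[of "(*) _"] fin cong: if_cong)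
  finally show ?thesis
    using assms by (simp add: D_def A_def comm_simps L_y py)
qed

lemma D_A:
  assumes "j \<in> I" "k \<in> I" "l \<in> I"
  shows "comm (D j) (A k l) = (if j = k then D l else 0)"
proof -
  have pA: "comm (p j) (A k l) = (if j = k then p l else 0)" if "j \<in> I" for j
    using assms that by (simp add: A_def comm_simps py pp pr)
  have rA: "comm (r i j) (A k l) = (if j = k then r i l else 0) - (if l = i then r k j else 0)"
    if "i \<in> I" for i
    using assms that by (simp add: A_def comm_simps ry rp rr)
  have "comm (\<Sum>i\<in>I. r i j * p i) (A k l)
      = (\<Sum>i\<in>I. r i j * (if i = k then p l else 0)
          + ((if j = k then r i l else 0) - (if l = i then r k j else 0)) * p i)"
    using assms unfolding comm_sum_left by (intro sum.cong refl) (simp only: comm_mult_left pA rA)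
  also have "\<dots> = (\<Sum>i\<in>I. (if i = k then r i j * p l else 0)) + (if j = k then (\<Sum>i\<in>I. r i l * p i) else 0)
      - (\<Sum>i\<in>I. if l = i then r k j * p i else 0)"
    by (auto simp: sum.distrib[symmetric] sum_subtractf[symmetric] algebra_simps intro!: sum.cong)
  also have "\<dots> = (if j = k then (\<Sum>i\<in>I. r i l * p i) else 0)"
    using assms by (simp add: fin)
  finally show ?thesis
    using assms by (simp add: D_def[of j] D_def[of l] comm_diff_left comm_mult_left pA L_A)
qed

text \<open>
  The commutator of the parts \<open>S i\<close> and \<open>S j\<close> reproduces \<open>S\<close> through the relations of gl(I). It
  cancels against the mixed terms because \<open>L\<close> counts each \<open>p\<close> with weight one.
\<close>

lemma D_D:
  assumes "i \<in> I" "j \<in> I"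
  shows "comm (D i) (D j) = 0"
proof -
  define S where "S j = (\<Sum>k\<in>I. r k j * p k)" for j
  have Sp: "comm (S i) (p j) = 0" if "i \<in> I" "j \<in> I" for i j
    using that by (simp add: S_def comm_simps rp pp)
  have LS: "comm L (S j) = S j" if "j \<in> I" for j
    using that by (simp add: S_def comm_simps L_r L_p)
  have SL: "comm (S j) L = - S j" if "j \<in> I" for j
    using LS[OF that] comm_swap[of "S j" L] by simp
  have pS: "comm (p j) (S i) = 0" if "i \<in> I" "j \<in> I" for i j
    using Sp[OF that] comm_swap[of "S i" "p j"] by simp
  have pL: "comm (p j) L = - p j" if "j \<in> I" for j
    using L_p[OF that] comm_swap[of "p j" L] by simp
  have pcom: "p a * p b = p b * p a" if "a \<in> I" "b \<in> I" for a b
    using pp[OF that] by (simp add: comm_def)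
  have "comm (S i) (S j) = (\<Sum>k\<in>I. \<Sum>m\<in>I. comm (r k i * p k) (r m j * p m))"
    unfolding S_def comm_sum_left by (simp only: comm_sum_right)
  also have "\<dots> = (\<Sum>k\<in>I. \<Sum>m\<in>I. (if m = i then r k j * p m * p k else 0)
                                   - (if j = k then r m i * p m * p k else 0))"
    using assms
    by (intro sum.cong refl) (auto simp: comm_simps rp pr pp rr algebra_simps mult.assoc pcom)
  also have "\<dots> = (\<Sum>k\<in>I. r k j * p i * p k) - (\<Sum>m\<in>I. r m i * p m * p j)"
  proof -
    have "(\<Sum>k\<in>I. \<Sum>m\<in>I. (if j = k then r m i * p m * p k else 0))
        = (\<Sum>m\<in>I. \<Sum>k\<in>I. (if j = k then r m i * p m * p k else 0))"
      by (rule sum.swap)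
    then show ?thesis
      using assms by (simp add: sum_subtractf fin)
  qed
  also have "\<dots> = S j * p i - S i * p j"
    using assms by (simp add: S_def sum_distrib_right mult.assoc pcom cong: sum.cong)
  finally have SS: "comm (S i) (S j) = S j * p i - S i * p j" .
  have "comm (L * p i) (L * p j) = 0"
    using assms by (simp add: comm_simps L_p pL pp mult.assoc pcom)
  moreover have "comm (L * p i) (S j) = S j * p i"
    using assms by (simp add: comm_simps LS pS)
  moreover have "comm (S i) (L * p j) = - (S i * p j)"
    using assms by (simp add: comm_simps SL Sp)
  ultimately show ?thesis
    using SS by (simp add: D_def S_def[symmetric] comm_diff_left comm_diff_right)
qed

end

section \<open>The ring of linear operators on series\<close>

text \<open>
  Operators form a ring only after restriction to the linear ones: composition distributes over
  sums on the right by linearity. Having them as a type makes commutators ring elements.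
\<close>

definition linear_op :: "(series \<Rightarrow> series) \<Rightarrow> bool" where
  "linear_op U \<longleftrightarrow> (\<forall>f g. U (f + g) = U f + U g) \<and> (\<forall>c f. U (fscale c f) = fscale c (U f))"

typedef linop = "{U. linear_op U}"
  morphisms app Abs_linop
  by (rule exI[of _ id]) (simp add: linear_op_def)

setup_lifting type_definition_linop

instantiation linop :: ring_1
begin

lift_definition zero_linop :: linop is "\<lambda>f. 0"
  by (simp add: linear_op_def fscale_def fun_eq_iff)
lift_definition one_linop :: linop is "\<lambda>f. f"
  by (simp add: linear_op_def)
lift_definition plus_linop :: "linop \<Rightarrow> linop \<Rightarrow> linop" is "\<lambda>S U f. S f + U f"
  by (simp add: linear_op_def fscale_def fun_eq_iff algebra_simps)
lift_definition minus_linop :: "linop \<Rightarrow> linop \<Rightarrow> linop" is "\<lambda>S U f. S f - U f"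
  by (simp add: linear_op_def fscale_def fun_eq_iff algebra_simps)
lift_definition uminus_linop :: "linop \<Rightarrow> linop" is "\<lambda>S f. - S f"
  by (simp add: linear_op_def fscale_def fun_eq_iff algebra_simps)
lift_definition times_linop :: "linop \<Rightarrow> linop \<Rightarrow> linop" is "\<lambda>S U f. S (U f)"
  by (simp add: linear_op_def)

instance
proof
  fix a b c :: linop
  show "a * b * c = a * (b * c)" by transfer simp
  show "a + b + c = a + (b + c)" by transfer (simp add: algebra_simps)
  show "a + b = b + a" by transfer (simp add: algebra_simps)
  show "0 + a = a" by transfer simp
  show "- a + a = 0" by transfer (simp add: fun_eq_iff)
  show "a - b = a + - b" by transfer (simp add: fun_eq_iff)
  show "1 * a = a" by transfer simp
  show "a * 1 = a" by transfer simp
  show "(a + b) * c = a * c + b * c" by transfer simp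
  show "a * (b + c) = a * b + a * c" by transfer (simp add: linear_op_def)
  show "(0::linop) \<noteq> 1"
  proof transfer
    show "(\<lambda>f. 0 :: series) \<noteq> (\<lambda>f. f)"
    proof
      assume "(\<lambda>f. 0 :: series) = (\<lambda>f. f)"
      from fun_cong[OF this, of "\<lambda>_. 1"] show False
        by (simp add: fun_eq_iff)
    qed
  qed
qed

end

lemma app_zero [simp]: "app 0 f = 0" by transfer simp
lemma app_one [simp]: "app 1 f = f" by transfer simp
lemma app_add [simp]: "app (S + U) f = app S f + app U f" by transfer simp
lemma app_diff [simp]: "app (S - U) f = app S f - app U f" by transfer simp
lemma app_uminus [simp]: "app (- S) f = - app S f" by transfer simp
lemma app_mult [simp]: "app (S * U) f = app S (app U f)" by transfer simp
lemma app_plus_arg: "app U (f + g) = app U f + app U g" by transfer (simp add: linear_op_def)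
lemma app_fscale: "app U (fscale c f) = fscale c (app U f)" by transfer (simp add: linear_op_def)

lemma app_zero_arg [simp]: "app U 0 = 0"
  using app_plus_arg[of U 0 0] by simp

lemma app_uminus_arg: "app U (- f) = - app U f"
proof -
  have "app U f + app U (- f) = 0"
    using app_plus_arg[of U f "- f"] by simp
  then show ?thesis
    by (rule minus_unique[symmetric])
qed

lemma app_diff_arg: "app U (f - g) = app U f - app U g"
  using app_plus_arg[of U f "- g"] by (simp add: app_uminus_arg)

lemma app_sum [simp]: "app (sum g I) f = (\<Sum>i\<in>I. app (g i) f)"
  by (induction I rule: infinite_finite_induct) auto

lemma sum_apply: "(sum g I :: 'a \<Rightarrow> 'b::comm_monoid_add) e = (\<Sum>i\<in>I. g i e)"
  by (induction I rule: infinite_finite_induct) auto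

lemma linop_eqI: "(\<And>f. app S f = app U f) \<Longrightarrow> S = U"
  by (simp add: app_inject[symmetric] fun_eq_iff)

lift_definition scop :: "complex \<Rightarrow> linop" is fscale
  by (auto simp: linear_op_def fscale_def fun_eq_iff algebra_simps)

lift_definition xop :: "nat \<Rightarrow> nat \<Rightarrow> linop" is "\<lambda>i j. xmul i j"
  by (auto simp: linear_op_def fscale_def xpow_def fun_eq_iff algebra_simps)

lift_definition dop :: "nat \<Rightarrow> nat \<Rightarrow> linop" is dx
  by (auto simp: linear_op_def fscale_def dx_def fun_eq_iff algebra_simps)

lemma app_scop [simp]: "app (scop c) f = fscale c f" by transfer simp
lemma app_xop: "app (xop i j) f = xmul i j f" by transfer simp
lemma app_dop: "app (dop i j) f = dx i j f" by transfer simp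

lemma app_xop_apply: "app (xop i j) f e = f (e((i, j) := e (i, j) - 1))"
  by (simp add: app_xop xpow_def)

lemma app_dop_apply: "app (dop i j) f e = (e (i, j) + 1) * f (e((i, j) := e (i, j) + 1))"
  by (simp add: app_dop dx_def)

lemma comm_scop: "comm (scop c) U = 0"
  by (rule linop_eqI) (simp add: comm_def app_fscale)

lemma comm_scop_right: "comm U (scop c) = 0"
  by (rule linop_eqI) (simp add: comm_def app_fscale)

lemma comm_xop_xop: "comm (xop i j) (xop k l) = 0"
  by (rule linop_eqI) (auto simp: comm_def app_xop_apply fun_eq_iff fun_upd_twist)

lemma comm_dop_dop: "comm (dop i j) (dop k l) = 0"
  by (rule linop_eqI) (auto simp: comm_def app_dop_apply fun_eq_iff fun_upd_twist)

lemma comm_dop_xop: "comm (dop i j) (xop k l) = (if (i, j) = (k, l) then 1 else 0)"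
  by (rule linop_eqI) (auto simp: comm_def app_dop_apply app_xop_apply fun_eq_iff fun_upd_twist algebra_simps)

lemma comm_xop_dop: "comm (xop k l) (dop i j) = (if (i, j) = (k, l) then - 1 else 0)"
  using comm_dop_xop[of i j k l] comm_swap[of "xop k l" "dop i j"] by auto

section \<open>The representation of gl(n)\<close>

text \<open>
  \<open>gl n l k i j\<close> is the action of \<open>E_{i,j}\<close> on the Verma module of gl({k..n}) with highest
  weight \<open>l\<close>, in the coordinates \<open>x_{a,b}\<close> with \<open>k \<le> b < a \<le> n\<close>: it is induced, in the sense
  above, from the module of gl({k+1..n}), with column \<open>k\<close> in the role of the \<open>y\<close>s. A monomial
  stands for the product of the \<open>E_{a,b}\<close> ordered by increasing \<open>a\<close>, applied to the
  highest-weight vector.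
\<close>

function gl :: "nat \<Rightarrow> (nat \<Rightarrow> complex) \<Rightarrow> nat \<Rightarrow> nat \<Rightarrow> nat \<Rightarrow> linop" where
  "gl n l k i j =
     (if n < k then 0
      else if i = k \<and> j = k then scop (l k) - (\<Sum>m\<in>{k<..n}. xop m k * dop m k)
      else if j = k then xop i k
      else if i = k then (scop (l k) - (\<Sum>m\<in>{k<..n}. xop m k * dop m k)) * dop j k
                          - (\<Sum>m\<in>{k<..n}. gl n l (Suc k) m j * dop m k)
      else xop i k * dop j k + gl n l (Suc k) i j)"
  by auto
termination
  by (relation "measure (\<lambda>(n, l, k, i, j). Suc n - k)") auto

declare gl.simps [simp del]

lemma gl_diag: "k \<le> n \<Longrightarrow> gl n l k k k = scop (l k) - (\<Sum>m\<in>{k<..n}. xop m k * dop m k)"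
  by (subst gl.simps) simp

lemma gl_col: "k \<le> n \<Longrightarrow> i \<noteq> k \<Longrightarrow> gl n l k i k = xop i k"
  by (subst gl.simps) simp

lemma gl_row: "k \<le> n \<Longrightarrow> j \<noteq> k \<Longrightarrow> gl n l k k j =
    gl n l k k k * dop j k - (\<Sum>m\<in>{k<..n}. gl n l (Suc k) m j * dop m k)"
  by (subst gl.simps) (simp add: gl_diag)

lemma gl_rest: "k \<le> n \<Longrightarrow> i \<noteq> k \<Longrightarrow> j \<noteq> k \<Longrightarrow> gl n l k i j = xop i k * dop j k + gl n l (Suc k) i j"
  by (subst gl.simps) simp

lemma comm_gl_left_columns:
  assumes "b < k"
  shows "comm (gl n l k i j) (xop a b) = 0 \<and> comm (gl n l k i j) (dop a b) = 0"
  using assms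
proof (induction n l k i j rule: gl.induct)
  case (1 n l k i j)
  show ?case
  proof (cases "n < k")
    case True
    then show ?thesis by (subst (1 2) gl.simps) (simp add: comm_simps)
  next
    case False
    show ?thesis
      using 1 False
      by (subst (1 2) gl.simps)
         (auto simp: comm_simps comm_xop_xop comm_dop_dop comm_dop_xop comm_xop_dop comm_scop intro!: sum.neutral)
  qed
qed

text \<open>
  The brackets computed in the locale cover all cases up to antisymmetry.
\<close>

lemma comm_gl:
  assumes "1 \<le> k" "i \<in> {k..n}" "j \<in> {k..n}" "a \<in> {k..n}" "b \<in> {k..n}"
  shows "comm (gl n l k i j) (gl n l k a b) =
    (if j = a then gl n l k i b else 0) - (if b = i then gl n l k a j else 0)"
  using assms
proof (induction "Suc n - k" arbitrary: k i j a b)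
  case 0
  then show ?case by simp
next
  case (Suc t)
  have kn: "k \<le> n" using Suc.prems by auto
  interpret induced_gl "{k<..n}" "\<lambda>i. xop i k" "\<lambda>i. dop i k" "gl n l (Suc k)" "scop (l k)"
  proof
    show "finite {k<..n}" by simp
  next
    fix i j a b assume "i \<in> {k<..n}" "j \<in> {k<..n}" "a \<in> {k<..n}" "b \<in> {k<..n}"
    then show "comm (gl n l (Suc k) i j) (gl n l (Suc k) a b) =
      (if j = a then gl n l (Suc k) i b else 0) - (if b = i then gl n l (Suc k) a j else 0)"
      using Suc.hyps by (intro Suc.hyps) auto
  qed (auto simp: comm_xop_xop comm_dop_dop comm_dop_xop comm_scop comm_gl_left_columns)
  have GA: "gl n l k i j = A i j" if "i \<noteq> k" "j \<noteq> k" for i j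
    using that kn by (simp add: gl_rest A_def)
  have GL: "gl n l k k k = L"
    using kn by (simp add: gl_diag L_def N_def)
  have GD: "gl n l k k j = D j" if "j \<noteq> k" for j
    using that kn by (simp add: gl_row GL D_def)
  have GY: "gl n l k i k = xop i k" if "i \<noteq> k" for i
    using that kn by (simp add: gl_col)
  have G4: "i \<noteq> k \<Longrightarrow> i \<in> {k<..n}" "j \<noteq> k \<Longrightarrow> j \<in> {k<..n}" "a \<noteq> k \<Longrightarrow> a \<in> {k<..n}" "b \<noteq> k \<Longrightarrow> b \<in> {k<..n}"
    using Suc.prems by auto
  have A_D: "comm (A i j) (D b) = - (if b = i then D j else 0)" if "b \<noteq> k" "i \<noteq> k" "j \<noteq> k"
    using that G4 D_A[of b i j] comm_swap[of "A i j" "D b"] by auto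
  have A_L: "comm (A i j) L = 0" if "i \<noteq> k" "j \<noteq> k"
    using that G4 L_A[of i j] comm_swap[of "A i j" L] by auto
  have y_A: "comm (xop i k) (A a b) = - (if b = i then xop a k else 0)" if "a \<noteq> k" "b \<noteq> k" "i \<noteq> k"
    using that G4 A_y[of a b i] comm_swap[of "xop i k" "A a b"] by auto
  have y_L: "comm (xop i k) L = xop i k" if "i \<noteq> k"
    using that G4 L_y[of i] comm_swap[of "xop i k" L] by auto
  have y_D: "comm (xop i k) (D b) = A i b - (if b = i then L else 0)" if "i \<noteq> k" "b \<noteq> k"
    using that G4 D_y[of b i] comm_swap[of "xop i k" "D b"] by auto
  have D_L: "comm (D j) L = - D j" if "j \<noteq> k"
    using that G4 L_D[of j] comm_swap[of "D j" L] by auto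
  consider "i = k" "j = k" | "i = k" "j \<noteq> k" | "i \<noteq> k" "j = k" | "i \<noteq> k" "j \<noteq> k" by blast
  then show ?case
  proof cases
    case 1
    then show ?thesis
      using G4 by (cases "a = k"; cases "b = k") (auto simp: GA GL GD GY L_y L_D L_A comm_self)
  next
    case 2
    then show ?thesis
      using G4 by (cases "a = k"; cases "b = k") (auto simp: GA GL GD GY D_L D_D D_y D_A)
  next
    case 3
    then show ?thesis
      using G4 by (cases "a = k"; cases "b = k") (auto simp: GA GL GD GY y_L y_D y_A yy)
  next
    case 4
    then show ?thesis
      using G4 by (cases "a = k"; cases "b = k") (auto simp: GA GL GD GY A_L A_D A_y A_A)
  qed
qed

section \<open>The given operators as root vectors and coroots\<close>

text \<open>
  Each column left of \<open>min i j\<close> contributes one vector field; at column \<open>min i j\<close> itself the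
  recursion reaches one of its other cases.
\<close>

lemma gl_unroll:
  assumes "k \<le> min i j" "min i j \<le> n"
  shows "gl n l k i j = (\<Sum>a\<in>{k..<min i j}. xop i a * dop j a) + gl n l (min i j) i j"
  using assms(1)
proof (induction k rule: inc_induct)
  case base
  then show ?case by simp
next
  case (step k)
  then have "gl n l k i j = xop i k * dop j k + gl n l (Suc k) i j"
    using assms(2) by (intro gl_rest) auto
  then show ?case
    using step by (simp add: sum.atLeast_Suc_lessThan add.assoc)
qed

lemma gl_lower:
  assumes "k \<le> j" "j < i" "i \<le> n"
  shows "gl n l k i j = xop i j + (\<Sum>a\<in>{k..<j}. xop i a * dop j a)"
  using assms gl_unroll[of k i j n l] by (simp add: gl_col min_def split: if_splits)

lemma gl_diagonal:
  assumes "k \<le> i" "i \<le> n"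
  shows "gl n l k i i = scop (l i) + (\<Sum>a\<in>{k..<i}. xop i a * dop i a) - (\<Sum>m\<in>{i<..n}. xop m i * dop m i)"
  using assms gl_unroll[of k i i n l] by (simp add: gl_diag)

lemma gl_upper:
  assumes "k \<le> i" "i < j" "j \<le> n"
  shows "gl n l k i j = (\<Sum>a\<in>{k..<i}. xop i a * dop j a) + gl n l i i i * dop j i
    - (\<Sum>m\<in>{i<..n}. gl n l (Suc i) m j * dop m i)"
  using assms gl_unroll[of k i j n l] by (simp add: gl_row min_def)

text \<open>
  One of the weights of gl(n) that restrict to \<open>lam\<close>, namely the one with value \<open>0\<close> on
  \<open>E_{n,n}\<close>.
\<close>

definition gl_weight :: "nat \<Rightarrow> (nat \<Rightarrow> complex) \<Rightarrow> nat \<Rightarrow> complex" where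
  "gl_weight n lam i = (\<Sum>j\<in>{i..<n}. lam j)"

lemma gl_weight_diff: "i < n \<Longrightarrow> gl_weight n lam i - gl_weight n lam (Suc i) = lam i"
  by (simp add: gl_weight_def sum.atLeast_Suc_lessThan)

lemma greaterThan_split: "i < (n::nat) \<Longrightarrow> {i<..n} = insert (Suc i) {Suc i<..n}"
  by auto

lemma app_raising:
  assumes "1 \<le> i" "i < n"
  shows "app (gl n (gl_weight n lam) 1 i (Suc i)) z = d n lam i z"
proof -
  have G1: "gl n (gl_weight n lam) 1 i (Suc i) = (\<Sum>a\<in>{1..<i}. xop i a * dop (Suc i) a)
      + (scop (gl_weight n lam i) - (\<Sum>m\<in>{i<..n}. xop m i * dop m i)) * dop (Suc i) i
      - (\<Sum>m\<in>{i<..n}. gl n (gl_weight n lam) (Suc i) m (Suc i) * dop m i)"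
    using assms by (simp add: gl_upper gl_diag)
  have "(\<Sum>m\<in>{i<..n}. gl n (gl_weight n lam) (Suc i) m (Suc i) * dop m i)
      = (scop (gl_weight n lam (Suc i)) - (\<Sum>m\<in>{Suc i<..n}. xop m (Suc i) * dop m (Suc i))) * dop (Suc i) i
        + (\<Sum>m\<in>{Suc i<..n}. xop m (Suc i) * dop m i)"
    using assms by (subst greaterThan_split) (auto simp: gl_diag gl_col intro!: sum.cong)
  then have G2: "gl n (gl_weight n lam) 1 i (Suc i) =
      (scop (gl_weight n lam i) - scop (gl_weight n lam (Suc i)) - (\<Sum>m\<in>{i<..n}. xop m i * dop m i)
        + (\<Sum>m\<in>{Suc i<..n}. xop m (Suc i) * dop m (Suc i))) * dop (Suc i) i
      + (\<Sum>a\<in>{1..<i}. xop i a * dop (Suc i) a) - (\<Sum>m\<in>{Suc i<..n}. xop m (Suc i) * dop m i)"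
    unfolding G1 by (simp add: algebra_simps)
  have sets: "{i<..n} = {i+1..n}" "{Suc i<..n} = {i+2..n}"
    by auto
  have "fscale (gl_weight n lam i) y - fscale (gl_weight n lam (Suc i)) y = fscale (lam i) y" for y
    using gl_weight_diff[OF assms(2), of lam] by (simp add: fscale_def fun_eq_iff flip: left_diff_distrib)
  then show ?thesis
    unfolding G2 d_def Let_def sets
    by (simp add: app_xop app_dop)
qed

lemma app_xop_dop: "app (xop i j * dop i j) f e = e (i, j) * f e"
  by (simp add: app_xop_apply app_dop_apply)

text \<open>
  The weight of the monomial with exponents \<open>e\<close>; the variable \<open>x_{i,a}\<close> has weight \<open>\<epsilon>_i - \<epsilon>_a\<close>.
\<close>

definition weight_of :: "nat \<Rightarrow> (nat \<Rightarrow> complex) \<Rightarrow> exponents \<Rightarrow> nat \<Rightarrow> complex" where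
  "weight_of n l e i = l i + (\<Sum>a\<in>{1..<i}. e (i, a)) - (\<Sum>m\<in>{i<..n}. e (m, i))"

lemma app_gl_diagonal:
  assumes "1 \<le> i" "i \<le> n"
  shows "app (gl n l 1 i i) f e = weight_of n l e i * f e"
  unfolding gl_diagonal[OF assms] weight_of_def
  by (simp del: app_mult add: app_xop_dop sum_apply fscale_def sum_distrib_right sum_distrib_left algebra_simps)

lemma zeta_apply:
  assumes "1 \<le> i" "i < n"
  shows "zeta n lam i f e = (weight_of n (gl_weight n lam) e i - weight_of n (gl_weight n lam) e (Suc i)) * f e"
proof -
  have xd: "xmul a b (dx a b f) e = e (a, b) * f e" for a b
    using app_xop_dop[of a b f e] by (simp add: app_xop app_dop)
  have s1: "(\<Sum>m\<in>{i<..n}. e (m, i)) = e (Suc i, i) + (\<Sum>m\<in>{i+2..n}. e (m, i))"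
    using assms by (subst greaterThan_split) (auto intro!: sum.cong)
  have s2: "{Suc i<..n} = {i+2..n}" by auto
  have s3: "(\<Sum>a\<in>{1..<Suc i}. e (Suc i, a)) = (\<Sum>a\<in>{1..<i}. e (Suc i, a)) + e (Suc i, i)"
    using assms by (simp add: sum.atLeastLessThan_Suc)
  have w: "weight_of n (gl_weight n lam) e i - weight_of n (gl_weight n lam) e (Suc i) =
     lam i + (\<Sum>a\<in>{1..<i}. e (i, a) - e (Suc i, a)) + (\<Sum>m\<in>{i+2..n}. e (m, Suc i) - e (m, i))
      - 2 * e (Suc i, i)"
  proof -
    have "a + b - (c + u) - (a' + (b' + c) - u') = (a - a') + (b - b') + (u' - u) - 2 * c"
      for a b c u a' b' u' :: complex
      by simp
    note eq = this
    show ?thesis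
      unfolding weight_of_def s1 s2 s3 sum_subtractf
      by (subst gl_weight_diff[OF assms(2), symmetric]) (rule eq)
  qed
  show ?thesis
    unfolding w zeta_def
    by (simp add: xd sum_apply fscale_def sum_distrib_right algebra_simps sum_subtractf sum_distrib_left)
qed

lemma sum_tri_swap:
  "(\<Sum>i\<in>{1..n}. \<Sum>a\<in>{1..<i}. f i a) = (\<Sum>a\<in>{1..n}. \<Sum>m\<in>{a<..n}. f m a)"
  for f :: "nat \<Rightarrow> nat \<Rightarrow> 'a::comm_monoid_add"
proof -
  have "(\<Sum>i\<in>{1..n}. \<Sum>a\<in>{1..<i}. f i a) = (\<Sum>i\<in>{1..n}. \<Sum>a\<in>{1..n}. if a < i then f i a else 0)"
    by (intro sum.cong[OF refl] sum.mono_neutral_cong_left) auto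
  also have "\<dots> = (\<Sum>a\<in>{1..n}. \<Sum>i\<in>{1..n}. if a < i then f i a else 0)"
    by (rule sum.swap)
  also have "\<dots> = (\<Sum>a\<in>{1..n}. \<Sum>m\<in>{a<..n}. f m a)"
    by (intro sum.cong[OF refl] sum.mono_neutral_cong_right) auto
  finally show ?thesis .
qed

lemma sum_weight_of: "(\<Sum>i\<in>{1..n}. weight_of n l e i) = (\<Sum>i\<in>{1..n}. l i)"
  using sum_tri_swap[of "\<lambda>i a. e (i, a)" n]
  by (simp add: weight_of_def sum.distrib sum_subtractf)

text \<open>
  The values of a weight on the \<open>h_i\<close> determine it up to a constant, and the constant is fixed
  because the identity matrix acts by the same scalar on all monomials.
\<close>

lemma weight_of_eqI:
  assumes "\<And>i. i \<in> {1..<n} \<Longrightarrow> weight_of n l e i - weight_of n l e (Suc i) = weight_of n l e' i - weight_of n l e' (Suc i)"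
    and "i \<in> {1..n}"
  shows "weight_of n l e i = weight_of n l e' i"
proof -
  define c where "c i = weight_of n l e i - weight_of n l e' i" for i
  have c: "c j = c n" if "j \<in> {1..n}" for j
  proof -
    have "j \<le> n" "1 \<le> j" using that by auto
    then show ?thesis
    proof (induction j rule: inc_induct)
      case base
      then show ?case by simp
    next
      case (step m)
      have "c m = c (Suc m)"
        using assms(1)[of m] step.prems step.hyps by (simp add: c_def algebra_simps)
      then show ?case
        using step by simp
    qed
  qed
  have "(\<Sum>i\<in>{1..n}. c i) = 0"
    unfolding c_def sum_subtractf sum_weight_of by simp
  moreover have "(\<Sum>i\<in>{1..n}. c i) = (\<Sum>i\<in>{1..n}. c n)"
    by (rule sum.cong[OF refl c])
  ultimately have "c n = 0"
    using assms(2) by auto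
  then show ?thesis
    using c[OF assms(2)] by (simp add: c_def)
qed

section \<open>Operators with polynomial coefficients\<close>

inductive polyfun :: "(exponents \<Rightarrow> complex) \<Rightarrow> bool" where
  polyfun_const: "polyfun (\<lambda>e. c)"
| polyfun_coord: "polyfun (\<lambda>e. e q)"
| polyfun_add: "polyfun u \<Longrightarrow> polyfun v \<Longrightarrow> polyfun (\<lambda>e. u e + v e)"
| polyfun_mult: "polyfun u \<Longrightarrow> polyfun v \<Longrightarrow> polyfun (\<lambda>e. u e * v e)"

lemma polyfun_sum: "(\<And>i. i \<in> I \<Longrightarrow> polyfun (u i)) \<Longrightarrow> polyfun (\<lambda>e. \<Sum>i\<in>I. u i e)"
  by (induction I rule: infinite_finite_induct) (auto intro: polyfun.intros)

lemma polyfun_shift: "polyfun u \<Longrightarrow> polyfun (\<lambda>e. u (e + s))"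
proof (induction rule: polyfun.induct)
  case (polyfun_coord q)
  then show ?case by (simp add: polyfun.intros)
qed (auto intro: polyfun.intros)

lemma polyfun_line: "polyfun u \<Longrightarrow> \<exists>w. \<forall>t. u (\<lambda>q. e q + t * v q) = poly w t"
proof (induction rule: polyfun.induct)
  case (polyfun_const c)
  show ?case by (rule exI[of _ "[:c:]"]) simp
next
  case (polyfun_coord q)
  show ?case by (rule exI[of _ "[:e q, v q:]"]) simp
next
  case (polyfun_add u v)
  then show ?case by (metis poly_add)
next
  case (polyfun_mult u v)
  then show ?case by (metis poly_mult)
qed

lemma poly_eq_0_of_nat:
  assumes "\<And>k::nat. poly w (of_nat k :: complex) = 0"
  shows "w = 0"
proof (rule ccontr)
  assume "w \<noteq> 0"
  then have "finite {x. poly w x = 0}"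
    by (rule poly_roots_finite)
  moreover have "range (of_nat :: nat \<Rightarrow> complex) \<subseteq> {x. poly w x = 0}"
    using assms by auto
  ultimately have "finite (range (of_nat :: nat \<Rightarrow> complex))"
    by (rule rev_finite_subset)
  then show False
    using finite_imageD[of "of_nat :: nat \<Rightarrow> complex" UNIV] by (auto simp: inj_on_def)
qed

text \<open>
  The natural points are Zariski dense. One coordinate after the other may be freed, because
  along a coordinate line the function is a polynomial in one variable with infinitely many
  zeros.
\<close>

lemma polyfun_zero_dense:
  assumes "polyfun u" "finite Q"
    and zero: "\<And>e. (\<And>q. q \<in> Q \<Longrightarrow> e q \<in> \<nat>) \<Longrightarrow> (\<And>q. q \<notin> Q \<Longrightarrow> e q = 0) \<Longrightarrow> u e = 0"
    and "\<And>q. q \<notin> Q \<Longrightarrow> e q = 0"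
  shows "u e = 0"
proof -
  have "A \<subseteq> Q \<Longrightarrow> (\<And>q. q \<in> Q - A \<Longrightarrow> e q \<in> \<nat>) \<Longrightarrow> (\<And>q. q \<notin> Q \<Longrightarrow> e q = 0) \<Longrightarrow> u e = 0"
    if "finite A" for A e
    using that
  proof (induction A arbitrary: e rule: finite_induct)
    case empty
    then show ?case using zero by auto
  next
    case (insert a A)
    obtain w where w: "\<And>t. u (\<lambda>q. (e(a := 0)) q + t * ((\<lambda>_. 0)(a := 1)) q) = poly w t"
      using polyfun_line[OF assms(1)] by metis
    have upd: "(\<lambda>q. (e(a := 0)) q + t * ((\<lambda>_. 0)(a := 1)) q) = e(a := t)" for t
      by auto
    have "poly w (of_nat k) = 0" for k
    proof -
      have "u (e(a := of_nat k)) = 0"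
        using insert.prems insert.hyps by (intro insert.IH) auto
      then show ?thesis
        using w[of "of_nat k"] unfolding upd by simp
    qed
    then have "w = 0"
      by (rule poly_eq_0_of_nat)
    then show ?case
      using w[of "e a"] unfolding upd by simp
  qed
  from this[OF assms(2)] show ?thesis
    using assms(4) by auto
qed

text \<open>
  Operators that combine finitely many shifts of the exponents, with coefficients that are
  polynomial in the exponents. Such an operator is determined by its values on ordinary
  monomials, which carries identities of the Verma module over to series with complex exponents.
\<close>

definition polyop :: "linop \<Rightarrow> bool" where
  "polyop U \<longleftrightarrow> (\<exists>S p. finite S \<and> (\<forall>s. polyfun (p s)) \<and>
     (\<forall>f e. app U f e = (\<Sum>s\<in>S. p s e * f (e + s))))"

lemma polyop_scop: "polyop (scop c)"
  unfolding polyop_def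
  by (rule exI[of _ "{0}"], rule exI[of _ "\<lambda>_ _. c"])
     (auto simp: fscale_def polyfun.intros zero_fun_def plus_fun_def)

lemma upd_plus: "e(q := e q + c) = e + (\<lambda>_. 0)(q := c)" for e :: exponents
  by (auto simp: fun_eq_iff)

lemma polyop_xop: "polyop (xop i j)"
  unfolding polyop_def
  by (rule exI[of _ "{(\<lambda>_. 0)((i, j) := - 1)}"], rule exI[of _ "\<lambda>_ _. 1"])
     (auto simp: app_xop_apply polyfun.intros upd_plus[symmetric])

lemma polyop_dop: "polyop (dop i j)"
  unfolding polyop_def
  by (rule exI[of _ "{(\<lambda>_. 0)((i, j) := 1)}"], rule exI[of _ "\<lambda>_ e. e (i, j) + 1"])
     (auto simp: app_dop_apply intro!: polyfun.intros simp flip: upd_plus)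

lemma polyop_add:
  assumes "polyop U" "polyop V"
  shows "polyop (U + V)"
proof -
  obtain S p where U: "finite S" "\<And>s. polyfun (p s)" "\<And>f e. app U f e = (\<Sum>s\<in>S. p s e * f (e + s))"
    using assms(1) unfolding polyop_def by blast
  obtain S' p' where V: "finite S'" "\<And>s. polyfun (p' s)" "\<And>f e. app V f e = (\<Sum>s\<in>S'. p' s e * f (e + s))"
    using assms(2) unfolding polyop_def by blast
  define r where "r s = (\<lambda>e. (if s \<in> S then p s e else 0) + (if s \<in> S' then p' s e else 0))" for s
  have "polyfun (r s)" for s
    unfolding r_def using U(2) V(2) by (cases "s \<in> S"; cases "s \<in> S'") (auto intro: polyfun.intros)
  moreover have "app (U + V) f e = (\<Sum>s\<in>S \<union> S'. r s e * f (e + s))" for f e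
  proof -
    have "app U f e = (\<Sum>s\<in>S \<union> S'. (if s \<in> S then p s e else 0) * f (e + s))"
      unfolding U(3) using U(1) V(1) by (intro sum.mono_neutral_cong_left) auto
    moreover have "app V f e = (\<Sum>s\<in>S \<union> S'. (if s \<in> S' then p' s e else 0) * f (e + s))"
      unfolding V(3) using U(1) V(1) by (intro sum.mono_neutral_cong_left) auto
    ultimately show ?thesis
      by (simp add: r_def distrib_right sum.distrib)
  qed
  ultimately show ?thesis
    unfolding polyop_def using U(1) V(1) by blast
qed

lemma polyop_mult:
  assumes "polyop U" "polyop V"
  shows "polyop (U * V)"
proof -
  obtain S p where U: "finite S" "\<And>s. polyfun (p s)" "\<And>f e. app U f e = (\<Sum>s\<in>S. p s e * f (e + s))"
    using assms(1) unfolding polyop_def by blast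
  obtain S' p' where V: "finite S'" "\<And>s. polyfun (p' s)" "\<And>f e. app V f e = (\<Sum>s\<in>S'. p' s e * f (e + s))"
    using assms(2) unfolding polyop_def by blast
  define R where "R = (\<lambda>(s, s'). s + s') ` (S \<times> S')"
  define r where "r t = (\<lambda>e. \<Sum>x\<in>{x \<in> S \<times> S'. fst x + snd x = t}. p (fst x) e * p' (snd x) (e + fst x))" for t
  have "polyfun (r t)" for t
    unfolding r_def using U(2) V(2) by (intro polyfun_sum polyfun_mult polyfun_shift) auto
  moreover have "app (U * V) f e = (\<Sum>t\<in>R. r t e * f (e + t))" for f e
  proof -
    have "app (U * V) f e = (\<Sum>x\<in>S \<times> S'. p (fst x) e * p' (snd x) (e + fst x) * f (e + (fst x + snd x)))"
      by (simp add: U(3) V(3) sum_distrib_left sum.cartesian_product case_prod_unfold mult.assoc add.assoc)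
    also have "\<dots> = (\<Sum>t\<in>R. \<Sum>x\<in>{x \<in> S \<times> S'. fst x + snd x = t}.
        p (fst x) e * p' (snd x) (e + fst x) * f (e + (fst x + snd x)))"
      using U(1) V(1) by (intro sum.group[symmetric]) (auto simp: R_def)
    also have "\<dots> = (\<Sum>t\<in>R. r t e * f (e + t))"
      by (intro sum.cong refl) (simp add: r_def sum_distrib_right)
    finally show ?thesis .
  qed
  ultimately show ?thesis
    unfolding polyop_def using U(1) V(1) by (intro exI[of _ R] exI[of _ r]) (auto simp: R_def)
qed

lemma polyop_zero: "polyop 0"
proof -
  have "0 = scop 0" by (rule linop_eqI) (simp add: fscale_def zero_fun_def)
  then show ?thesis by (metis polyop_scop)
qed

lemma polyop_one: "polyop 1"
proof -
  have "1 = scop 1" by (rule linop_eqI) (simp add: fscale_def)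
  then show ?thesis by (metis polyop_scop)
qed

lemma polyop_uminus: "polyop U \<Longrightarrow> polyop (- U)"
proof -
  assume "polyop U"
  moreover have "- U = scop (- 1) * U"
    by (rule linop_eqI) (simp add: fscale_def fun_eq_iff)
  ultimately show ?thesis by (metis polyop_mult polyop_scop)
qed

lemma polyop_diff: "polyop U \<Longrightarrow> polyop V \<Longrightarrow> polyop (U - V)"
  using polyop_add[of U "- V"] polyop_uminus[of V] by simp

lemma polyop_sum: "(\<And>i. i \<in> I \<Longrightarrow> polyop (u i)) \<Longrightarrow> polyop (\<Sum>i\<in>I. u i)"
  by (induction I rule: infinite_finite_induct) (auto intro: polyop_add polyop_zero)

lemmas polyop_intros = polyop_scop polyop_xop polyop_dop polyop_add polyop_mult polyop_zero polyop_one polyop_diff polyop_sum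

lemma polyop_gl: "polyop (gl n l k i j)"
proof (induction n l k i j rule: gl.induct)
  case (1 n l k i j)
  then show ?case
    by (subst gl.simps) (auto intro!: polyop_intros)
qed

text \<open>
  The coefficient with which the operator moves \<open>e\<close> to \<open>e - s\<close> is a polynomial in \<open>e\<close>. It
  vanishes at all natural \<open>e\<close>, hence identically.
\<close>

lemma fmonom_dense:
  assumes "polyop U" "finite Q"
    and zero: "\<And>e. (\<And>q. q \<in> Q \<Longrightarrow> e q \<in> \<nat>) \<Longrightarrow> (\<And>q. q \<notin> Q \<Longrightarrow> e q = 0) \<Longrightarrow> app U (fmonom e) = 0"
    and supp: "\<And>e q. f e \<noteq> 0 \<Longrightarrow> q \<notin> Q \<Longrightarrow> e q = 0"
  shows "app U f = 0"
proof
  fix e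
  obtain S p where U: "finite S" "\<And>s. polyfun (p s)" "\<And>f e. app U f e = (\<Sum>s\<in>S. p s e * f (e + s))"
    using assms(1) unfolding polyop_def by blast
  have *: "p s (e - s) = 0" if "s \<in> S" and e: "\<And>q. q \<notin> Q \<Longrightarrow> e q = 0" for s e
  proof (rule polyfun_zero_dense[where u = "\<lambda>e. p s (e - s)", OF _ assms(2) _ e])
    show "polyfun (\<lambda>e. p s (e - s))"
      using polyfun_shift[OF U(2), of s "- s"] by simp
  next
    fix e :: exponents
    assume e: "\<And>q. q \<in> Q \<Longrightarrow> e q \<in> \<nat>" "\<And>q. q \<notin> Q \<Longrightarrow> e q = 0"
    have eq: "e - s + t = e \<longleftrightarrow> t = s" for t
      by (auto simp: fun_eq_iff)
    have "app U (fmonom e) (e - s) = (\<Sum>t\<in>S. if t = s then p t (e - s) else 0)"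
      unfolding U(3) fmonom_def eq by (intro sum.cong) auto
    also have "\<dots> = p s (e - s)"
      using U(1) \<open>s \<in> S\<close> by simp
    finally show "p s (e - s) = 0"
      using zero[OF e] by simp
  qed auto
  have "p s e * f (e + s) = 0" if "s \<in> S" for s
    using *[OF that, of "e + s"] supp[of "e + s"] by (cases "f (e + s) = 0") auto
  then show "app U f e = 0 e"
    by (auto simp: U(3) intro!: sum.neutral)
qed

section \<open>Operators that respect the exponent set\<close>

text \<open>
  The positions of the variables.
\<close>

definition tri :: "nat \<Rightarrow> (nat \<times> nat) set" where
  "tri n = {(i, j). 1 \<le> j \<and> j < i \<and> i \<le> n}"

definition supported :: "nat \<Rightarrow> series \<Rightarrow> bool" where
  "supported n f \<longleftrightarrow> {e. f e \<noteq> 0} \<subseteq> exponents_of n"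

lemma finite_tri: "finite (tri n)"
  by (rule finite_subset[of _ "{..n} \<times> {..n}"]) (auto simp: tri_def)

lemma supportedD: "supported n f \<Longrightarrow> f e \<noteq> 0 \<Longrightarrow> e \<in> exponents_of n"
  by (auto simp: supported_def)

lemma supported_add: "supported n f \<Longrightarrow> supported n g \<Longrightarrow> supported n (f + g)"
  by (force simp: supported_def)

lemma supported_diff: "supported n f \<Longrightarrow> supported n g \<Longrightarrow> supported n (f - g)"
  by (force simp: supported_def)

lemma supported_fscale: "supported n f \<Longrightarrow> supported n (fscale c f)"
  by (auto simp: supported_def fscale_def)

lemma supported_zero: "supported n 0"
  by (simp add: supported_def)

definition preserves :: "nat \<Rightarrow> linop \<Rightarrow> bool" where
  "preserves n U \<longleftrightarrow> (\<forall>f. supported n f \<longrightarrow> supported n (app U f))"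

lemma exponents_of_upd:
  assumes e: "e((i, j) := c) \<in> exponents_of n" and ij: "(i, j) \<in> tri n"
    and nat: "j + 2 \<le> i \<Longrightarrow> c \<in> \<nat> \<Longrightarrow> e (i, j) \<in> \<nat>"
  shows "e \<in> exponents_of n"
proof -
  have z: "(e((i, j) := c)) (a, b) = 0" if "\<not> (1 \<le> b \<and> b < a \<and> a \<le> n)" for a b
    using e that unfolding exponents_of_def by blast
  have m: "(e((i, j) := c)) (a, b) \<in> \<nat>" if "1 \<le> b \<and> b + 2 \<le> a \<and> a \<le> n" for a b
    using e that unfolding exponents_of_def by blast
  have "e (a, b) = 0" if "\<not> (1 \<le> b \<and> b < a \<and> a \<le> n)" for a b
    using z[OF that] that ij by (cases "a = i \<and> b = j") (auto simp: tri_def split: if_splits)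
  moreover have "e (a, b) \<in> \<nat>" if "1 \<le> b \<and> b + 2 \<le> a \<and> a \<le> n" for a b
  proof (cases "(a, b) = (i, j)")
    case True
    then show ?thesis using m[OF that] nat that by simp
  next
    case False
    then show ?thesis using m[OF that] by (simp del: prod.inject)
  qed
  ultimately show ?thesis
    unfolding exponents_of_def by blast
qed

lemma preserves_xop:
  assumes "(i, j) \<in> tri n"
  shows "preserves n (xop i j)"
  unfolding preserves_def supported_def
proof (intro allI impI subsetI)
  fix f e
  assume f: "{e. f e \<noteq> 0} \<subseteq> exponents_of n" and e: "e \<in> {e. app (xop i j) f e \<noteq> 0}"
  have "e((i, j) := e (i, j) - 1) \<in> exponents_of n"
    using f e by (auto simp: app_xop_apply)
  then show "e \<in> exponents_of n"
  proof (rule exponents_of_upd[OF _ assms])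
    assume "e (i, j) - 1 \<in> \<nat>"
    then have "e (i, j) - 1 + 1 \<in> \<nat>" by (intro Nats_add Nats_1)
    then show "e (i, j) \<in> \<nat>" by simp
  qed
qed

text \<open>
  A derivative could produce the exponent \<open>-1\<close>, but there its coefficient is zero.
\<close>

lemma preserves_dop:
  assumes "(i, j) \<in> tri n"
  shows "preserves n (dop i j)"
  unfolding preserves_def supported_def
proof (intro allI impI subsetI)
  fix f e
  assume f: "{e. f e \<noteq> 0} \<subseteq> exponents_of n" and e: "e \<in> {e. app (dop i j) f e \<noteq> 0}"
  have "e((i, j) := e (i, j) + 1) \<in> exponents_of n" and ne: "e (i, j) + 1 \<noteq> 0"
    using f e by (auto simp: app_dop_apply)
  from this(1) show "e \<in> exponents_of n"
  proof (rule exponents_of_upd[OF _ assms])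
    assume "e (i, j) + 1 \<in> \<nat>"
    then obtain m where m: "e (i, j) + 1 = of_nat m" by (auto elim: Nats_cases)
    with ne obtain m' where "m = Suc m'" by (cases m) auto
    with m have "e (i, j) = of_nat m'" by (simp add: add.commute)
    then show "e (i, j) \<in> \<nat>" by simp
  qed
qed

lemma preserves_scop: "preserves n (scop c)"
  by (simp add: preserves_def supported_fscale)

lemma preserves_zero: "preserves n 0"
  by (simp add: preserves_def supported_zero)

lemma preserves_add: "preserves n U \<Longrightarrow> preserves n V \<Longrightarrow> preserves n (U + V)"
  by (simp add: preserves_def supported_add)

lemma preserves_diff: "preserves n U \<Longrightarrow> preserves n V \<Longrightarrow> preserves n (U - V)"
  by (simp add: preserves_def supported_diff)

lemma preserves_mult: "preserves n U \<Longrightarrow> preserves n V \<Longrightarrow> preserves n (U * V)"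
  by (simp add: preserves_def)

lemma preserves_sum: "(\<And>i. i \<in> I \<Longrightarrow> preserves n (u i)) \<Longrightarrow> preserves n (\<Sum>i\<in>I. u i)"
  by (induction I rule: infinite_finite_induct) (auto intro: preserves_add preserves_zero)

lemma preserves_power: "preserves n U \<Longrightarrow> preserves n (U ^ a)"
  by (induction a) (simp_all add: preserves_def)

lemmas preserves_intros = preserves_scop preserves_xop preserves_dop preserves_add preserves_mult preserves_zero preserves_diff preserves_sum

lemma preserves_gl: "1 \<le> k \<Longrightarrow> i \<in> {k..n} \<Longrightarrow> j \<in> {k..n} \<Longrightarrow> preserves n (gl n l k i j)"
proof (induction n l k i j rule: gl.induct)
  case (1 n l k i j)
  then show ?case
    by (subst gl.simps) (auto intro!: preserves_intros simp: tri_def)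
qed

section \<open>Singular series\<close>

definition singular :: "nat \<Rightarrow> (nat \<Rightarrow> complex) \<Rightarrow> series \<Rightarrow> bool" where
  "singular n l z \<longleftrightarrow> (\<forall>i\<in>{1..<n}. app (gl n l 1 i (Suc i)) z = 0)"

text \<open>
  Weight vectors for gl(n), in a given Verma module.
\<close>

definition has_weight :: "nat \<Rightarrow> (nat \<Rightarrow> complex) \<Rightarrow> (nat \<Rightarrow> complex) \<Rightarrow> series \<Rightarrow> bool" where
  "has_weight n l M f \<longleftrightarrow> supported n f \<and> (\<forall>e. f e \<noteq> 0 \<longrightarrow> (\<forall>i\<in>{1..n}. weight_of n l e i = M i))"

lemma fscale_zero: "fscale c 0 = 0"
  by (auto simp: fscale_def)

lemma comm_appD: "comm U V = W \<Longrightarrow> app U (app V f) = app V (app U f) + app W f"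
proof -
  assume "comm U V = W"
  then have "U * V = V * U + W" by (auto simp: comm_def)
  then have "app (U * V) f = app (V * U + W) f" by simp
  then show ?thesis by simp
qed

text \<open>
  Each positive root vector is an iterated bracket of simple ones.
\<close>

lemma singular_all:
  assumes "singular n l z" "1 \<le> i" "i < j" "j \<le> n"
  shows "app (gl n l 1 i j) z = 0"
  using assms(3,4)
proof (induction j rule: less_induct)
  case (less j)
  then obtain t where t: "j = Suc t" by (cases j) auto
  show ?case
  proof (cases "i = t")
    case True
    then show ?thesis using assms(1,2) less.prems t by (auto simp: singular_def)
  next
    case False
    then have "comm (gl n l 1 i t) (gl n l 1 t j) = gl n l 1 i j"
      using comm_gl[of 1 i n t t j l] less.prems t assms(2) by auto
    from comm_appD[OF this, of z]
    have eq: "app (gl n l 1 i t) (app (gl n l 1 t j) z) = app (gl n l 1 t j) (app (gl n l 1 i t) z) + app (gl n l 1 i j) z" .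
    have a: "app (gl n l 1 t j) z = 0"
      using False less.prems t assms(1,2) by (auto simp: singular_def)
    have b: "app (gl n l 1 i t) z = 0"
      using less.IH[of t] False less.prems t by auto
    show ?thesis
      using eq unfolding a b app_zero_arg by simp
  qed
qed

section \<open>Leading monomials of singular series\<close>

text \<open>
  A grading in which the variables \<open>x_{j+1,j}\<close> count twice. For \<open>i < j\<close> the action of \<open>E_{i,j}\<close>
  then raises the grade by at most one, and the part that raises it by one consists of the two
  terms \<open>x_{i,i-1} \<partial>_{j,i-1}\<close> and \<open>- x_{j+1,j} \<partial>_{j+1,i}\<close>: in the other vector fields the
  variable on the left counts once, a bare derivative lowers the grade, and a term with two or
  more derivatives gains at most \<open>2\<close> from its single multiplication and loses at least \<open>1\<close> with
  each derivative.
\<close>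

definition var_grade :: "nat \<Rightarrow> nat \<Rightarrow> nat" where
  "var_grade i j = (if i = Suc j then 2 else 1)"

definition grade :: "nat \<Rightarrow> exponents \<Rightarrow> complex" where
  "grade n e = (\<Sum>(i, j)\<in>tri n. of_nat (var_grade i j) * e (i, j))"

lemma grade_upd: "(i, j) \<in> tri n \<Longrightarrow> grade n (e((i, j) := c)) = grade n e + of_nat (var_grade i j) * (c - e (i, j))"
proof -
  assume ij: "(i, j) \<in> tri n"
  have 1: "grade n f = of_nat (var_grade i j) * f (i, j) + (\<Sum>(i, j)\<in>tri n - {(i, j)}. of_nat (var_grade i j) * f (i, j))" for f
    unfolding grade_def using ij by (subst sum.remove[OF finite_tri]) auto
  have 2: "(\<Sum>(a, b)\<in>tri n - {(i, j)}. of_nat (var_grade a b) * (e((i, j) := c)) (a, b)) =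
    (\<Sum>(a, b)\<in>tri n - {(i, j)}. of_nat (var_grade a b) * e (a, b))"
    by (intro sum.cong) (auto split: if_splits)
  show ?thesis
    unfolding 1 2 by (simp add: algebra_simps)
qed

text \<open>
  \<open>U\<close> raises the grade by at most \<open>k\<close>, expressed through the coefficients on which a given
  coefficient of \<open>U f\<close> depends. Grades are complex numbers, so they are compared only when they
  differ by an integer.
\<close>

definition grade_le :: "nat \<Rightarrow> int \<Rightarrow> linop \<Rightarrow> bool" where
  "grade_le n k U \<longleftrightarrow> (\<forall>f e. (\<forall>e' m. - k \<le> m \<longrightarrow> grade n e' = grade n e + of_int m \<longrightarrow> f e' = 0) \<longrightarrow> app U f e = 0)"

lemma grade_leD: "grade_le n k U \<Longrightarrow> (\<And>e' m. - k \<le> m \<Longrightarrow> grade n e' = grade n e + of_int m \<Longrightarrow> f e' = 0) \<Longrightarrow> app U f e = 0"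
  unfolding grade_le_def by blast

lemma grade_le_mono: "grade_le n k U \<Longrightarrow> k \<le> k' \<Longrightarrow> grade_le n k' U"
  unfolding grade_le_def by (meson neg_le_iff_le order_trans)

lemma grade_le_xop: "(i, j) \<in> tri n \<Longrightarrow> grade_le n (int (var_grade i j)) (xop i j)"
  unfolding grade_le_def
proof (intro allI impI)
  fix f :: series and e
  assume ij: "(i, j) \<in> tri n" and *: "\<forall>e' m. - int (var_grade i j) \<le> m \<longrightarrow> grade n e' = grade n e + of_int m \<longrightarrow> f e' = 0"
  show "app (xop i j) f e = 0"
    unfolding app_xop_apply
    by (rule *[rule_format, of "- int (var_grade i j)"]) (simp_all add: grade_upd[OF ij])
qed

lemma grade_le_dop: "(i, j) \<in> tri n \<Longrightarrow> grade_le n (- int (var_grade i j)) (dop i j)"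
  unfolding grade_le_def
proof (intro allI impI)
  fix f :: series and e
  assume ij: "(i, j) \<in> tri n" and *: "\<forall>e' m. - (- int (var_grade i j)) \<le> m \<longrightarrow> grade n e' = grade n e + of_int m \<longrightarrow> f e' = 0"
  have "f (e((i, j) := e (i, j) + 1)) = 0"
    by (rule *[rule_format, of "int (var_grade i j)"]) (simp_all add: grade_upd[OF ij])
  then show "app (dop i j) f e = 0"
    unfolding app_dop_apply by simp
qed

lemma grade_le_mult: "grade_le n k U \<Longrightarrow> grade_le n k' V \<Longrightarrow> grade_le n (k + k') (U * V)"
  unfolding grade_le_def[of n "k + k'"]
proof (intro allI impI)
  fix f :: series and e
  assume U: "grade_le n k U" and V: "grade_le n k' V"
    and *: "\<forall>e' m. - (k + k') \<le> m \<longrightarrow> grade n e' = grade n e + of_int m \<longrightarrow> f e' = 0"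
  have "app U (app V f) e = 0"
  proof (rule grade_leD[OF U])
    fix e' m assume m: "- k \<le> m" "grade n e' = grade n e + of_int m"
    show "app V f e' = 0"
    proof (rule grade_leD[OF V])
      fix e'' m' assume m': "- k' \<le> m'" "grade n e'' = grade n e' + of_int m'"
      show "f e'' = 0"
        by (rule *[rule_format, of "m + m'"]) (use m m' in auto)
    qed
  qed
  then show "app (U * V) f e = 0" by simp
qed

lemma grade_le_add: "grade_le n k U \<Longrightarrow> grade_le n k V \<Longrightarrow> grade_le n k (U + V)"
  unfolding grade_le_def by simp

lemma grade_le_diff: "grade_le n k U \<Longrightarrow> grade_le n k V \<Longrightarrow> grade_le n k (U - V)"
  unfolding grade_le_def by simp

lemma grade_le_zero: "grade_le n k 0"
  unfolding grade_le_def by simp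

lemma grade_le_sum: "(\<And>i. i \<in> I \<Longrightarrow> grade_le n k (u i)) \<Longrightarrow> grade_le n k (\<Sum>i\<in>I. u i)"
  by (induction I rule: infinite_finite_induct) (auto intro: grade_le_add grade_le_zero)

lemma grade_le_scop: "grade_le n 0 (scop c)"
  unfolding grade_le_def
proof (intro allI impI)
  fix f :: series and e
  assume "\<forall>e' m. - 0 \<le> m \<longrightarrow> grade n e' = grade n e + of_int m \<longrightarrow> f e' = 0"
  from this[rule_format, of 0 e] show "app (scop c) f e = 0"
    by (simp add: fscale_def)
qed

lemma grade_le_xop_dop:
  assumes "(i, j) \<in> tri n" "(k, l) \<in> tri n" "int (var_grade i j) - int (var_grade k l) \<le> t"
  shows "grade_le n t (xop i j * dop k l)"
  by (rule grade_le_mono[OF grade_le_mult[OF grade_le_xop[OF assms(1)] grade_le_dop[OF assms(2)]]]) (use assms(3) in simp)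

lemma var_grade_far: "Suc j < i \<Longrightarrow> var_grade i j = 1"
  by (simp add: var_grade_def)

lemma var_grade_bounds: "1 \<le> var_grade i j" "var_grade i j \<le> 2"
  by (simp_all add: var_grade_def)

lemma grade_le_gl_lower:
  assumes "1 \<le> k" "k \<le> j" "j < i" "i \<le> n"
  shows "grade_le n (int (var_grade i j)) (gl n l k i j)"
proof -
  have "grade_le n (int (var_grade i j)) (xop i a * dop j a)" if "a \<in> {k..<j}" for a
    using assms that var_grade_bounds[of j a] var_grade_far[of a i] by (intro grade_le_xop_dop) (auto simp: tri_def)
  then show ?thesis
    unfolding gl_lower[OF assms(2-4)] using assms
    by (intro grade_le_add grade_le_sum grade_le_xop) (auto simp: tri_def)
qed

lemma grade_le_gl_diag:
  assumes "1 \<le> k" "k \<le> i" "i \<le> n"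
  shows "grade_le n 0 (gl n l k i i)"
  unfolding gl_diagonal[OF assms(2,3)] using assms
  by (intro grade_le_add grade_le_diff grade_le_sum grade_le_xop_dop grade_le_scop) (auto simp: tri_def)

text \<open>
  The two leading terms are taken off; the statement for \<open>E_{m,j}\<close> with \<open>i < m < j\<close>, whose
  columns begin at \<open>i + 1\<close>, bounds the grade of the factors \<open>E_{m,j}\<close> in the recursion by one.
\<close>

lemma grade_le_gl_upper_main:
  assumes "1 \<le> k" "k \<le> i" "i < j" "j \<le> n"
  shows "grade_le n 0 (gl n l k i j - (if k < i then xop i (i - 1) * dop j (i - 1) else 0)
                             + (if j < n then xop (Suc j) j * dop (Suc j) i else 0))"
  using assms
proof (induction "j - i" arbitrary: k i rule: less_induct)
  case less
  have a: "grade_le n 0 (xop i a * dop j a)" if "a \<in> {k..<i} - {i - 1}" for a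
    using less.prems that var_grade_bounds[of j a] var_grade_far[of a i] by (intro grade_le_xop_dop) (auto simp: tri_def)
  have b: "grade_le n 0 (gl n l i i i * dop j i)"
    by (rule grade_le_mono[OF grade_le_mult[OF grade_le_gl_diag grade_le_dop]]) (use less.prems in \<open>auto simp: tri_def\<close>)
  have c: "grade_le n 0 (gl n l (Suc i) m j * dop m i)" if m: "m \<in> {i<..n} - {Suc j}" for m
  proof -
    have dop: "grade_le n (- int (var_grade m i)) (dop m i)"
      using m less.prems by (intro grade_le_dop) (auto simp: tri_def)
    consider "m < j" | "m = j" | "m > j" by linarith
    then show ?thesis
    proof cases
      case 1
      let ?A = "if Suc i < m then xop m (m - 1) * dop j (m - 1) else 0"
      let ?B = "if j < n then xop (Suc j) j * dop (Suc j) m else 0"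
      have "grade_le n 0 (gl n l (Suc i) m j - ?A + ?B)"
        using 1 m less.prems by (intro less.hyps) auto
      then have main: "grade_le n 1 (gl n l (Suc i) m j - ?A + ?B)"
        by (rule grade_le_mono) simp
      have A: "grade_le n 1 ?A"
        using 1 m less.prems var_grade_bounds[of m "m - 1"] var_grade_bounds[of j "m - 1"]
        by (auto intro!: grade_le_xop_dop grade_le_zero simp: tri_def)
      have B: "grade_le n 1 ?B"
        using 1 m less.prems var_grade_bounds[of "Suc j" j] var_grade_bounds[of "Suc j" m]
        by (auto intro!: grade_le_xop_dop grade_le_zero simp: tri_def)
      have "x - u + v + u - v = x" for x u v :: linop
        by simp
      with grade_le_diff[OF grade_le_add[OF main A] B] have "grade_le n 1 (gl n l (Suc i) m j)"
        by (simp only:)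
      from grade_le_mult[OF this dop] show ?thesis
        using var_grade_bounds[of m i] by (elim grade_le_mono) auto
    next
      case 2
      then have "grade_le n 0 (gl n l (Suc i) m j)"
        using m less.prems by (auto intro!: grade_le_gl_diag)
      from grade_le_mult[OF this dop] show ?thesis
        using var_grade_bounds[of m i] by (elim grade_le_mono) auto
    next
      case 3
      then have "grade_le n (int (var_grade m j)) (gl n l (Suc i) m j)"
        using m less.prems by (auto intro!: grade_le_gl_lower)
      from grade_le_mult[OF this dop] show ?thesis
        using var_grade_bounds[of m i] var_grade_far[of j m] 3 m by (elim grade_le_mono) auto
    qed
  qed
  have A: "(\<Sum>a\<in>{k..<i}. xop i a * dop j a) = (if k < i then xop i (i - 1) * dop j (i - 1) else 0)
      + (\<Sum>a\<in>{k..<i} - {i - 1}. xop i a * dop j a)"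
  proof (cases "k < i")
    case True
    then show ?thesis by (subst sum.remove[of _ "i - 1"]) auto
  next
    case False
    then show ?thesis by auto
  qed
  have S: "grade_le n 0 (\<Sum>m\<in>{i<..n} - {Suc j}. gl n l (Suc i) m j * dop m i)"
    by (intro grade_le_sum c)
  have C: "grade_le n 0 ((if j < n then xop (Suc j) j * dop (Suc j) i else 0)
    - (\<Sum>m\<in>{i<..n}. gl n l (Suc i) m j * dop m i))"
  proof (cases "j < n")
    case True
    have "grade_le n 0 ((\<Sum>a\<in>{Suc i..<j}. xop (Suc j) a * dop j a) * dop (Suc j) i)"
    proof -
      have "grade_le n 0 (\<Sum>a\<in>{Suc i..<j}. xop (Suc j) a * dop j a)"
      proof (intro grade_le_sum)
        fix a assume "a \<in> {Suc i..<j}"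
        then show "grade_le n 0 (xop (Suc j) a * dop j a)"
          using True less.prems var_grade_bounds[of j a] var_grade_far[of a "Suc j"] by (intro grade_le_xop_dop) (auto simp: tri_def)
      qed
      show ?thesis
        by (rule grade_le_mono[OF grade_le_mult[OF \<open>grade_le n 0 (\<Sum>a\<in>{Suc i..<j}. xop (Suc j) a * dop j a)\<close> grade_le_dop]])
           (use True less.prems in \<open>auto simp: tri_def\<close>)
    qed
    moreover have "(\<Sum>m\<in>{i<..n}. gl n l (Suc i) m j * dop m i) =
        gl n l (Suc i) (Suc j) j * dop (Suc j) i + (\<Sum>m\<in>{i<..n} - {Suc j}. gl n l (Suc i) m j * dop m i)"
      using True less.prems by (subst sum.remove[of _ "Suc j"]) auto
    moreover have "gl n l (Suc i) (Suc j) j = xop (Suc j) j + (\<Sum>a\<in>{Suc i..<j}. xop (Suc j) a * dop j a)"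
      using True less.prems by (intro gl_lower) auto
    moreover have "grade_le n 0 (- ((\<Sum>a\<in>{Suc i..<j}. xop (Suc j) a * dop j a) * dop (Suc j) i)
       - (\<Sum>m\<in>{i<..n} - {Suc j}. gl n l (Suc i) m j * dop m i))"
      using grade_le_diff[OF grade_le_diff[OF grade_le_zero calculation(1)] S] by simp
    ultimately show ?thesis
      using True by (simp add: algebra_simps)
  next
    case False
    then have "{i<..n} - {Suc j} = {i<..n}" using less.prems by auto
    then show ?thesis
      using False grade_le_diff[OF grade_le_zero S] by simp
  qed
  have "grade_le n 0 ((\<Sum>a\<in>{k..<i} - {i - 1}. xop i a * dop j a) + gl n l i i i * dop j i +
     ((if j < n then xop (Suc j) j * dop (Suc j) i else 0) - (\<Sum>m\<in>{i<..n}. gl n l (Suc i) m j * dop m i)))"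
    by (intro grade_le_add grade_le_sum a b C)
  moreover have "gl n l k i j - (if k < i then xop i (i - 1) * dop j (i - 1) else 0)
                             + (if j < n then xop (Suc j) j * dop (Suc j) i else 0) =
     ((\<Sum>a\<in>{k..<i} - {i - 1}. xop i a * dop j a) + gl n l i i i * dop j i +
     ((if j < n then xop (Suc j) j * dop (Suc j) i else 0) - (\<Sum>m\<in>{i<..n}. gl n l (Suc i) m j * dop m i)))"
    unfolding gl_upper[OF less.prems(2-4)] A by simp
  ultimately show ?case by (simp only:)
qed

text \<open>
  Monomials in the variables that admit complex exponents. The top monomials of singular series
  will be of this kind.
\<close>

definition pure :: "nat \<Rightarrow> exponents \<Rightarrow> bool" where
  "pure n e \<longleftrightarrow> (\<forall>(i, j)\<in>tri n. Suc j < i \<longrightarrow> e (i, j) = 0)"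

text \<open>
  Let \<open>c\<close> be the top grade of \<open>z\<close>. In a coefficient of \<open>E_{i,j} z\<close> of grade \<open>c + 1\<close> only the two
  leading terms survive. The term with \<open>\<partial>_{j,i-1}\<close> is zero by induction on \<open>i\<close>, so the other one
  is zero as well, which says that \<open>x_{j+1,i}\<close> does not occur in grade \<open>c\<close>.
\<close>

lemma top_pure:
  assumes singular: "singular n l z" and top: "\<And>e m. 1 \<le> m \<Longrightarrow> grade n e = c + of_int m \<Longrightarrow> z e = 0"
    and "1 \<le> i" "i < j" "j < n" "grade n e = c" "z e \<noteq> 0"
  shows "e (Suc j, i) = 0"
  using assms(3-)
proof (induction i arbitrary: j e rule: less_induct)
  case (less i)
  (* The exponent to which x_{j+1,j} d_{j+1,i} moves e. *)
  define e' where "e' = e((Suc j, i) := e (Suc j, i) - 1, (Suc j, j) := e (Suc j, j) + 1)"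
  have e': "e'((Suc j, j) := e' (Suc j, j) - 1) = e((Suc j, i) := e (Suc j, i) - 1)"
      "e' (Suc j, i) = e (Suc j, i) - 1" "e'((Suc j, j) := e' (Suc j, j) - 1, (Suc j, i) := e (Suc j, i)) = e"
    using less.prems by (auto simp: e'_def)
  have tri: "(Suc j, i) \<in> tri n" "(Suc j, j) \<in> tri n"
    using less.prems by (auto simp: tri_def)
  have he': "grade n e' = c + 1"
    using less.prems unfolding e'_def by (subst grade_upd[OF tri(2)], subst grade_upd[OF tri(1)]) (simp add: var_grade_def)
  have "app (gl n l 1 i j - (if 1 < i then xop i (i - 1) * dop j (i - 1) else 0)
        + (if j < n then xop (Suc j) j * dop (Suc j) i else 0)) z e' = 0"
  proof (rule grade_leD[OF grade_le_gl_upper_main])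
    fix e'' m assume "- 0 \<le> m" "grade n e'' = grade n e' + of_int m"
    then show "z e'' = 0"
      by (intro top[of "m + 1"]) (auto simp: he')
  qed (use less.prems in auto)
  moreover have "app (gl n l 1 i j) z = 0"
    using less.prems by (intro singular_all[OF singular]) auto
  moreover have "app (xop (Suc j) j * dop (Suc j) i) z e' = e (Suc j, i) * z e"
    using e' less.prems by (simp add: app_xop_apply app_dop_apply)
  moreover have "app (if 1 < i then xop i (i - 1) * dop j (i - 1) else 0) z e' = 0"
  proof (cases "1 < i")
    case True
    (* The exponent that x_{i,i-1} d_{j,i-1} moves to e'. *)
    define e2 where "e2 = e'((i, i - 1) := e' (i, i - 1) - 1, (j, i - 1) := e' (j, i - 1) + 1)"
    have tri2: "(i, i - 1) \<in> tri n" "(j, i - 1) \<in> tri n"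
      using less.prems True by (auto simp: tri_def)
    have he2: "grade n e2 = c"
      using less.prems True he' unfolding e2_def
      by (subst grade_upd[OF tri2(2)], subst grade_upd[OF tri2(1)]) (auto simp: var_grade_def)
    have "app (xop i (i - 1) * dop j (i - 1)) z e' = e2 (j, i - 1) * z e2"
      using less.prems by (simp add: app_xop_apply app_dop_apply e2_def)
    also have "\<dots> = 0"
      using less.IH[of "i - 1" "j - 1" e2] True less.prems he2 by (cases "z e2 = 0") auto
    finally show ?thesis using True by simp
  qed simp
  ultimately show ?case
    using less.prems by simp
qed

lemma tri_Sigma: "tri n = (SIGMA i:{1..n}. {1..<i})"
  by (auto simp: tri_def)

text \<open>
  The variable \<open>x_{i,a}\<close> lowers the weight by a root of height \<open>i - a\<close>, and heights can be read
  off from the weight.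
\<close>

lemma height_weight:
  "(\<Sum>(i, a)\<in>tri n. of_nat (i - a) * e (i, a)) = (\<Sum>i\<in>{1..n}. of_nat i * (weight_of n l e i - l i))"
proof -
  have "(\<Sum>i\<in>{1..n}. of_nat i * (weight_of n l e i - l i)) =
    (\<Sum>i\<in>{1..n}. \<Sum>a\<in>{1..<i}. of_nat i * e (i, a)) - (\<Sum>i\<in>{1..n}. \<Sum>m\<in>{i<..n}. of_nat i * e (m, i))"
    by (simp add: weight_of_def algebra_simps sum_distrib_left sum_subtractf)
  also have "(\<Sum>i\<in>{1..n}. \<Sum>m\<in>{i<..n}. of_nat i * e (m, i)) = (\<Sum>i\<in>{1..n}. \<Sum>a\<in>{1..<i}. of_nat a * e (i, a))"
    by (rule sum_tri_swap[symmetric])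
  also have "(\<Sum>i\<in>{1..n}. \<Sum>a\<in>{1..<i}. of_nat i * e (i, a)) - \<dots> =
    (\<Sum>i\<in>{1..n}. \<Sum>a\<in>{1..<i}. of_nat (i - a) * e (i, a))"
    by (simp flip: sum_subtractf) (intro sum.cong refl, simp add: of_nat_diff algebra_simps)
  also have "\<dots> = (\<Sum>(i, a)\<in>tri n. of_nat (i - a) * e (i, a))"
    unfolding tri_Sigma by (rule sum.Sigma) auto
  finally show ?thesis by simp
qed

lemma Nats_sum: "(\<And>i. i \<in> I \<Longrightarrow> f i \<in> \<nat>) \<Longrightarrow> (\<Sum>i\<in>I. f i) \<in> (\<nat> :: 'a::semiring_1 set)"
  by (induction I rule: infinite_finite_induct) auto

text \<open>
  With \<open>H\<close> the height of \<open>l - M\<close>, \<open>2 H - grade\<close> is a combination of the exponents in which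
  \<open>x_{j+1,j}\<close> has coefficient \<open>0\<close> and the other variables, whose exponents are natural, have
  positive coefficients.
\<close>

lemma grade_bounded:
  assumes "has_weight n l M z"
  shows "\<exists>H. \<forall>e. z e \<noteq> 0 \<longrightarrow> H - grade n e \<in> \<nat>"
proof (intro exI allI impI)
  fix e assume e: "z e \<noteq> 0"
  define H where "H = (\<Sum>i\<in>{1..n}. of_nat i * (M i - l i))"
  have exp: "e \<in> exponents_of n"
    using assms e by (auto simp: has_weight_def dest: supportedD)
  have "H = (\<Sum>(i, a)\<in>tri n. of_nat (i - a) * e (i, a))"
    unfolding height_weight[of _ _ l] H_def using assms e by (intro sum.cong) (auto simp: has_weight_def)
  then have "2 * H - grade n e = (\<Sum>(i, a)\<in>tri n. of_nat (2 * (i - a) - var_grade i a) * e (i, a))"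
    unfolding grade_def
    by (simp add: sum_distrib_left flip: sum_subtractf)
       (intro sum.cong refl, auto simp: tri_def var_grade_def of_nat_diff algebra_simps)
  also have "\<dots> \<in> \<nat>"
  proof (intro Nats_sum, clarify)
    fix i a assume ia: "(i, a) \<in> tri n"
    show "of_nat (2 * (i - a) - var_grade i a) * e (i, a) \<in> \<nat>"
    proof (cases "i = Suc a")
      case True
      then show ?thesis by (simp add: var_grade_def)
    next
      case False
      then have "e (i, a) \<in> \<nat>"
        using exp ia by (auto simp: exponents_of_def tri_def)
      then show ?thesis by (intro Nats_mult) auto
    qed
  qed
  finally show "2 * H - grade n e \<in> \<nat>" .
qed

text \<open>
  The grade is bounded above on a weight space, so a monomial of top grade exists, and it is
  pure.
\<close>

lemma singular_pure_coeff:
  assumes singular: "singular n l z" and has_weight: "has_weight n l M z" and "z \<noteq> 0"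
  obtains e where "e \<in> exponents_of n" "pure n e" "z e \<noteq> 0"
proof -
  obtain H where H: "\<And>e. z e \<noteq> 0 \<Longrightarrow> H - grade n e \<in> \<nat>"
    using grade_bounded[OF has_weight] by auto
  obtain e1 where e1: "z e1 \<noteq> 0" using \<open>z \<noteq> 0\<close> by (auto simp: fun_eq_iff)
  obtain k1 where "H - grade n e1 = of_nat k1"
    using H[OF e1] by (auto elim: Nats_cases)
  with e1 have ex: "\<exists>k e. z e \<noteq> 0 \<and> H - grade n e = of_nat k"
    by blast
  (* The least distance of the grade from its bound. *)
  define k where "k = (LEAST k. \<exists>e. z e \<noteq> 0 \<and> H - grade n e = of_nat k)"
  have "\<exists>e. z e \<noteq> 0 \<and> H - grade n e = of_nat k"
    unfolding k_def using ex by (rule LeastI_ex)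
  then obtain e where e: "z e \<noteq> 0" "H - grade n e = of_nat k" by auto
  have min: "k \<le> k'" if "z e' \<noteq> 0" "H - grade n e' = of_nat k'" for e' k'
    unfolding k_def by (rule Least_le) (use that in auto)
  have top: "z e' = 0" if m: "1 \<le> m" "grade n e' = grade n e + of_int m" for e' m
  proof (rule ccontr)
    assume "z e' \<noteq> 0"
    moreover from H[OF this] obtain k' where k': "H - grade n e' = of_nat k'"
      by (auto elim: Nats_cases)
    ultimately have "k \<le> k'" by (rule min)
    have "(of_int (int k - int k') :: complex) = of_int m"
      using k' e(2) m(2) by (simp add: algebra_simps)
    then have "int k - int k' = m" by (simp only: of_int_eq_iff)
    with \<open>k \<le> k'\<close> m(1) show False by simp
  qed
  have "pure n e"
    unfolding pure_def
  proof clarify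
    fix a b assume ab: "(a, b) \<in> tri n" "Suc b < a"
    then have "e (Suc (a - 1), b) = 0"
      using e(1) by (intro top_pure[OF singular top]) (auto simp: tri_def)
    then show "e (a, b) = 0" using ab by simp
  qed
  moreover have "e \<in> exponents_of n"
    using has_weight e(1) by (auto simp: has_weight_def dest: supportedD)
  ultimately show ?thesis using e(1) that by blast
qed

lemma pure_weight_of_unique:
  assumes "pure n e" "pure n e'" "e \<in> exponents_of n" "e' \<in> exponents_of n"
    and w: "\<And>i. i \<in> {1..n} \<Longrightarrow> weight_of n l e i = weight_of n l e' i"
  shows "e = e'"
proof -
  have weight_of: "weight_of n l e i = l i + (if 2 \<le> i then e (i, i - 1) else 0) - (if i < n then e (Suc i, i) else 0)"
    if "pure n e" "i \<in> {1..n}" for e i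
  proof -
    have "(\<Sum>a\<in>{1..<i}. e (i, a)) = (\<Sum>a\<in>{1..<i}. if a = i - 1 then e (i, a) else 0)"
      using that by (intro sum.cong) (force simp: pure_def tri_def)+
    also have "\<dots> = (if 2 \<le> i then e (i, i - 1) else 0)"
      by auto
    finally have 1: "(\<Sum>a\<in>{1..<i}. e (i, a)) = (if 2 \<le> i then e (i, i - 1) else 0)" .
    have "(\<Sum>m\<in>{i<..n}. e (m, i)) = (\<Sum>m\<in>{i<..n}. if m = Suc i then e (m, i) else 0)"
      using that by (intro sum.cong) (force simp: pure_def tri_def)+
    also have "\<dots> = (if i < n then e (Suc i, i) else 0)"
      by auto
    finally show ?thesis using 1 by (simp add: weight_of_def)
  qed
  have d: "e (Suc i, i) = e' (Suc i, i)" if "1 \<le> i" "i < n" for i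
    using that
  proof (induction i rule: less_induct)
    case (less i)
    have "(if 2 \<le> i then e (i, i - 1) else 0) = (if 2 \<le> i then e' (i, i - 1) else 0)"
      using less.IH[of "i - 1"] less.prems by (cases i) auto
    then show ?case
      using w[of i] weight_of[OF assms(1), of i] weight_of[OF assms(2), of i] less.prems by simp
  qed
  have "e (i, j) = e' (i, j)" for i j
  proof (cases "(i, j) \<in> tri n")
    case True
    then have "j < i" by (simp add: tri_def)
    then consider "i = Suc j" | "Suc j < i" by linarith
    then show ?thesis
    proof cases
      case 1
      then show ?thesis using d[of j] True by (auto simp: tri_def)
    next
      case 2
      then show ?thesis using True assms(1,2) by (fastforce simp: pure_def)
    qed
  next
    case False
    then show ?thesis
      using assms(3,4) by (simp add: exponents_of_def tri_def)
  qed
  then show ?thesis by (auto simp: fun_eq_iff)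
qed

text \<open>
  Singular series of a given weight form a space of dimension at most one: the weight determines
  the pure monomial \<open>e\<close>, and \<open>z - z e * y\<close> has no pure monomial left.
\<close>

lemma singular_unique:
  assumes "singular n l z" "has_weight n l M z" "singular n l y" "has_weight n l M y" "pure n e" "y e = 1"
  shows "z = fscale (z e) y"
proof -
  define u where "u = z - fscale (z e) y"
  have "singular n l u"
    using assms(1,3) by (auto simp: singular_def u_def app_diff_arg app_fscale fscale_zero)
  moreover have wu: "has_weight n l M u"
    unfolding has_weight_def
  proof (intro conjI allI impI)
    show "supported n u"
      unfolding u_def using assms(2,4) by (intro supported_diff supported_fscale) (auto simp: has_weight_def)
    fix e' assume "u e' \<noteq> 0"
    then have "z e' \<noteq> 0 \<or> y e' \<noteq> 0" by (auto simp: u_def fscale_def)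
    then show "\<forall>i\<in>{1..n}. weight_of n l e' i = M i"
      using assms(2,4) by (auto simp: has_weight_def)
  qed
  have e: "e \<in> exponents_of n" "\<And>i. i \<in> {1..n} \<Longrightarrow> weight_of n l e i = M i"
    using assms(4,6) by (auto simp: has_weight_def supported_def)
  have "u = 0"
  proof (rule ccontr)
    assume "u \<noteq> 0"
    with \<open>singular n l u\<close> wu obtain e' where e': "e' \<in> exponents_of n" "pure n e'" "u e' \<noteq> 0"
      by (rule singular_pure_coeff)
    have "e' = e"
      using e e' wu assms(5) by (intro pure_weight_of_unique[where l = l]) (auto simp: has_weight_def)
    then show False
      using e'(3) assms(6) by (simp add: u_def fscale_def)
  qed
  then show ?thesis by (simp add: u_def)
qed

(* Index sets are written {1..n}; rewriting 1 to Suc 0 would obscure them. *)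
declare One_nat_def [simp del]

section \<open>Monomials generated from the constant\<close>

abbreviation lower_word :: "nat \<Rightarrow> (nat \<Rightarrow> complex) \<Rightarrow> (nat \<times> nat) list \<Rightarrow> series \<Rightarrow> series" where
  "lower_word n l ps f \<equiv> foldr (\<lambda>(i, j). app (gl n l 1 i j)) ps f"

lemma upd_shift_iff: "f(q := f q - 1) = g \<longleftrightarrow> f = g(q := g q + 1)" for f g :: exponents
proof
  assume "f(q := f q - 1) = g"
  then have "g = f(q := f q - 1)" by simp
  then show "f = g(q := g q + 1)" by simp
next
  assume "f = g(q := g q + 1)"
  then show "f(q := f q - 1) = g" by simp
qed

lemma app_xop_fmonom: "app (xop i j) (fmonom e) = fmonom (e((i, j) := e (i, j) + 1))"
  by (rule ext) (simp add: app_xop_apply fmonom_def upd_shift_iff)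

lemma app_dop_fmonom: "e (i, j) = 0 \<Longrightarrow> app (dop i j) (fmonom e) = 0"
  by (auto simp: app_dop_apply fmonom_def fun_eq_iff)

text \<open>
  When the word is sorted by rows, \<open>E_{i,j}\<close> acts on a monomial without variables of rows less
  than \<open>i\<close>. As \<open>j < i\<close>, the terms \<open>x_{i,a} \<partial>_{j,a}\<close> vanish and only \<open>x_{i,j}\<close> remains.
\<close>

lemma lower_word_fone:
  assumes "sorted (map fst ps)" "set ps \<subseteq> tri n"
  shows "lower_word n l ps fone = fmonom (\<lambda>q. of_nat (count (mset ps) q))"
  using assms
proof (induction ps)
  case Nil
  then show ?case by (simp add: fone_def)
next
  case (Cons q ps)
  obtain i j where q: "q = (i, j)" by (cases q)
  have ij: "1 \<le> j" "j < i" "i \<le> n"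
    using Cons.prems q by (auto simp: tri_def)
  define e :: exponents where "e = (\<lambda>q. of_nat (count (mset ps) q))"
  have IH: "lower_word n l ps fone = fmonom e"
    using Cons by (simp add: e_def)
  have "e (j, a) = 0" for a
  proof -
    have "(j, a) \<notin> set ps" using Cons.prems(1) q ij by force
    then have "count (mset ps) (j, a) = 0" by (simp add: count_mset_0_iff)
    then show ?thesis unfolding e_def by simp
  qed
  then have "app (dop j a) (fmonom e) = 0" for a
    by (rule app_dop_fmonom)
  then have "app (gl n l 1 i j) (fmonom e) = app (xop i j) (fmonom e)"
    unfolding gl_lower[OF ij] by simp
  then show ?case
    using IH q by (simp add: app_xop_fmonom) (auto simp: fmonom_def e_def fun_eq_iff)
qed

lemma natural_exponents_list:
  fixes e :: exponents
  assumes "\<And>q. q \<in> tri n \<Longrightarrow> e q \<in> \<nat>" "\<And>q. q \<notin> tri n \<Longrightarrow> e q = 0"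
  obtains ps where "sorted (map fst ps)" "set ps \<subseteq> tri n" "e = (\<lambda>q. of_nat (count (mset ps) q))"
proof -
  have "\<exists>k. e q = of_nat k" for q
  proof (cases "q \<in> tri n")
    case True
    from assms(1)[OF this] show ?thesis by (rule Nats_cases) blast
  next
    case False
    from assms(2)[OF this] show ?thesis by (intro exI[of _ 0]) simp
  qed
  then obtain k where k: "\<And>q. e q = of_nat (k q)" by metis
  define A where "A = (\<Sum>q\<in>tri n. replicate_mset (k q) q)"
  have "count A q = k q" for q
  proof -
    have "count A q = (\<Sum>p\<in>tri n. if p = q then k p else 0)"
      unfolding A_def count_sum by (intro sum.cong) auto
    also have "\<dots> = k q"
      using assms(2)[of q] k[of q] by (auto simp: finite_tri)
    finally show ?thesis .
  qed
  moreover obtain ps where ps: "mset ps = A" using ex_mset by blast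
  moreover have "set ps \<subseteq> tri n"
  proof
    fix q assume "q \<in> set ps"
    then have "count A q \<noteq> 0" using ps by (metis count_mset_0_iff)
    then have "e q \<noteq> 0" using calculation(1) k by simp
    then show "q \<in> tri n" using assms(2)[of q] by blast
  qed
  ultimately show ?thesis
    using that[of "sort_key fst ps"] k by (simp add: fun_eq_iff)
qed

section \<open>Central elements and their eigenvalues\<close>

text \<open>
  The entries of the powers of the matrix with entries \<open>E_{i,j}\<close>. Their traces, the Gelfand
  invariants, are central.
\<close>

fun mat_power :: "nat \<Rightarrow> (nat \<Rightarrow> complex) \<Rightarrow> nat \<Rightarrow> nat \<Rightarrow> nat \<Rightarrow> linop" where
  "mat_power n l 0 i j = (if i = j then 1 else 0)"
| "mat_power n l (Suc m) i j = (\<Sum>k\<in>{1..n}. mat_power n l m i k * gl n l 1 k j)"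

text \<open>
  The powers transform under gl(n) in the same way as the matrix of the \<open>E_{i,j}\<close> itself.
\<close>

lemma comm_gl_mat_power:
  assumes "a \<in> {1..n}" "b \<in> {1..n}" "i \<in> {1..n}" "j \<in> {1..n}"
  shows "comm (gl n l 1 a b) (mat_power n l m i j) =
    (if b = i then mat_power n l m a j else 0) - (if j = a then mat_power n l m i b else 0)"
  using assms
proof (induction m arbitrary: i j)
  case 0
  then show ?case by (auto simp: comm_def)
next
  case (Suc m)
  let ?g = "gl n l 1" and ?t = "mat_power n l m"
  have "comm (?g a b) (mat_power n l (Suc m) i j) =
     (\<Sum>k\<in>{1..n}. comm (?g a b) (?t i k) * ?g k j + ?t i k * comm (?g a b) (?g k j))"
    by (simp add: comm_simps)
  also have "\<dots> = (\<Sum>k\<in>{1..n}. ((if b = i then ?t a k else 0) - (if k = a then ?t i b else 0)) * ?g k j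
      + ?t i k * ((if b = k then ?g a j else 0) - (if j = a then ?g k b else 0)))"
    using Suc by (intro sum.cong[OF refl]) (simp only: Suc.IH comm_gl order_refl)
  also have "\<dots> = (\<Sum>k\<in>{1..n}. (if b = i then ?t a k * ?g k j else 0))
      - (\<Sum>k\<in>{1..n}. if k = a then ?t i b * ?g k j else 0)
      + (\<Sum>k\<in>{1..n}. if k = b then ?t i k * ?g a j else 0)
      - (\<Sum>k\<in>{1..n}. (if j = a then ?t i k * ?g k b else 0))"
    by (simp only: sum.distrib[symmetric] sum_subtractf[symmetric]) (rule sum.cong[OF refl], auto simp: algebra_simps)
  also have "\<dots> = (if b = i then mat_power n l (Suc m) a j else 0) - (if j = a then mat_power n l (Suc m) i b else 0)"
    using Suc.prems by auto
  finally show ?case .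
qed

definition gelfand :: "nat \<Rightarrow> (nat \<Rightarrow> complex) \<Rightarrow> nat \<Rightarrow> linop" where
  "gelfand n l m = (\<Sum>i\<in>{1..n}. mat_power n l m i i)"

lemma comm_gl_gelfand:
  assumes "a \<in> {1..n}" "b \<in> {1..n}"
  shows "comm (gl n l 1 a b) (gelfand n l m) = 0"
proof -
  have "comm (gl n l 1 a b) (gelfand n l m) =
     (\<Sum>i\<in>{1..n}. (if i = b then mat_power n l m a i else 0) - (if i = a then mat_power n l m i b else 0))"
    unfolding gelfand_def comm_sum_right using assms by (intro sum.cong[OF refl]) (auto simp: comm_gl_mat_power)
  also have "\<dots> = 0"
    using assms by (simp add: sum_subtractf)
  finally show ?thesis .
qed

lemma polyop_mat_power: "polyop (mat_power n l m i j)"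
  by (induction m arbitrary: i j) (auto intro!: polyop_intros polyop_gl)

lemma fscale_null: "fscale 0 f = 0"
  by (auto simp: fscale_def)

text \<open>
  The eigenvalue of the \<open>i\<close>-th diagonal entry of the \<open>m\<close>-th power on a singular series of weight
  \<open>M\<close>.
\<close>

fun gelfand_ev :: "nat \<Rightarrow> (nat \<Rightarrow> complex) \<Rightarrow> nat \<Rightarrow> nat \<Rightarrow> complex" where
  "gelfand_ev n M 0 i = 1"
| "gelfand_ev n M (Suc m) i = (M i + of_nat (n - i)) * gelfand_ev n M m i - (\<Sum>k\<in>{i<..n}. gelfand_ev n M m k)"

lemma app_gl_diagonal_has_weight:
  assumes "has_weight n l M z" "i \<in> {1..n}"
  shows "app (gl n l 1 i i) z = fscale (M i) z"
proof
  fix e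
  show "app (gl n l 1 i i) z e = fscale (M i) z e"
    using assms by (cases "z e = 0") (auto simp: app_gl_diagonal fscale_def has_weight_def)
qed

text \<open>
  In the last step of the matrix product, \<open>E_{k,j}\<close> with \<open>k < j\<close> annihilates \<open>z\<close>, \<open>E_{j,j}\<close> acts
  by a scalar, and \<open>E_{k,j}\<close> with \<open>k > j\<close> is moved to the left, where it meets an entry above
  the diagonal, which annihilates \<open>z\<close>; the commutator leaves a difference of diagonal entries.
\<close>

lemma mat_power_singular:
  assumes singular: "singular n l z" and has_weight: "has_weight n l M z"
    and "i \<in> {1..n}" "j \<in> {1..n}" "i \<le> j"
  shows "app (mat_power n l m i j) z = fscale (if i = j then gelfand_ev n M m i else 0) z"
  using assms(3-)
proof (induction m arbitrary: i j)
  case 0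
  then show ?case by (auto simp: fscale_def fun_eq_iff)
next
  case (Suc m)
  let ?g = "gl n l 1" and ?t = "mat_power n l m"
  have up: "app (?g k j) z = 0" if "k \<in> {1..<j}" for k
    using that Suc.prems by (intro singular_all[OF singular]) auto
  have diag: "app (?g k k) z = fscale (M k) z" if "k \<in> {1..n}" for k
    using has_weight that by (rule app_gl_diagonal_has_weight)
  have t: "app (?t i k) z = fscale (if i = k then gelfand_ev n M m i else 0) z" if "i \<in> {1..n}" "k \<in> {1..n}" "i \<le> k" for i k
    using that Suc.IH[of i k] by auto
  define s where "s k = (if k < j then 0 else if k = j then M j * (if i = j then gelfand_ev n M m i else 0)
    else if i = j then gelfand_ev n M m i - gelfand_ev n M m k else 0)" for k
  have s: "app (?t i k) (app (?g k j) z) = fscale (s k) z" if k: "k \<in> {1..n}" for k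
  proof -
    consider "k < j" | "k = j" | "k > j" by linarith
    then show ?thesis
    proof cases
      case 1
      then have "app (?g k j) z = 0" using up k by simp
      then show ?thesis using 1 by (simp add: s_def fscale_null)
    next
      case 2
      then show ?thesis
        using diag[OF k] t[OF Suc.prems(1) k] Suc.prems by (simp add: s_def app_fscale)
    next
      case 3
      have "comm (?g k j) (?t i k) = (if j = i then ?t k k else 0) - ?t i j"
        using comm_gl_mat_power[of k n j i k l m] k Suc.prems by simp
      from comm_appD[OF this, of z] have
        "app (?g k j) (app (?t i k) z) = app (?t i k) (app (?g k j) z) + (app (if j = i then ?t k k else 0) z - app (?t i j) z)"
        by simp
      moreover have "app (?t i k) z = 0"
        using t[OF Suc.prems(1) k] 3 Suc.prems by (simp add: fscale_null)
      ultimately have "app (?t i k) (app (?g k j) z) = app (?t i j) z - app (if j = i then ?t k k else 0) z"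
        by (simp add: algebra_simps eq_neg_iff_add_eq_0)
      also have "\<dots> = fscale (s k) z"
        using t[OF k k] t[OF Suc.prems(1,2)] Suc.prems 3
        by (auto simp: s_def fscale_def fun_eq_iff algebra_simps)
      finally show ?thesis .
    qed
  qed
  have "app (mat_power n l (Suc m) i j) z = (\<Sum>k\<in>{1..n}. fscale (s k) z)"
    using s by simp
  also have "\<dots> = fscale (\<Sum>k\<in>{1..n}. s k) z"
    by (simp add: fun_eq_iff fscale_def sum_apply sum_distrib_right)
  also have "(\<Sum>k\<in>{1..n}. s k) = (\<Sum>k\<in>{1..<j}. s k) + (s j + (\<Sum>k\<in>{j<..n}. s k))"
  proof -
    have "{1..n} = {1..<j} \<union> insert j {j<..n}" using Suc.prems by auto
    then have "(\<Sum>k\<in>{1..n}. s k) = (\<Sum>k\<in>{1..<j} \<union> insert j {j<..n}. s k)" by simp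
    also have "\<dots> = (\<Sum>k\<in>{1..<j}. s k) + (\<Sum>k\<in>insert j {j<..n}. s k)"
      by (rule sum.union_disjoint) auto
    finally show ?thesis by simp
  qed
  also have "(\<Sum>k\<in>{1..<j}. s k) = 0"
    by (intro sum.neutral) (simp add: s_def)
  also have "(\<Sum>k\<in>{j<..n}. s k) = (if i = j then (\<Sum>k\<in>{i<..n}. gelfand_ev n M m i - gelfand_ev n M m k) else 0)"
    by (auto simp: s_def intro!: sum.cong)
  also have "0 + (s j + \<dots>) = (if i = j then gelfand_ev n M (Suc m) i else 0)"
    by (simp add: s_def sum_subtractf algebra_simps)
  finally show ?case .
qed

lemma gelfand_singular:
  assumes "singular n l z" "has_weight n l M z"
  shows "app (gelfand n l m) z = fscale (\<Sum>i\<in>{1..n}. gelfand_ev n M m i) z"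
  using mat_power_singular[OF assms]
  by (simp add: gelfand_def) (simp add: fscale_def fun_eq_iff sum_apply sum_distrib_right)

lemma supported_fone: "supported n fone"
  by (auto simp: supported_def fone_def fmonom_def exponents_of_def)

lemma has_weight_fone: "has_weight n l l fone"
  using supported_fone by (auto simp: has_weight_def fone_def fmonom_def weight_of_def)

lemma singular_fone: "singular n l fone"
  unfolding singular_def
proof
  fix i assume i: "i \<in> {1..<n}"
  have dop: "app (dop a b) fone = 0" for a b
    unfolding fone_def by (rule app_dop_fmonom) simp
  show "app (gl n l 1 i (Suc i)) fone = 0"
    using i by (simp add: gl_upper dop)
qed

lemma gelfand_lower_word_fone:
  assumes "set ps \<subseteq> tri n"
  shows "app (gelfand n l m) (lower_word n l ps fone) = fscale (\<Sum>i\<in>{1..n}. gelfand_ev n l m i) (lower_word n l ps fone)"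
  using assms
proof (induction ps)
  case Nil
  show ?case using gelfand_singular[OF singular_fone has_weight_fone] by simp
next
  case (Cons q ps)
  obtain i j where q: "q = (i, j)" by (cases q)
  have "comm (gelfand n l m) (gl n l 1 i j) = 0"
    using comm_gl_gelfand[of i n j l m] comm_swap[of "gelfand n l m" "gl n l 1 i j"] Cons.prems q
    by (auto simp: tri_def)
  from comm_appD[OF this, of "lower_word n l ps fone"] Cons show ?case
    by (simp add: q app_fscale)
qed

text \<open>
  A central element acts by one scalar on everything generated from the constant, in particular
  on all ordinary monomials. By density it acts by this scalar on series with complex exponents.
\<close>

lemma gelfand_scalar:
  assumes "supported n f"
  shows "app (gelfand n l m) f = fscale (\<Sum>i\<in>{1..n}. gelfand_ev n l m i) f"
proof -
  let ?c = "\<Sum>i\<in>{1..n}. gelfand_ev n l m i"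
  have "app (gelfand n l m - scop ?c) f = 0"
  proof (rule fmonom_dense[OF _ finite_tri[of n]])
    show "polyop (gelfand n l m - scop ?c)"
      unfolding gelfand_def by (intro polyop_intros polyop_mat_power)
    fix e :: exponents
    assume e: "\<And>q. q \<in> tri n \<Longrightarrow> e q \<in> \<nat>" "\<And>q. q \<notin> tri n \<Longrightarrow> e q = 0"
    obtain ps where ps: "sorted (map fst ps)" "set ps \<subseteq> tri n" "e = (\<lambda>q. of_nat (count (mset ps) q))"
      using natural_exponents_list[of n e] e by blast
    show "app (gelfand n l m - scop ?c) (fmonom e) = 0"
      using gelfand_lower_word_fone[OF ps(2), of l m] unfolding lower_word_fone[OF ps(1,2)] ps(3) by simp
  next
    fix e q assume "f e \<noteq> 0" "q \<notin> tri n"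
    then show "e q = 0"
      using supportedD[OF assms] by (cases q) (auto simp: exponents_of_def tri_def)
  qed
  then show ?thesis by simp
qed

lemma gelfand_ev_sums_eq:
  assumes "singular n l z" "has_weight n l M z" "z \<noteq> 0"
  shows "(\<Sum>i\<in>{1..n}. gelfand_ev n M m i) = (\<Sum>i\<in>{1..n}. gelfand_ev n l m i)"
proof -
  obtain e where "z e \<noteq> 0" using assms(3) by (auto simp: fun_eq_iff)
  moreover have "supported n z" using assms(2) by (simp add: has_weight_def)
  from gelfand_scalar[OF this] gelfand_singular[OF assms(1,2)]
  have "fscale (\<Sum>i\<in>{1..n}. gelfand_ev n M m i) z = fscale (\<Sum>i\<in>{1..n}. gelfand_ev n l m i) z" by metis
  then have "fscale (\<Sum>i\<in>{1..n}. gelfand_ev n M m i) z e = fscale (\<Sum>i\<in>{1..n}. gelfand_ev n l m i) z e"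
    by (rule fun_cong)
  ultimately show ?thesis by (simp add: fscale_def)
qed

section \<open>Linkage of weights\<close>

text \<open>
  The weight shifted by \<open>\<rho>\<close>, here \<open>(n-1, n-2, ..., 0)\<close>.
\<close>

definition rho_shift :: "nat \<Rightarrow> (nat \<Rightarrow> complex) \<Rightarrow> nat \<Rightarrow> complex" where
  "rho_shift n M i = M i + of_nat (n - i)"

text \<open>
  With \<open>l_k = rho_shift n M k\<close> and \<open>S_k\<close> the sum of the generating series from \<open>k\<close> on, the
  recursion of the eigenvalues is \<open>(1 - l_k X) (1 - X S_k) = (1 - (l_k + 1) X) (1 - X S_{k+1})\<close>.
\<close>

lemma gelfand_ev_fps:
  fixes n M
  defines "g \<equiv> \<lambda>i. Abs_fps (\<lambda>m. gelfand_ev n M m i)"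
  assumes "k \<le> Suc n" "1 \<le> k"
  shows "(\<Prod>i\<in>{k..n}. 1 - fps_const (rho_shift n M i) * fps_X) * (1 - fps_X * (\<Sum>i\<in>{k..n}. g i))
     = (\<Prod>i\<in>{k..n}. 1 - fps_const (rho_shift n M i + 1) * fps_X)"
  using assms(2,3)
proof (induction k rule: inc_induct)
  case base
  then show ?case by simp
next
  case (step k)
  define S where "S k = (\<Sum>i\<in>{k..n}. g i)" for k
  have eq: "{k<..n} = {Suc k..n}" by auto
  have g: "g k = 1 + fps_X * (fps_const (rho_shift n M k) * g k - S (Suc k))"
  proof (rule fps_ext)
    fix m
    show "fps_nth (g k) m = fps_nth (1 + fps_X * (fps_const (rho_shift n M k) * g k - S (Suc k))) m"
      by (cases m) (simp_all add: g_def S_def rho_shift_def eq fps_sum_nth)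
  qed
  have S: "S k = g k + S (Suc k)"
    using step.hyps by (simp add: S_def sum.atLeast_Suc_atMost)
  have key: "(1 - fps_const (rho_shift n M k) * fps_X) * (1 - fps_X * S k)
      = (1 - fps_const (rho_shift n M k + 1) * fps_X) * (1 - fps_X * S (Suc k))"
  proof -
    have c: "fps_const (rho_shift n M k + 1) = fps_const (rho_shift n M k) + 1"
      by (simp flip: fps_const_add)
    have "g k - fps_X * (fps_const (rho_shift n M k) * g k) = 1 - fps_X * S (Suc k)"
      using g by (simp add: algebra_simps)
    then have "fps_X * (g k - fps_X * (fps_const (rho_shift n M k) * g k)) = fps_X * (1 - fps_X * S (Suc k))"
      by simp
    then show ?thesis
      unfolding S c by (simp add: algebra_simps)
  qed
  have pr: "(\<Prod>i\<in>{k..n}. f i) = f k * (\<Prod>i\<in>{Suc k..n}. f i)" for f :: "nat \<Rightarrow> complex fps"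
    using step.hyps by (simp add: prod.atLeast_Suc_atMost)
  let ?A = "\<Prod>i\<in>{Suc k..n}. 1 - fps_const (rho_shift n M i) * fps_X"
  let ?B = "\<Prod>i\<in>{Suc k..n}. 1 - fps_const (rho_shift n M i + 1) * fps_X"
  have IH: "?A * (1 - fps_X * S (Suc k)) = ?B"
    using step by (simp add: S_def)
  have "(1 - fps_const (rho_shift n M k) * fps_X) * ?A * (1 - fps_X * S k)
      = ?A * ((1 - fps_const (rho_shift n M k) * fps_X) * (1 - fps_X * S k))"
    by (simp only: ac_simps)
  also have "\<dots> = (1 - fps_const (rho_shift n M k + 1) * fps_X) * (?A * (1 - fps_X * S (Suc k)))"
    unfolding key by (simp only: ac_simps)
  finally have "(1 - fps_const (rho_shift n M k) * fps_X) * ?A * (1 - fps_X * S k)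
      = (1 - fps_const (rho_shift n M k + 1) * fps_X) * (?A * (1 - fps_X * S (Suc k)))" .
  then show ?case
    unfolding pr IH S_def[symmetric] .
qed

lemma fps_of_linear: "fps_of_poly [:1, - c:] = 1 - fps_const c * fps_X" for c :: complex
  by (simp add: fps_of_poly_pCons algebra_simps)

lemma poly_prod_linear: "poly (\<Prod>i\<in>I. [:1, - c i:]) (1 / u) * u ^ card I = (\<Prod>i\<in>I. u - c i)"
  if "finite I" "u \<noteq> 0" for c :: "'b \<Rightarrow> complex"
proof -
  have "poly (\<Prod>i\<in>I. [:1, - c i:]) (1 / u) * u ^ card I = (\<Prod>i\<in>I. (1 - c i / u) * u)"
    by (simp add: poly_prod prod.distrib)
  also have "\<dots> = (\<Prod>i\<in>I. u - c i)"
    using that by (intro prod.cong) (simp_all add: field_simps)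
  finally show ?thesis .
qed

lemma count_image_succ: "count (image_mset (\<lambda>x. x + 1) A) (t + 1) = count A t" for t :: complex
  by (induction A) auto

text \<open>
  The difference of the multiplicities is invariant under \<open>t \<mapsto> t + 1\<close> and vanishes for all but
  finitely many \<open>t\<close>.
\<close>

lemma mset_eq_of_shift:
  fixes A B :: "complex multiset"
  assumes "image_mset (\<lambda>x. x + 1) A + B = A + image_mset (\<lambda>x. x + 1) B"
  shows "A = B"
proof (rule multiset_eqI, rule ccontr)
  fix t assume t: "count A t \<noteq> count B t"
  have step: "int (count A (s + 1)) - int (count B (s + 1)) = int (count A s) - int (count B s)" for s
  proof -
    have "count (image_mset (\<lambda>x. x + 1) A + B) (s + 1) = count (A + image_mset (\<lambda>x. x + 1) B) (s + 1)"
      using assms by simp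
    then show ?thesis by (simp add: count_image_succ)
  qed
  have D: "int (count A (t + of_nat k)) - int (count B (t + of_nat k)) = int (count A t) - int (count B t)" for k
  proof (induction k)
    case (Suc k)
    then show ?case using step[of "t + of_nat k"] by (simp add: ac_simps)
  qed simp
  have "count A (t + of_nat k) \<noteq> 0 \<or> count B (t + of_nat k) \<noteq> 0" for k
    using D[of k] t by linarith
  then have "range (\<lambda>k::nat. t + of_nat k) \<subseteq> set_mset (A + B)"
    by (auto simp: count_eq_zero_iff)
  then have "finite (range (\<lambda>k::nat. t + of_nat k))"
    by (rule finite_subset) simp
  then show False
    using finite_imageD[of "\<lambda>k::nat. t + of_nat k" UNIV] by (auto simp: inj_on_def)
qed

text \<open>
  The Gelfand invariants act on \<open>z\<close> as they act on the constant. Hence the quotients of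
  \<open>\<Prod>(1 - (l_i + 1) X)\<close> by \<open>\<Prod>(1 - l_i X)\<close> agree for the two weights, where \<open>l_i\<close> runs through the
  shifted weight, and these quotients determine the multiset of the \<open>l_i\<close>.
\<close>

lemma weight_linkage:
  assumes "singular n l z" "has_weight n l M z" "z \<noteq> 0"
  obtains \<pi> where "\<pi> permutes {1..n}" "\<And>i. i \<in> {1..n} \<Longrightarrow> rho_shift n M i = rho_shift n l (\<pi> i)"
proof -
  let ?p = "\<lambda>c::nat \<Rightarrow> complex. \<Prod>i\<in>{1..n}. [:1, - c i:]"
  let ?f = "\<lambda>c::nat \<Rightarrow> complex. \<Prod>i\<in>{1..n}. 1 - fps_const (c i) * fps_X"
  have fp: "fps_of_poly (?p c) = ?f c" for c
    by (simp add: fps_of_poly_prod fps_of_linear)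
  define S where "S M = 1 - fps_X * (\<Sum>i\<in>{1..n}. Abs_fps (\<lambda>m. gelfand_ev n M m i))" for M
  have S: "?f (rho_shift n M) * S M = ?f (\<lambda>i. rho_shift n M i + 1)" for M
    unfolding S_def using gelfand_ev_fps[of 1 n M] by simp
  have "(\<Sum>i\<in>{1..n}. Abs_fps (\<lambda>m. gelfand_ev n M m i)) = (\<Sum>i\<in>{1..n}. Abs_fps (\<lambda>m. gelfand_ev n l m i))"
    using gelfand_ev_sums_eq[OF assms] by (intro fps_ext) (simp add: fps_sum_nth)
  then have SS: "S M = S l" by (simp add: S_def)
  have "?f (\<lambda>i. rho_shift n l i + 1) * ?f (rho_shift n M) = ?f (rho_shift n l) * ?f (\<lambda>i. rho_shift n M i + 1)"
    unfolding S[symmetric] SS by (simp only: ac_simps)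
  then have "fps_of_poly (?p (\<lambda>i. rho_shift n l i + 1) * ?p (rho_shift n M)) =
      fps_of_poly (?p (rho_shift n l) * ?p (\<lambda>i. rho_shift n M i + 1))"
    by (simp only: fps_of_poly_mult fp)
  then have peq: "?p (\<lambda>i. rho_shift n l i + 1) * ?p (rho_shift n M) = ?p (rho_shift n l) * ?p (\<lambda>i. rho_shift n M i + 1)"
    by (simp only: fps_of_poly_eq_iff)
  (* The reversed polynomials, whose roots retain the values c i = 0. *)
  let ?q = "\<lambda>c::nat \<Rightarrow> complex. \<Prod>i\<in>{1..n}. [:- c i, 1:]"
  have pq: "poly (?p c) (1 / u) * u ^ n = poly (?q c) u" if "u \<noteq> 0" for c u
    using poly_prod_linear[of "{1..n}" u c] that by (simp add: poly_prod)
  have gelfand_ev: "poly (?q (\<lambda>i. rho_shift n l i + 1) * ?q (rho_shift n M)) u = poly (?q (rho_shift n l) * ?q (\<lambda>i. rho_shift n M i + 1)) u"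
    if "u \<noteq> 0" for u
  proof -
    have "poly (?p (\<lambda>i. rho_shift n l i + 1)) (1/u) * poly (?p (rho_shift n M)) (1/u) =
        poly (?p (rho_shift n l)) (1/u) * poly (?p (\<lambda>i. rho_shift n M i + 1)) (1/u)"
      using peq by (simp only: poly_mult[symmetric])
    then show ?thesis
      unfolding poly_mult pq[OF that, symmetric] by (simp only: ac_simps)
  qed
  have qeq: "?q (\<lambda>i. rho_shift n l i + 1) * ?q (rho_shift n M) = ?q (rho_shift n l) * ?q (\<lambda>i. rho_shift n M i + 1)"
  proof -
    let ?d = "?q (\<lambda>i. rho_shift n l i + 1) * ?q (rho_shift n M) - ?q (rho_shift n l) * ?q (\<lambda>i. rho_shift n M i + 1)"
    have "poly ?d (1 + of_nat k) = 0" for k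
    proof -
      have "(1 + of_nat k :: complex) \<noteq> 0"
        by (metis of_nat_Suc of_nat_eq_0_iff nat.distinct(1))
      from gelfand_ev[OF this] show ?thesis by (simp only: poly_diff) simp
    qed
    then have "poly (pcompose ?d [:1, 1:]) (of_nat k) = 0" for k
      by (simp only: poly_pcompose) simp
    then have "pcompose ?d [:1, 1:] = 0" by (rule poly_eq_0_of_nat)
    then have "?d = 0" by (subst (asm) pcompose_eq_0_iff) auto
    then show ?thesis by simp
  qed
  have proots: "proots (?q c) = image_mset c (mset_set {1..n})" for c
  proof -
    have "proots (?q c) = (\<Sum>i\<in>{1..n}. {#c i#})"
      by (simp add: proots_prod)
    also have "\<dots> = image_mset c (mset_set I)" if "I = {1..n}" for I
      unfolding that[symmetric] by (induction I rule: infinite_finite_induct) auto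
    finally show ?thesis by simp
  qed
  have pm: "proots (?q a * ?q b) = proots (?q a) + proots (?q b)" for a b
    by (rule proots_mult) simp_all
  have "proots (?q (\<lambda>i. rho_shift n l i + 1)) + proots (?q (rho_shift n M)) = proots (?q (rho_shift n l)) + proots (?q (\<lambda>i. rho_shift n M i + 1))"
    using arg_cong[OF qeq, of proots] unfolding pm[of "\<lambda>i. rho_shift n l i + 1" "rho_shift n M"] pm[of "rho_shift n l" "\<lambda>i. rho_shift n M i + 1"] .
  then have sum_eq: "image_mset (\<lambda>i. rho_shift n l i + 1) (mset_set {1..n}) + image_mset (rho_shift n M) (mset_set {1..n}) =
      image_mset (rho_shift n l) (mset_set {1..n}) + image_mset (\<lambda>i. rho_shift n M i + 1) (mset_set {1..n})"
    unfolding proots[of "\<lambda>i. rho_shift n l i + 1"] proots[of "rho_shift n M"] proots[of "rho_shift n l"]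
      proots[of "\<lambda>i. rho_shift n M i + 1"] .
  have succ: "image_mset (\<lambda>x. x + 1) (image_mset c B) = image_mset (\<lambda>i. c i + 1) B" for c :: "nat \<Rightarrow> complex" and B
    by (simp add: multiset.map_comp comp_def)
  have "image_mset (rho_shift n l) (mset_set {1..n}) = image_mset (rho_shift n M) (mset_set {1..n})"
  proof (rule mset_eq_of_shift)
    show "image_mset (\<lambda>x. x + 1) (image_mset (rho_shift n l) (mset_set {1..n})) + image_mset (rho_shift n M) (mset_set {1..n}) =
      image_mset (rho_shift n l) (mset_set {1..n}) + image_mset (\<lambda>x. x + 1) (image_mset (rho_shift n M) (mset_set {1..n}))"
      unfolding succ[of "rho_shift n l"] succ[of "rho_shift n M"] by (rule sum_eq)
  qed
  then obtain p where "p permutes {1..n}" "\<forall>x\<in>{1..n}. rho_shift n M x = rho_shift n l (p x)"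
    using image_mset_eq_implies_permutes[of "{1..n}" "rho_shift n M" "rho_shift n l"] by (metis finite_atLeastAtMost)
  then show ?thesis
    using that by blast
qed

section \<open>Powers of a lowering operator\<close>

lemma comm_power_zero: "comm x y = 0 \<Longrightarrow> comm x (y ^ a) = 0" for x y :: "'a::ring_1"
proof (induction a)
  case 0
  show ?case by (simp add: comm_def)
qed (simp add: comm_mult_right)

lemma comm_power_sl2:
  fixes x f h :: "'a::ring_1"
  assumes "comm x f = h" "comm h f = - (f + f)"
  shows "comm x (f ^ Suc a) = of_nat (Suc a) * (f ^ a * (h - of_nat a))"
proof (induction a)
  case 0
  then show ?case using assms(1) by (simp add: comm_mult_right)
next
  case (Suc a)
  have hf: "h * f ^ b = f ^ b * (h - 2 * of_nat b)" for b
  proof (induction b)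
    case (Suc b)
    have "h * f = comm h f + f * h" by (simp add: comm_def)
    then have "h * f = f * h - (f + f)" by (simp add: assms(2))
    moreover have "h * f ^ Suc b = (h * f) * f ^ b" by (simp add: mult.assoc)
    ultimately have "h * f ^ Suc b = (f * h - (f + f)) * f ^ b" by simp
    also have "\<dots> = f * (h * f ^ b) - 2 * f ^ Suc b"
      by (simp add: algebra_simps mult_2 mult_2_right)
    also have "\<dots> = f ^ Suc b * (h - 2 * of_nat b) - 2 * f ^ Suc b"
      by (simp add: Suc.IH mult.assoc)
    also have "\<dots> = f ^ Suc b * (h - 2 * of_nat (Suc b))"
      by (simp add: algebra_simps mult_2 mult_2_right)
    finally show ?case .
  qed simp
  have "comm x (f ^ Suc (Suc a)) = h * f ^ Suc a + f * comm x (f ^ Suc a)"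
    by (simp add: comm_mult_right assms(1) algebra_simps)
  also have "\<dots> = f ^ Suc a * (h - 2 * of_nat (Suc a)) + f * (of_nat (Suc a) * (f ^ a * (h - of_nat a)))"
    unfolding hf Suc.IH ..
  also have "f * (of_nat (Suc a) * (f ^ a * (h - of_nat a))) = f ^ Suc a * (of_nat (Suc a) * (h - of_nat a))"
    by (metis (no_types, lifting) mult.assoc mult_of_nat_commute power_Suc)
  also have "f ^ Suc a * (h - 2 * of_nat (Suc a)) + \<dots> =
      f ^ Suc a * ((h - 2 * of_nat (Suc a)) + of_nat (Suc a) * (h - of_nat a))"
    by (simp only: distrib_left)
  also have "(h - 2 * of_nat (Suc a)) + of_nat (Suc a) * (h - of_nat a) = of_nat (Suc (Suc a)) * (h - of_nat (Suc a))"
    by (simp add: algebra_simps mult_2)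
  also have "f ^ Suc a * \<dots> = of_nat (Suc (Suc a)) * (f ^ Suc a * (h - of_nat (Suc a)))"
    by (metis (no_types, lifting) mult.assoc mult_of_nat_commute)
  finally show ?case .
qed

lemma binomial_commuting:
  fixes x y :: "'a::ring_1"
  assumes "x * y = y * x"
  shows "(x + y) ^ n = (\<Sum>k\<le>n. of_nat (n choose k) * (x ^ (n - k) * y ^ k))"
proof (induction n)
  case (Suc n)
  define S where "S = (\<Sum>k\<le>n. of_nat (n choose k) * (x ^ (n - k) * y ^ k))"
  have xS: "x * S = (\<Sum>k\<le>n. of_nat (n choose k) * (x ^ (Suc n - k) * y ^ k))"
    unfolding S_def sum_distrib_left
  proof (intro sum.cong refl)
    fix k assume "k \<in> {..n}"
    then show "x * (of_nat (n choose k) * (x ^ (n - k) * y ^ k)) = of_nat (n choose k) * (x ^ (Suc n - k) * y ^ k)"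
      by (simp add: Suc_diff_le) (metis (no_types, lifting) mult.assoc mult_of_nat_commute)
  qed
  have xy: "y * x ^ k = x ^ k * y" for k
    by (induction k) (simp_all, metis assms mult.assoc)
  have yS: "y * S = (\<Sum>k\<le>n. of_nat (n choose k) * (x ^ (n - k) * y ^ Suc k))"
    unfolding S_def sum_distrib_left
  proof (intro sum.cong refl)
    fix k
    have "y * (of_nat (n choose k) * (x ^ (n - k) * y ^ k)) = of_nat (n choose k) * (y * x ^ (n - k) * y ^ k)"
      by (metis (no_types, lifting) mult.assoc mult_of_nat_commute)
    then show "y * (of_nat (n choose k) * (x ^ (n - k) * y ^ k)) = of_nat (n choose k) * (x ^ (n - k) * y ^ Suc k)"
      unfolding xy by (simp add: mult.assoc)
  qed
  have "(\<Sum>k\<le>Suc n. of_nat (Suc n choose k) * (x ^ (Suc n - k) * y ^ k)) =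
      x ^ Suc n + (\<Sum>k\<le>n. of_nat (Suc n choose Suc k) * (x ^ (n - k) * y ^ Suc k))"
    by (subst sum.atMost_Suc_shift) simp
  also have "\<dots> = (x ^ Suc n + (\<Sum>k\<le>n. of_nat (n choose Suc k) * (x ^ (Suc n - Suc k) * y ^ Suc k))) + y * S"
    unfolding yS by (simp add: algebra_simps sum.distrib)
  also have "x ^ Suc n + (\<Sum>k\<le>n. of_nat (n choose Suc k) * (x ^ (Suc n - Suc k) * y ^ Suc k))
      = (\<Sum>k\<le>Suc n. of_nat (n choose k) * (x ^ (Suc n - k) * y ^ k))"
    by (subst sum.atMost_Suc_shift) simp
  also have "\<dots> = x * S"
    unfolding xS by (simp add: binomial_eq_0)
  finally show ?case
    using Suc.IH by (simp add: S_def distrib_right)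
qed simp

section \<open>Polynomial functions of one variable\<close>

definition poly_map :: "(complex \<Rightarrow> complex) \<Rightarrow> bool" where
  "poly_map u \<longleftrightarrow> (\<exists>w. \<forall>t. u t = poly w t)"

lemma poly_map_const: "poly_map (\<lambda>t. c)"
  unfolding poly_map_def by (rule exI[of _ "[:c:]"]) simp

lemma poly_map_id: "poly_map (\<lambda>t. t)"
  unfolding poly_map_def by (rule exI[of _ "[:0, 1:]"]) simp

lemma poly_map_add: "poly_map u \<Longrightarrow> poly_map v \<Longrightarrow> poly_map (\<lambda>t. u t + v t)"
  unfolding poly_map_def by (metis poly_add)

lemma poly_map_diff: "poly_map u \<Longrightarrow> poly_map v \<Longrightarrow> poly_map (\<lambda>t. u t - v t)"
  unfolding poly_map_def by (metis poly_diff)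

lemma poly_map_mult: "poly_map u \<Longrightarrow> poly_map v \<Longrightarrow> poly_map (\<lambda>t. u t * v t)"
  unfolding poly_map_def by (metis poly_mult)

lemma poly_map_sum: "(\<And>i. i \<in> I \<Longrightarrow> poly_map (u i)) \<Longrightarrow> poly_map (\<lambda>t. \<Sum>i\<in>I. u i t)"
  by (induction I rule: infinite_finite_induct) (auto intro: poly_map_const poly_map_add)

lemma poly_map_prod: "(\<And>i. i \<in> I \<Longrightarrow> poly_map (u i)) \<Longrightarrow> poly_map (\<lambda>t. \<Prod>i\<in>I. u i t)"
  by (induction I rule: infinite_finite_induct) (auto intro: poly_map_const poly_map_mult)

lemma poly_map_gbinomial: "poly_map (\<lambda>t. t gchoose k)"
  unfolding gbinomial_altdef_of_nat divide_inverse
  by (intro poly_map_prod poly_map_mult poly_map_diff poly_map_id poly_map_const)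

lemma poly_map_shift: "poly_map u \<Longrightarrow> poly_map (\<lambda>t. u (t - c))"
  unfolding poly_map_def
proof (elim exE)
  fix w assume "\<forall>t. u t = poly w t"
  then show "\<exists>w. \<forall>t. u (t - c) = poly w t"
    by (intro exI[of _ "pcompose w [:- c, 1:]"]) (simp add: poly_pcompose algebra_simps)
qed

text \<open>
  Shifting one exponent by \<open>t\<close> turns polynomial dependence on the exponents into polynomial
  dependence on \<open>t\<close>.
\<close>

lemma poly_map_polyfun: "polyfun u \<Longrightarrow> poly_map (\<lambda>t. u (e(q := e q + t)))"
proof -
  assume "polyfun u"
  moreover have "(\<lambda>x. e x + t * ((\<lambda>_. 0)(q := 1)) x) = e(q := e q + t)" for t
    by auto
  ultimately show ?thesis
    using polyfun_line[of u e "(\<lambda>_. 0)(q := 1)"] by (simp add: poly_map_def)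
qed

lemma poly_map_eqI:
  assumes "poly_map u" "poly_map v" "\<And>k::nat. u (of_nat k) = v (of_nat k)"
  shows "u t = v t"
proof -
  obtain w where w: "\<And>t. u t - v t = poly w t"
    using poly_map_diff[OF assms(1,2)] by (auto simp: poly_map_def)
  have "poly w (of_nat k) = 0" for k
    using w[of "of_nat k"] assms(3)[of k] by simp
  then have "w = 0" by (rule poly_eq_0_of_nat)
  then show ?thesis using w[of t] by simp
qed

section \<open>Complex powers of a lowering operator\<close>

text \<open>
  \<open>E_{i+1,i}\<close> acts as \<open>x_{i+1,i} + tail_op i\<close>. The two summands commute, and \<open>eta i a\<close> is the
  binomial expansion of the \<open>a\<close>-th power of their sum.
\<close>

definition tail_op :: "nat \<Rightarrow> linop" where
  "tail_op i = (\<Sum>a\<in>{1..<i}. xop (i + 1) a * dop i a)"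

lemma gl_lowering: "1 \<le> i \<Longrightarrow> i < n \<Longrightarrow> gl n l 1 (Suc i) i = xop (Suc i) i + tail_op i"
  by (subst gl_lower) (simp_all add: tail_op_def flip: Suc_eq_plus1)

lemma tail_op_power: "((\<lambda>g. \<Sum>j\<in>{1..<i}. xmul (i + 1) j (dx i j g)) ^^ p) f = app (tail_op i ^ p) f"
  by (induction p) (simp_all add: tail_op_def app_xop app_dop)

lemma preserves_tail_op: "i < n \<Longrightarrow> preserves n (tail_op i)"
  unfolding tail_op_def by (intro preserves_sum preserves_mult preserves_xop preserves_dop) (auto simp: tri_def)

definition row_degree :: "nat \<Rightarrow> exponents \<Rightarrow> complex" where
  "row_degree i e = (\<Sum>a\<in>{1..<i}. e (Suc i, a))"

lemma row_degree_upd: "row_degree i (e((Suc i, i) := c)) = row_degree i e"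
  by (simp add: row_degree_def)

lemma tail_op_nonzero:
  assumes "app (tail_op i) f e \<noteq> 0"
  obtains a where "a \<in> {1..<i}" "f (e((Suc i, a) := e (Suc i, a) - 1, (i, a) := e (i, a) + 1)) \<noteq> 0"
proof -
  have "app (tail_op i) f e = (\<Sum>a\<in>{1..<i}. (e (i, a) + 1) * f (e((Suc i, a) := e (Suc i, a) - 1, (i, a) := e (i, a) + 1)))"
    by (simp add: tail_op_def sum_apply app_xop_apply app_dop_apply flip: Suc_eq_plus1)
  with assms obtain a where "a \<in> {1..<i}"
    "(e (i, a) + 1) * f (e((Suc i, a) := e (Suc i, a) - 1, (i, a) := e (i, a) + 1)) \<noteq> 0"
    by (metis (no_types, lifting) sum.neutral)
  then show ?thesis using that by auto
qed

text \<open>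
  Each application of \<open>tail_op i\<close> raises the degree in the \<open>x_{i+1,j}\<close>, \<open>j < i\<close>, by one, and
  before the first one this degree is natural.
\<close>

lemma tail_op_power_row_degree:
  assumes "supported n f" "i < n"
  shows "app (tail_op i ^ p) f e \<noteq> 0 \<Longrightarrow> \<exists>k. row_degree i e = of_nat (p + k)"
proof (induction p arbitrary: e)
  case 0
  then have "e \<in> exponents_of n" using supportedD[OF assms(1)] by simp
  then have "row_degree i e \<in> \<nat>"
    unfolding row_degree_def using assms(2) by (intro Nats_sum) (auto simp: exponents_of_def)
  then show ?case by (auto elim: Nats_cases)
next
  case (Suc p)
  then obtain a where a: "a \<in> {1..<i}"
    "app (tail_op i ^ p) f (e((Suc i, a) := e (Suc i, a) - 1, (i, a) := e (i, a) + 1)) \<noteq> 0"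
    by (auto elim: tail_op_nonzero)
  from Suc.IH[OF a(2)] obtain k where
    "row_degree i (e((Suc i, a) := e (Suc i, a) - 1, (i, a) := e (i, a) + 1)) = of_nat (p + k)" ..
  moreover have "row_degree i (e((Suc i, a) := e (Suc i, a) - 1, (i, a) := e (i, a) + 1)) =
      (\<Sum>b\<in>{1..<i}. e (Suc i, b) - (if b = a then 1 else 0))"
    unfolding row_degree_def by (intro sum.cong) auto
  moreover have "\<dots> = row_degree i e - 1"
    using a(1) by (simp add: sum_subtractf row_degree_def)
  ultimately have "row_degree i e = of_nat (Suc p + k)" by (simp add: algebra_simps)
  then show ?case ..
qed

text \<open>
  Where \<open>row_degree i e\<close> is not a natural number, no term of \<open>eta\<close> contributes and any bound is
  correct.
\<close>

definition row_bound :: "nat \<Rightarrow> exponents \<Rightarrow> nat" where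
  "row_bound i e = nat \<lfloor>Re (row_degree i e)\<rfloor>"

lemma row_bound_upd: "row_bound i (e((Suc i, i) := c)) = row_bound i e"
  by (simp add: row_bound_def row_degree_upd)

lemma tail_op_power_row_bound:
  assumes "supported n f" "i < n" "row_bound i e < p"
  shows "app (tail_op i ^ p) f e = 0"
proof (rule ccontr)
  assume "app (tail_op i ^ p) f e \<noteq> 0"
  from tail_op_power_row_degree[OF assms(1,2) this] obtain k where "row_degree i e = of_nat (p + k)" ..
  then have "row_bound i e = p + k" by (simp add: row_bound_def flip: of_nat_add)
  then show False using assms(3) by simp
qed

lemma eta_finite:
  assumes "supported n f" "i < n" "row_bound i e \<le> N"
  shows "eta i a f e = (\<Sum>p\<le>N. (a gchoose p) * app (tail_op i ^ p) f (e((Suc i, i) := e (Suc i, i) - (a - of_nat p))))"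
proof -
  have "eta i a f e = Sum_any (\<lambda>p. (a gchoose p) * app (tail_op i ^ p) f (e((Suc i, i) := e (Suc i, i) - (a - of_nat p))))"
    unfolding eta_def tail_op_power by (simp only: xpow_def Suc_eq_plus1)
  also have "\<dots> = (\<Sum>p\<in>{..N}. (a gchoose p) * app (tail_op i ^ p) f (e((Suc i, i) := e (Suc i, i) - (a - of_nat p))))"
    using assms by (intro Sum_any.expand_superset) (auto simp: row_bound_upd not_le[symmetric] intro: tail_op_power_row_bound)
  finally show ?thesis .
qed

text \<open>
  At the exponent shifted by \<open>a\<close>, the parameter \<open>a\<close> enters only through the binomial
  coefficients. Therefore the coefficients of \<open>eta i a f\<close>, read in this way, are polynomials in
  \<open>a\<close>.
\<close>

lemma eta_shifted:
  assumes "supported n f" "i < n" "row_bound i e \<le> N"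
  shows "eta i a f (e((Suc i, i) := e (Suc i, i) + a)) =
    (\<Sum>p\<le>N. (a gchoose p) * app (tail_op i ^ p) f (e((Suc i, i) := e (Suc i, i) + of_nat p)))"
  using assms by (subst eta_finite[of n f i _ N]) (auto simp: row_bound_upd)

lemma poly_map_eta:
  assumes "supported n f" "i < n"
  shows "poly_map (\<lambda>t. eta i t f (e((Suc i, i) := e (Suc i, i) + t)))"
  unfolding eta_shifted[OF assms order_refl]
  by (intro poly_map_sum poly_map_mult poly_map_gbinomial poly_map_const)

lemma eta_fscale:
  assumes "supported n f" "i < n"
  shows "eta i a (fscale c f) = fscale c (eta i a f)"
proof
  fix e
  show "eta i a (fscale c f) e = fscale c (eta i a f) e"
    using eta_finite[OF supported_fscale[OF assms(1)] assms(2) order_refl, of a c e] eta_finite[OF assms order_refl, of a e]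
    by (simp add: app_fscale) (simp add: fscale_def sum_distrib_left mult_ac)
qed

lemma eta_zero: "eta i a 0 = 0"
  unfolding eta_def tail_op_power by (simp add: xpow_def fun_eq_iff)

lemma app_xop_power: "app (xop i j ^ k) f e = f (e((i, j) := e (i, j) - of_nat k))"
proof (induction k arbitrary: e)
  case (Suc k)
  have "app (xop i j ^ Suc k) f e = app (xop i j ^ k) f (e((i, j) := e (i, j) - 1))"
    by (simp add: app_xop_apply)
  also have "\<dots> = f ((e((i, j) := e (i, j) - 1))((i, j) := (e((i, j) := e (i, j) - 1)) (i, j) - of_nat k))"
    by (rule Suc.IH)
  also have "(e((i, j) := e (i, j) - 1))((i, j) := (e((i, j) := e (i, j) - 1)) (i, j) - of_nat k)
      = e((i, j) := e (i, j) - of_nat (Suc k))"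
    by (simp add: diff_diff_eq)
  finally show ?case .
qed simp

lemma comm_xop_tail_op: "comm (xop (Suc i) i) (tail_op i) = 0"
  unfolding tail_op_def by (simp add: comm_simps comm_xop_xop comm_xop_dop)

lemma eta_of_nat:
  assumes "supported n f" "1 \<le> i" "i < n"
  shows "eta i (of_nat a) f = app (gl n l 1 (Suc i) i ^ a) f"
proof
  fix e
  have 1: "eta i (of_nat a) f e = (\<Sum>p\<le>max a (row_bound i e). (of_nat a gchoose p) *
      app (tail_op i ^ p) f (e((Suc i, i) := e (Suc i, i) - (of_nat a - of_nat p))))"
    using assms by (intro eta_finite) auto
  also have "\<dots> = (\<Sum>p\<le>a. (of_nat a gchoose p) *
      app (tail_op i ^ p) f (e((Suc i, i) := e (Suc i, i) - (of_nat a - of_nat p))))"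
    by (intro sum.mono_neutral_right) (auto simp flip: binomial_gbinomial)
  also have "\<dots> = (\<Sum>p\<le>a. of_nat (a choose p) * app (xop (Suc i) i ^ (a - p)) (app (tail_op i ^ p) f) e)"
    by (intro sum.cong refl) (simp add: app_xop_power of_nat_diff binomial_gbinomial)
  also have "\<dots> = app ((xop (Suc i) i + tail_op i) ^ a) f e"
  proof -
    have of_nat: "(of_nat k :: linop) = scop (of_nat k)" for k
      by (rule linop_eqI, induction k) (simp_all add: fun_eq_iff fscale_def algebra_simps)
    have com: "xop (Suc i) i * tail_op i = tail_op i * xop (Suc i) i"
      using comm_xop_tail_op by (simp add: comm_eq_zero_iff)
    show ?thesis
      unfolding binomial_commuting[OF com] of_nat by (simp add: sum_apply) (simp add: fscale_def)
  qed
  finally show "eta i (of_nat a) f e = app (gl n l 1 (Suc i) i ^ a) f e"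
    using assms by (simp add: gl_lowering)
qed

lemma poly_map_polyop_eta:
  assumes "supported n f" "i < n" "polyop U"
  shows "poly_map (\<lambda>t. app U (eta i t f) (e((Suc i, i) := e (Suc i, i) + t)))"
proof -
  obtain S p where U: "finite S" "\<And>s. polyfun (p s)" "\<And>f e. app U f e = (\<Sum>s\<in>S. p s e * f (e + s))"
    using assms(3) unfolding polyop_def by blast
  have upd: "e((Suc i, i) := e (Suc i, i) + t) + s = (e + s)((Suc i, i) := (e + s) (Suc i, i) + t)" for t s
    by (auto simp: fun_eq_iff)
  show ?thesis
    unfolding U(3) upd by (intro poly_map_sum poly_map_mult poly_map_polyfun U poly_map_eta[OF assms(1,2)])
qed

definition coroot_op :: "nat \<Rightarrow> (nat \<Rightarrow> complex) \<Rightarrow> nat \<Rightarrow> linop" where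
  "coroot_op n l i = gl n l 1 i i - gl n l 1 (Suc i) (Suc i)"

lemma raising_lowering:
  assumes "1 \<le> i" "i < n" "1 \<le> j" "j < n"
  shows "comm (gl n l 1 j (Suc j)) (gl n l 1 (Suc i) i) = (if i = j then coroot_op n l i else 0)"
  using assms comm_gl[of 1 j n "Suc j" "Suc i" i l] by (auto simp: coroot_op_def)

lemma coroot_op_lowering:
  assumes "1 \<le> i" "i < n"
  shows "comm (coroot_op n l i) (gl n l 1 (Suc i) i) = - (gl n l 1 (Suc i) i + gl n l 1 (Suc i) i)"
  using assms comm_gl[of 1 i n i "Suc i" i l] comm_gl[of 1 "Suc i" n "Suc i" "Suc i" i l]
  by (simp add: coroot_op_def comm_diff_left)

lemma preserves_coroot_op: "1 \<le> i \<Longrightarrow> i < n \<Longrightarrow> preserves n (coroot_op n l i)"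
  unfolding coroot_op_def by (intro preserves_diff preserves_gl) auto

lemma raising_eta_of_nat:
  assumes "supported n f" and ij: "1 \<le> i" "i < n" "1 \<le> j" "j < n" and t_def: "t = of_nat a"
  shows "app (gl n l 1 j (Suc j)) (eta i t f) = eta i t (app (gl n l 1 j (Suc j)) f)
    + (if i = j then fscale t (eta i (t - 1) (app (coroot_op n l i) f) - fscale (t - 1) (eta i (t - 1) f)) else 0)"
proof -
  let ?E = "gl n l 1 j (Suc j)" and ?F = "gl n l 1 (Suc i) i" and ?H = "coroot_op n l i"
  have goodE: "supported n (app ?E f)"
    using preserves_gl[of 1 j n "Suc j" l] assms(1) ij by (auto simp: preserves_def)
  have goodH: "supported n (app ?H f)"
    using preserves_coroot_op[of i n l] assms(1) ij by (auto simp: preserves_def)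
  have comm: "comm ?E ?F = (if i = j then ?H else 0)"
    using ij by (rule raising_lowering)
  show ?thesis
  proof (cases "i = j \<and> a \<noteq> 0")
    case False
    then have "comm ?E (?F ^ a) = 0"
      using comm_power_zero[of ?E ?F a] comm by (cases "i = j") (auto simp: comm_def)
    from comm_appD[OF this, of f] False show ?thesis
      unfolding t_def eta_of_nat[OF assms(1) ij(1,2), of a l] eta_of_nat[OF goodE ij(1,2), of a l]
      by (auto simp: fscale_null)
  next
    case True
    then obtain b where b: "a = Suc b" by (cases a) auto
    have "comm ?E (?F ^ Suc b) = of_nat (Suc b) * (?F ^ b * (?H - of_nat b))"
      by (rule comm_power_sl2) (use comm True coroot_op_lowering ij in auto)
    from comm_appD[OF this, of f]
    have *: "app ?E (app (?F ^ a) f) = app (?F ^ a) (app ?E f) + app (of_nat (Suc b) * (?F ^ b * (?H - of_nat b))) f"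
      by (simp add: b)
    have of_nat: "(of_nat k :: linop) = scop (of_nat k)" for k
      by (rule linop_eqI, induction k) (simp_all add: fun_eq_iff fscale_def algebra_simps)
    have t1: "t - 1 = of_nat b" by (simp add: t_def b)
    have "app (of_nat (Suc b) * (?F ^ b * (?H - of_nat b))) f =
        fscale t (app (?F ^ b) (app ?H f) - fscale (of_nat b) (app (?F ^ b) f))"
      unfolding of_nat t_def b
      by (simp only: app_mult app_diff app_scop app_diff_arg app_fscale)
         (simp add: fscale_def fun_eq_iff algebra_simps)
    with * show ?thesis
      unfolding t1 eta_of_nat[OF assms(1) ij(1,2), of b l] eta_of_nat[OF goodH ij(1,2), of b l]
      unfolding t_def eta_of_nat[OF assms(1) ij(1,2), of a l] eta_of_nat[OF goodE ij(1,2), of a l]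
      using True by simp
  qed
qed

text \<open>
  For natural \<open>t\<close> this is the commutation of \<open>E_{j,j+1}\<close> with the \<open>t\<close>-th power of \<open>E_{i+1,i}\<close>.
  Both sides, read at an exponent shifted by \<open>t\<close>, are polynomials in \<open>t\<close>, so that the identity
  persists for complex \<open>t\<close>.
\<close>

lemma raising_eta:
  assumes "supported n f" and ij: "1 \<le> i" "i < n" "1 \<le> j" "j < n"
  shows "app (gl n l 1 j (Suc j)) (eta i t f) = eta i t (app (gl n l 1 j (Suc j)) f)
    + (if i = j then fscale t (eta i (t - 1) (app (coroot_op n l i) f) - fscale (t - 1) (eta i (t - 1) f)) else 0)"
    (is "_ = ?rhs t")
proof
  fix e'
  let ?q = "(Suc i, i)"
  (* The exponent to which the shift by t leads back from e'. *)
  define e where "e = e'(?q := e' ?q - t)"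
  have e': "e' = e(?q := e ?q + t)" by (simp add: e_def)
  let ?E = "gl n l 1 j (Suc j)" and ?F = "gl n l 1 (Suc i) i" and ?H = "coroot_op n l i"
  have goodE: "supported n (app ?E f)"
    using preserves_gl[of 1 j n "Suc j" l] assms(1) ij by (auto simp: preserves_def)
  have goodH: "supported n (app ?H f)"
    using preserves_coroot_op[of i n l] assms(1) ij by (auto simp: preserves_def)
  have sh: "poly_map (\<lambda>t. eta i (t - 1) g (e(?q := e ?q + t)))" if "supported n g" for g
  proof -
    have "poly_map (\<lambda>s. eta i s g ((e(?q := e ?q + 1))(?q := (e(?q := e ?q + 1)) ?q + s)))"
      using that ij(2) by (rule poly_map_eta)
    from poly_map_shift[OF this, of 1] show ?thesis by (simp add: algebra_simps)
  qed
  have "poly_map (\<lambda>t. ?rhs t (e(?q := e ?q + t)))"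
  proof (cases "i = j")
    case True
    then have eq: "(\<lambda>t. ?rhs t (e(?q := e ?q + t))) = (\<lambda>t. eta i t (app ?E f) (e(?q := e ?q + t)) +
       t * (eta i (t - 1) (app ?H f) (e(?q := e ?q + t)) - (t - 1) * eta i (t - 1) f (e(?q := e ?q + t))))"
      by (simp only: fscale_def if_True plus_fun_apply minus_apply simp_thms)
    show ?thesis
      unfolding eq
      by (intro poly_map_add poly_map_mult poly_map_diff poly_map_const poly_map_id sh[OF goodH] sh[OF assms(1)] poly_map_eta[OF goodE ij(2)])
  next
    case False
    then have eq: "(\<lambda>t. ?rhs t (e(?q := e ?q + t))) = (\<lambda>t. eta i t (app ?E f) (e(?q := e ?q + t)))"
      by (simp only: if_False plus_fun_apply zero_fun_apply add_0_right)
    show ?thesis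
      unfolding eq by (rule poly_map_eta[OF goodE ij(2)])
  qed
  with poly_map_polyop_eta[OF assms(1) ij(2) polyop_gl, of n l 1 j "Suc j" e]
  have "app ?E (eta i t f) (e(?q := e ?q + t)) = ?rhs t (e(?q := e ?q + t))"
    by (rule poly_map_eqI) (simp only: raising_eta_of_nat[OF assms(1) ij refl])
  then show "app ?E (eta i t f) e' = ?rhs t e'"
    unfolding e' .
qed

lemma weight_of_upd:
  assumes "(a, b) \<in> tri n" "k \<in> {1..n}"
  shows "weight_of n l (e((a, b) := c)) k = weight_of n l e k + (if k = a then c - e (a, b) else 0) - (if k = b then c - e (a, b) else 0)"
proof -
  have 1: "(\<Sum>j\<in>{1..<k}. (e((a, b) := c)) (k, j)) = (\<Sum>j\<in>{1..<k}. e (k, j) + (if j = b then if k = a then c - e (a, b) else 0 else 0))"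
    by (intro sum.cong) auto
  have 2: "(\<Sum>m\<in>{k<..n}. (e((a, b) := c)) (m, k)) = (\<Sum>m\<in>{k<..n}. e (m, k) + (if m = a then if k = b then c - e (a, b) else 0 else 0))"
    by (intro sum.cong) auto
  show ?thesis
    unfolding weight_of_def 1 2 using assms by (auto simp: sum.distrib tri_def)
qed

text \<open>
  \<open>tail_op i\<close> has the weight of \<open>E_{i+1,i}\<close>.
\<close>

lemma tail_op_power_weight_of:
  assumes "has_weight n l M f" "i < n"
  shows "app (tail_op i ^ p) f e \<noteq> 0 \<Longrightarrow> k \<in> {1..n} \<Longrightarrow>
    weight_of n l e k = M k + (if k = Suc i then of_nat p else 0) - (if k = i then of_nat p else 0)"
proof (induction p arbitrary: e)
  case 0
  then show ?case using assms by (auto simp: has_weight_def)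
next
  case (Suc p)
  then obtain a where a: "a \<in> {1..<i}"
    "app (tail_op i ^ p) f (e((Suc i, a) := e (Suc i, a) - 1, (i, a) := e (i, a) + 1)) \<noteq> 0"
    by (auto elim: tail_op_nonzero)
  have t: "(i, a) \<in> tri n" "(Suc i, a) \<in> tri n"
    using a(1) assms(2) by (auto simp: tri_def)
  from Suc.IH[OF a(2) Suc.prems(2)] show ?case
    using Suc.prems(2) a(1) unfolding weight_of_upd[OF t(1) Suc.prems(2)] weight_of_upd[OF t(2) Suc.prems(2)]
    by (auto simp: algebra_simps split: if_splits)
qed

lemma has_weight_eta:
  assumes "has_weight n l M f" "1 \<le> i" "i < n"
  shows "has_weight n l (M(i := M i - a, Suc i := M (Suc i) + a)) (eta i a f)"
proof -
  have supported: "supported n f" using assms(1) by (simp add: has_weight_def)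
  have q: "(Suc i, i) \<in> tri n" using assms by (auto simp: tri_def)
  have nz: "\<exists>p. app (tail_op i ^ p) f (e((Suc i, i) := e (Suc i, i) - (a - of_nat p))) \<noteq> 0"
    if "eta i a f e \<noteq> 0" for e
    using that unfolding eta_finite[OF supported assms(3) order_refl] by (metis (no_types, lifting) mult_zero_right sum.neutral)
  have "e \<in> exponents_of n" if e: "eta i a f e \<noteq> 0" for e
  proof -
    obtain p where "app (tail_op i ^ p) f (e((Suc i, i) := e (Suc i, i) - (a - of_nat p))) \<noteq> 0"
      using nz[OF e] ..
    moreover have "supported n (app (tail_op i ^ p) f)"
      using preserves_power[OF preserves_tail_op[OF assms(3)]] supported by (simp add: preserves_def)
    ultimately have "e((Suc i, i) := e (Suc i, i) - (a - of_nat p)) \<in> exponents_of n"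
      by (blast dest: supportedD)
    then show ?thesis
      by (rule exponents_of_upd[OF _ q]) auto
  qed
  moreover have "weight_of n l e k = (M(i := M i - a, Suc i := M (Suc i) + a)) k"
    if e: "eta i a f e \<noteq> 0" "k \<in> {1..n}" for e k
  proof -
    obtain p where "app (tail_op i ^ p) f (e((Suc i, i) := e (Suc i, i) - (a - of_nat p))) \<noteq> 0"
      using nz[OF e(1)] ..
    from tail_op_power_weight_of[OF assms(1,3) this e(2)] show ?thesis
      unfolding weight_of_upd[OF q e(2)] by (auto simp: algebra_simps split: if_splits)
  qed
  ultimately show ?thesis
    by (auto simp: has_weight_def supported_def)
qed

text \<open>
  The dot action of the \<open>i\<close>-th simple reflection on weights of gl(n).
\<close>

definition refl_wt :: "nat \<Rightarrow> (nat \<Rightarrow> complex) \<Rightarrow> nat \<Rightarrow> complex" where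
  "refl_wt i M = M(i := M (Suc i) - 1, Suc i := M i + 1)"

text \<open>
  The exponent \<open>a\<close> is chosen so that \<open>h_i\<close> acts on \<open>f\<close> by \<open>a - 1\<close>; then the correction term in
  the commutation with \<open>E_{i,i+1}\<close> vanishes.
\<close>

lemma singular_eta:
  assumes singular: "singular n l f" and has_weight: "has_weight n l M f" and i: "1 \<le> i" "i < n"
  defines "a \<equiv> M i - M (Suc i) + 1"
  shows "singular n l (eta i a f)" "has_weight n l (refl_wt i M) (eta i a f)"
proof -
  have supported: "supported n f" using has_weight by (simp add: has_weight_def)
  have H: "app (coroot_op n l i) f = fscale (a - 1) f"
    using app_gl_diagonal_has_weight[OF has_weight, of i] app_gl_diagonal_has_weight[OF has_weight, of "Suc i"] i
    by (simp add: coroot_op_def a_def fscale_def fun_eq_iff algebra_simps)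
  show "singular n l (eta i a f)"
    unfolding singular_def
  proof
    fix j assume j: "j \<in> {1..<n}"
    have "app (gl n l 1 j (Suc j)) f = 0" using singular j by (simp add: singular_def)
    then show "app (gl n l 1 j (Suc j)) (eta i a f) = 0"
      using raising_eta[OF supported i, of j l a] j unfolding H eta_fscale[OF supported i(2)]
      by (simp add: eta_zero fscale_zero)
  qed
  have "refl_wt i M = M(i := M i - a, Suc i := M (Suc i) + a)"
    by (simp add: refl_wt_def a_def)
  then show "has_weight n l (refl_wt i M) (eta i a f)"
    using has_weight_eta[OF has_weight i] by simp
qed

text \<open>
  Every application of \<open>tail_op i\<close> brings in a variable \<open>x_{i+1,j}\<close> with \<open>j < i\<close>, so pure
  monomials come from the leading term \<open>x_{i+1,i}^a\<close> of \<open>eta i a\<close>.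
\<close>

lemma eta_pure_coeff:
  assumes "supported n f" "1 \<le> i" "i < n" "pure n e"
  shows "eta i a f (e((Suc i, i) := e (Suc i, i) + a)) = f e"
proof -
  have "row_degree i e = 0"
    unfolding row_degree_def using assms by (intro sum.neutral) (auto simp: pure_def tri_def)
  then have "row_bound i e = 0" by (simp add: row_bound_def)
  then show ?thesis
    using eta_shifted[OF assms(1,3), of e 0 a] by simp
qed

lemma pure_upd: "pure n e \<Longrightarrow> pure n (e((Suc i, i) := c))"
  by (auto simp: pure_def)

section \<open>The action of the simple reflections\<close>

lemma zeta_fmonom_iff:
  assumes "i \<in> {1..<n}"
  shows "zeta n lam i (fmonom e) = fscale c (fmonom e) \<longleftrightarrow> weight_of n (gl_weight n lam) e i - weight_of n (gl_weight n lam) e (Suc i) = c"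
proof
  assume "zeta n lam i (fmonom e) = fscale c (fmonom e)"
  then have "zeta n lam i (fmonom e) e = fscale c (fmonom e) e" by simp
  then show "weight_of n (gl_weight n lam) e i - weight_of n (gl_weight n lam) e (Suc i) = c"
    using assms by (simp add: zeta_apply fscale_def fmonom_def)
next
  assume "weight_of n (gl_weight n lam) e i - weight_of n (gl_weight n lam) e (Suc i) = c"
  then have "zeta n lam i (fmonom e) x = fscale c (fmonom e) x" for x
    using assms by (cases "x = e") (auto simp: zeta_apply fscale_def fmonom_def)
  then show "zeta n lam i (fmonom e) = fscale c (fmonom e)"
    by (rule ext)
qed

lemma wcomp_apply: "wcomp n lam mu f e =
   (if \<forall>i\<in>{1..<n}. weight_of n (gl_weight n lam) e i - weight_of n (gl_weight n lam) e (Suc i) = mu i then f e else 0)"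
  unfolding wcomp_def using zeta_fmonom_iff[of _ n lam e] by auto

lemma wcomp_has_weight:
  assumes "has_weight n (gl_weight n lam) M f"
  shows "wcomp n lam mu f = (if \<forall>i\<in>{1..<n}. M i - M (Suc i) = mu i then f else 0)"
proof
  fix e
  show "wcomp n lam mu f e = (if \<forall>i\<in>{1..<n}. M i - M (Suc i) = mu i then f else 0) e"
    using assms by (cases "f e = 0") (auto simp: wcomp_apply has_weight_def)
qed

text \<open>
  Of all the weights \<open>mu\<close> in the definition of \<open>sigma\<close>, the weight of \<open>f\<close> is the one with a
  nonzero component; among the functions that represent it a single one is extensional.
\<close>

lemma sigma_has_weight:
  assumes "has_weight n (gl_weight n lam) M f" "i \<in> {1..<n}"
  shows "sigma n lam i f = eta i (M i - M (Suc i) + 1) f"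
proof
  fix e
  define mu where "mu = restrict (\<lambda>i. M i - M (Suc i)) {1..<n}"
  have "(if mu' \<in> extensional {1..<n} then eta i (mu' i + 1) (wcomp n lam mu' f) e else 0)
      = (if mu' = mu then eta i (mu' i + 1) f e else 0)" for mu'
  proof (cases "mu' \<in> extensional {1..<n}")
    case True
    then have "(\<forall>i\<in>{1..<n}. M i - M (Suc i) = mu' i) \<longleftrightarrow> mu' = mu"
      unfolding mu_def by (auto simp: extensional_def restrict_def fun_eq_iff)
    then show ?thesis
      using True by (simp add: wcomp_has_weight[OF assms(1)] eta_zero)
  next
    case False
    then have "mu' \<noteq> mu" unfolding mu_def by auto
    then show ?thesis using False by simp
  qed
  then have "sigma n lam i f e = eta i (mu i + 1) f e"
    unfolding sigma_def by simp
  then show "sigma n lam i f e = eta i (M i - M (Suc i) + 1) f e"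
    using assms(2) by (simp add: mu_def)
qed

section \<open>Weight components of a singular series\<close>

text \<open>
  \<open>U\<close> raises weights by \<open>c\<close>, expressed through the coefficients on which a given coefficient of
  \<open>U f\<close> depends; series may have components in infinitely many weights, so this is not a
  statement about weight vectors alone.
\<close>

definition shifts_weight :: "nat \<Rightarrow> (nat \<Rightarrow> complex) \<Rightarrow> (nat \<Rightarrow> complex) \<Rightarrow> linop \<Rightarrow> bool" where
  "shifts_weight n l c U \<longleftrightarrow> (\<forall>f e. (\<forall>e'. (\<forall>k\<in>{1..n}. weight_of n l e' k = weight_of n l e k - c k) \<longrightarrow> f e' = 0) \<longrightarrow> app U f e = 0)"

lemma shifts_weightD: "shifts_weight n l c U \<Longrightarrow> (\<And>e'. (\<And>k. k \<in> {1..n} \<Longrightarrow> weight_of n l e' k = weight_of n l e k - c k) \<Longrightarrow> f e' = 0) \<Longrightarrow> app U f e = 0"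
  unfolding shifts_weight_def by blast

lemma shifts_weightI: "(\<And>f e. (\<And>e'. (\<And>k. k \<in> {1..n} \<Longrightarrow> weight_of n l e' k = weight_of n l e k - c k) \<Longrightarrow> f e' = 0) \<Longrightarrow> app U f e = 0) \<Longrightarrow> shifts_weight n l c U"
  unfolding shifts_weight_def by blast

text \<open>
  The weight of \<open>E_{i,j}\<close>.
\<close>

definition unit_diff :: "nat \<Rightarrow> nat \<Rightarrow> nat \<Rightarrow> complex" where
  "unit_diff i j k = (if k = i then 1 else 0) - (if k = j then 1 else 0)"

lemma shifts_weight_xop: "(i, j) \<in> tri n \<Longrightarrow> shifts_weight n l (unit_diff i j) (xop i j)"
  by (rule shifts_weightI) (auto simp: app_xop_apply weight_of_upd unit_diff_def)

lemma shifts_weight_dop: "(i, j) \<in> tri n \<Longrightarrow> shifts_weight n l (unit_diff j i) (dop i j)"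
  by (rule shifts_weightI) (auto simp: app_dop_apply weight_of_upd unit_diff_def)

lemma shifts_weight_mult:
  assumes "shifts_weight n l c U" "shifts_weight n l c' V" "\<And>k. c k + c' k = c'' k"
  shows "shifts_weight n l c'' (U * V)"
proof (rule shifts_weightI)
  fix f :: series and e
  assume *: "\<And>e'. (\<And>k. k \<in> {1..n} \<Longrightarrow> weight_of n l e' k = weight_of n l e k - c'' k) \<Longrightarrow> f e' = 0"
  have "app U (app V f) e = 0"
  proof (rule shifts_weightD[OF assms(1)])
    fix e' assume e': "\<And>k. k \<in> {1..n} \<Longrightarrow> weight_of n l e' k = weight_of n l e k - c k"
    show "app V f e' = 0"
    proof (rule shifts_weightD[OF assms(2)])
      fix e'' assume e'': "\<And>k. k \<in> {1..n} \<Longrightarrow> weight_of n l e'' k = weight_of n l e' k - c' k"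
      show "f e'' = 0"
        by (rule *) (simp add: e' e'' flip: assms(3))
    qed
  qed
  then show "app (U * V) f e = 0" by simp
qed

lemma shifts_weight_add: "shifts_weight n l c U \<Longrightarrow> shifts_weight n l c V \<Longrightarrow> shifts_weight n l c (U + V)"
  unfolding shifts_weight_def by simp

lemma shifts_weight_diff: "shifts_weight n l c U \<Longrightarrow> shifts_weight n l c V \<Longrightarrow> shifts_weight n l c (U - V)"
  unfolding shifts_weight_def by simp

lemma shifts_weight_zero: "shifts_weight n l c 0"
  unfolding shifts_weight_def by simp

lemma shifts_weight_sum: "(\<And>i. i \<in> I \<Longrightarrow> shifts_weight n l c (u i)) \<Longrightarrow> shifts_weight n l c (\<Sum>i\<in>I. u i)"
  by (induction I rule: infinite_finite_induct) (auto intro: shifts_weight_add shifts_weight_zero)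

lemma shifts_weight_scop: "shifts_weight n l (unit_diff k k) (scop c)"
  by (rule shifts_weightI) (simp add: fscale_def unit_diff_def)

lemma shifts_weight_xop_dop:
  assumes "(i, k) \<in> tri n" "(j, k) \<in> tri n"
  shows "shifts_weight n l (unit_diff i j) (xop i k * dop j k)"
  by (rule shifts_weight_mult[OF shifts_weight_xop[OF assms(1)] shifts_weight_dop[OF assms(2)]]) (simp add: unit_diff_def)

lemma shifts_weight_gl: "1 \<le> k \<Longrightarrow> i \<in> {k..n} \<Longrightarrow> j \<in> {k..n} \<Longrightarrow> shifts_weight n l (unit_diff i j) (gl n l k i j)"
proof (induction n l k i j rule: gl.induct)
  case (1 n l k i j)
  have kn: "k \<le> n" using "1.prems" by auto
  have N: "shifts_weight n l (unit_diff k k) (xop m k * dop m k)" if "m \<in> {k<..n}" for m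
    by (rule shifts_weight_mult[OF shifts_weight_xop shifts_weight_dop]) (use that "1.prems" in \<open>auto simp: tri_def unit_diff_def\<close>)
  have K: "shifts_weight n l (unit_diff k k) (gl n l k k k)"
    unfolding gl_diag[OF kn] by (intro shifts_weight_diff shifts_weight_scop shifts_weight_sum N)
  consider "i = k" "j = k" | "i = k" "j \<noteq> k" | "i \<noteq> k" "j = k" | "i \<noteq> k" "j \<noteq> k" by blast
  then show ?case
  proof cases
    case 1
    then show ?thesis using K by simp
  next
    case 2
    have "shifts_weight n l (unit_diff k j) (gl n l k k k * dop j k)"
      by (rule shifts_weight_mult[OF K shifts_weight_dop]) (use "1.prems" 2 in \<open>auto simp: tri_def unit_diff_def\<close>)
    moreover have "shifts_weight n l (unit_diff k j) (gl n l (Suc k) m j * dop m k)" if m: "m \<in> {k<..n}" for m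
    proof (rule shifts_weight_mult)
      show "shifts_weight n l (unit_diff m j) (gl n l (Suc k) m j)"
        using "1.IH"(1)[of m] 2 m "1.prems" kn by auto
      show "shifts_weight n l (unit_diff k m) (dop m k)"
        using m "1.prems" by (intro shifts_weight_dop) (auto simp: tri_def)
    qed (simp add: unit_diff_def)
    ultimately show ?thesis
      unfolding \<open>i = k\<close> gl_row[OF kn \<open>j \<noteq> k\<close>] by (intro shifts_weight_diff shifts_weight_sum)
  next
    case 3
    then show ?thesis
      using "1.prems" by (auto simp: gl_col[OF kn] tri_def intro!: shifts_weight_xop)
  next
    case 4
    then show ?thesis
      using "1.prems" "1.IH"(2) kn
      by (auto simp: gl_rest[OF kn] tri_def intro!: shifts_weight_add shifts_weight_xop_dop)
  qed
qed

definition weight_part :: "nat \<Rightarrow> (nat \<Rightarrow> complex) \<Rightarrow> (nat \<Rightarrow> complex) \<Rightarrow> series \<Rightarrow> series" where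
  "weight_part n l M f = (\<lambda>e. if \<forall>k\<in>{1..n}. weight_of n l e k = M k then f e else 0)"

lemma has_weight_weight_part: "supported n f \<Longrightarrow> has_weight n l M (weight_part n l M f)"
  by (auto simp: has_weight_def supported_def weight_part_def)

lemma app_weight_part:
  assumes "shifts_weight n l c U" "app U f = 0"
  shows "app U (weight_part n l M f) = 0"
proof
  fix e
  have "app U (weight_part n l M f) e = 0"
  proof (cases "\<forall>k\<in>{1..n}. weight_of n l e k = M k + c k")
    case True
    have "app U (f - weight_part n l M f) e = 0"
      by (rule shifts_weightD[OF assms(1)]) (use True in \<open>simp add: weight_part_def\<close>)
    then show ?thesis
      by (simp add: app_diff_arg assms(2))
  next
    case False
    show ?thesis
    proof (rule shifts_weightD[OF assms(1)])
      fix e' assume e': "\<And>k. k \<in> {1..n} \<Longrightarrow> weight_of n l e' k = weight_of n l e k - c k"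
      have "\<not> (\<forall>k\<in>{1..n}. weight_of n l e' k = M k)"
        using False e' by (metis diff_add_cancel)
      then show "weight_part n l M f e' = 0" unfolding weight_part_def by (rule if_not_P)
    qed
  qed
  then show "app U (weight_part n l M f) e = 0 e" by simp
qed

lemma singular_weight_part: "singular n l f \<Longrightarrow> singular n l (weight_part n l M f)"
  unfolding singular_def by (auto intro!: app_weight_part[OF shifts_weight_gl])

section \<open>Truncated-up series\<close>

text \<open>
  The difference of the weights contains the simple root \<open>\<alpha>_i\<close> as often as variables \<open>x_{m,j}\<close>
  with \<open>j \<le> i < m\<close> occur.
\<close>

lemma weight_cut:
  assumes "has_weight n l M z" "z e \<noteq> 0" "i \<in> {1..n}"
  shows "(\<Sum>j\<in>{1..i}. l j - M j) = (\<Sum>j\<in>{1..i}. \<Sum>m\<in>{i<..n}. e (m, j))"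
proof -
  have "(\<Sum>j\<in>{1..i}. l j - M j) = (\<Sum>j\<in>{1..i}. l j - weight_of n l e j)"
    using assms by (intro sum.cong) (auto simp: has_weight_def)
  also have "\<dots> = (\<Sum>j\<in>{1..i}. \<Sum>m\<in>{j<..n}. e (m, j)) - (\<Sum>j\<in>{1..i}. \<Sum>a\<in>{1..<j}. e (j, a))"
    by (simp add: weight_of_def sum_subtractf)
  also have "(\<Sum>j\<in>{1..i}. \<Sum>a\<in>{1..<j}. e (j, a)) = (\<Sum>j\<in>{1..i}. \<Sum>m\<in>{j<..i}. e (m, j))"
    by (rule sum_tri_swap)
  also have "(\<Sum>j\<in>{1..i}. \<Sum>m\<in>{j<..n}. e (m, j)) - \<dots> = (\<Sum>j\<in>{1..i}. \<Sum>m\<in>{i<..n}. e (m, j))"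
  proof -
    have "(\<Sum>m\<in>{j<..n}. e (m, j)) = (\<Sum>m\<in>{j<..i}. e (m, j)) + (\<Sum>m\<in>{i<..n}. e (m, j))" if "j \<in> {1..i}" for j
    proof -
      have "{j<..n} = {j<..i} \<union> {i<..n}" using that assms(3) by auto
      then show ?thesis by (simp add: sum.union_disjoint)
    qed
    then have "(\<Sum>j\<in>{1..i}. \<Sum>m\<in>{j<..n}. e (m, j)) =
        (\<Sum>j\<in>{1..i}. (\<Sum>m\<in>{j<..i}. e (m, j)) + (\<Sum>m\<in>{i<..n}. e (m, j)))"
      by (intro sum.cong refl)
    then show ?thesis by (simp only: sum.distrib) simp
  qed
  finally show ?thesis .
qed

lemma Nats_sum_pair: "(\<And>j m. (j, m) \<in> S \<Longrightarrow> f j m \<in> \<nat>) \<Longrightarrow> (\<Sum>(j, m)\<in>S. f j m) \<in> (\<nat> :: complex set)"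
  by (rule Nats_sum) auto

text \<open>
  The exponent of \<open>x_{i+1,i}\<close> and those of the \<open>x_{m,j}\<close>, \<open>j \<le> i < m\<close>, add up to a constant, and
  all of them except the first are natural. So a single \<open>a\<close> bounds the exponents of the
  \<open>x_{i+1,i}\<close>, and once these are fixed the other exponents are bounded.
\<close>

lemma has_weight_A1:
  assumes "has_weight n l M z"
  shows "z \<in> A1 n"
proof -
  define a where "a i = (\<Sum>j\<in>{1..i}. l j - M j)" for i
  have supported: "supported n z" using assms by (simp add: has_weight_def)
  have nat: "e (i, j) \<in> \<nat>" if "z e \<noteq> 0" "1 \<le> j" "j + 2 \<le> i" "i \<le> n" for e i j
    using supportedD[OF supported that(1)] that by (auto simp: exponents_of_def)
  have split: "a i - e (Suc i, i) = (\<Sum>(j, m)\<in>({1..i} \<times> {i<..n}) - {(i, Suc i)}. e (m, j))"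
    if "z e \<noteq> 0" "i \<in> {1..<n}" for e i
  proof -
    have "a i = (\<Sum>(j, m)\<in>{1..i} \<times> {i<..n}. e (m, j))"
      unfolding a_def using weight_cut[OF assms that(1), of i] that(2) by (simp add: sum.cartesian_product)
    also have "\<dots> = e (Suc i, i) + (\<Sum>(j, m)\<in>({1..i} \<times> {i<..n}) - {(i, Suc i)}. e (m, j))"
      using that(2) by (subst sum.remove[of _ "(i, Suc i)"]) auto
    finally show ?thesis by simp
  qed
  have terms: "e (m, j) \<in> \<nat>" if "z e \<noteq> 0" "i \<in> {1..<n}" "(j, m) \<in> ({1..i} \<times> {i<..n}) - {(i, Suc i)}" for e i j m
    using that by (intro nat) auto
  have diag: "a i - e (Suc i, i) \<in> \<nat>" if "z e \<noteq> 0" "i \<in> {1..<n}" for e i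
    unfolding split[OF that] by (intro Nats_sum_pair terms[OF that])
  have fin: "finite {e. z e \<noteq> 0 \<and> (\<forall>i\<in>{1..<n}. e (i + 1, i) = b i)}" for b :: "nat \<Rightarrow> complex"
  proof -
    define B where "B = b ` {1..<n} \<union> (\<Union>j\<in>{1..<n}. of_nat ` {..nat \<lfloor>Re (a j - b j)\<rfloor>})"
    have "finite B" unfolding B_def by auto
    have "{e. z e \<noteq> 0 \<and> (\<forall>i\<in>{1..<n}. e (i + 1, i) = b i)} \<subseteq>
        {e. \<forall>q. (q \<in> tri n \<longrightarrow> e q \<in> B) \<and> (q \<notin> tri n \<longrightarrow> e q = 0)}"
    proof (intro subsetI CollectI allI)
      fix e :: exponents and q :: "nat \<times> nat"
      assume "e \<in> {e. z e \<noteq> 0 \<and> (\<forall>i\<in>{1..<n}. e (i + 1, i) = b i)}"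
      then have e: "z e \<noteq> 0" "\<And>i. i \<in> {1..<n} \<Longrightarrow> e (Suc i, i) = b i"
        unfolding Suc_eq_plus1 by blast+
      obtain i j where q: "q = (i, j)" by (cases q)
      have "e q \<in> B" if "q \<in> tri n"
      proof (cases "i = Suc j")
        case True
        then show ?thesis using that q e(2)[of j] by (auto simp: B_def tri_def)
      next
        case False
        have ij: "1 \<le> j" "j < i" "i \<le> n" using that q by (auto simp: tri_def)
        then have j: "j \<in> {1..<n}" by auto
        let ?S = "({1..j} \<times> {j<..n}) - {(j, Suc j)}"
        have mem: "(j, i) \<in> ?S" using ij False by auto
        have "a j - b j = e (i, j) + (\<Sum>(j, m)\<in>?S - {(j, i)}. e (m, j))"
          using split[OF e(1) j] e(2)[OF j] mem by (simp add: sum.remove[of ?S "(j, i)"])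
        moreover have "(\<Sum>(j, m)\<in>?S - {(j, i)}. e (m, j)) \<in> \<nat>"
          by (intro Nats_sum_pair terms[OF e(1) j]) blast
        then obtain r where "(\<Sum>(j, m)\<in>?S - {(j, i)}. e (m, j)) = of_nat r" by (auto elim: Nats_cases)
        moreover obtain s where s: "e (i, j) = of_nat s"
          using terms[OF e(1) j mem] by (auto elim: Nats_cases)
        ultimately have "a j - b j = of_nat (s + r)" by simp
        then have "nat \<lfloor>Re (a j - b j)\<rfloor> = s + r" by (simp flip: of_nat_add)
        then have "e (i, j) \<in> of_nat ` {..nat \<lfloor>Re (a j - b j)\<rfloor>}"
          using s by auto
        then show ?thesis using j q by (auto simp: B_def)
      qed
      moreover have "e q = 0" if "q \<notin> tri n"
        using supportedD[OF supported e(1)] that q by (auto simp: exponents_of_def tri_def)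
      ultimately show "(q \<in> tri n \<longrightarrow> e q \<in> B) \<and> (q \<notin> tri n \<longrightarrow> e q = 0)" by blast
    qed
    then show ?thesis
      using finite_set_of_finite_funs[OF finite_tri \<open>finite B\<close>, of n 0] by (rule finite_subset)
  qed
  show ?thesis
    unfolding A1_def
  proof (intro CollectI conjI allI exI)
    show "{e. z e \<noteq> 0} \<subseteq> exponents_of n" using supported by (simp add: supported_def)
    show "finite {a}" by simp
    show "z e \<noteq> 0 \<longrightarrow> (\<exists>a\<in>{a}. \<forall>i\<in>{1..<n}. a i - e (i + 1, i) \<in> \<nat>)" for e
      using diag unfolding Suc_eq_plus1 by blast
    show "finite {e. z e \<noteq> 0 \<and> (\<forall>i\<in>{1..<n}. e (i + 1, i) = b i)}" for b by (rule fin)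
  qed
qed

lemma A1_zero: "0 \<in> A1 n"
  by (auto simp: A1_def intro: exI[of _ "{}"])

lemma A1_fscale: "f \<in> A1 n \<Longrightarrow> fscale c f \<in> A1 n"
proof (cases "c = 0")
  case True
  then show ?thesis using A1_zero by (simp add: fscale_null)
next
  case False
  then have "fscale c f e \<noteq> 0 \<longleftrightarrow> f e \<noteq> 0" for e by (simp add: fscale_def)
  then show "f \<in> A1 n \<Longrightarrow> fscale c f \<in> A1 n" unfolding A1_def by simp
qed

lemma A1_add:
  assumes f: "f \<in> A1 n" and g: "g \<in> A1 n"
  shows "f + g \<in> A1 n"
proof -
  from f obtain A where A: "finite A" "\<And>e. f e \<noteq> 0 \<Longrightarrow> \<exists>a\<in>A. \<forall>i\<in>{1..<n}. a i - e (i + 1, i) \<in> \<nat>"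
    unfolding A1_def by blast
  from g obtain B where B: "finite B" "\<And>e. g e \<noteq> 0 \<Longrightarrow> \<exists>a\<in>B. \<forall>i\<in>{1..<n}. a i - e (i + 1, i) \<in> \<nat>"
    unfolding A1_def by blast
  have nz: "f e \<noteq> 0 \<or> g e \<noteq> 0" if "(f + g) e \<noteq> 0" for e using that by auto
  show ?thesis
    unfolding A1_def
  proof (intro CollectI conjI allI exI)
    show "{e. (f + g) e \<noteq> 0} \<subseteq> exponents_of n"
      using f g nz unfolding A1_def by blast
    show "finite (A \<union> B)" using A B by simp
    show "(f + g) e \<noteq> 0 \<longrightarrow> (\<exists>a\<in>A \<union> B. \<forall>i\<in>{1..<n}. a i - e (i + 1, i) \<in> \<nat>)" for e
      using A(2)[of e] B(2)[of e] nz[of e] by blast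
    show "finite {e. (f + g) e \<noteq> 0 \<and> (\<forall>i\<in>{1..<n}. e (i + 1, i) = b i)}" for b
    proof (rule finite_subset)
      show "{e. (f + g) e \<noteq> 0 \<and> (\<forall>i\<in>{1..<n}. e (i + 1, i) = b i)} \<subseteq>
        {e. f e \<noteq> 0 \<and> (\<forall>i\<in>{1..<n}. e (i + 1, i) = b i)} \<union> {e. g e \<noteq> 0 \<and> (\<forall>i\<in>{1..<n}. e (i + 1, i) = b i)}"
        using nz by blast
      show "finite ({e. f e \<noteq> 0 \<and> (\<forall>i\<in>{1..<n}. e (i + 1, i) = b i)} \<union> {e. g e \<noteq> 0 \<and> (\<forall>i\<in>{1..<n}. e (i + 1, i) = b i)})"
        using f g unfolding A1_def by blast
    qed
  qed
qed

lemma A1_supported: "f \<in> A1 n \<Longrightarrow> supported n f"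
  by (auto simp: A1_def supported_def)

lemma solutions_iff: "z \<in> solutions n lam \<longleftrightarrow> z \<in> A1 n \<and> singular n (gl_weight n lam) z"
  by (auto simp: solutions_def singular_def app_raising)

lemma subspace_solutions: "formal.subspace (solutions n lam)"
  unfolding formal.subspace_def
  by (auto simp: solutions_iff A1_zero A1_add A1_fscale singular_def app_plus_arg app_fscale fscale_zero)

section \<open>The orbit of the constant and the solution space\<close>

abbreviation adj_swap :: "nat \<Rightarrow> nat \<Rightarrow> nat" where
  "adj_swap i \<equiv> Transposition.transpose i (Suc i)"

text \<open>
  The weight that, shifted by \<open>\<rho>\<close>, is the permuted shifted weight \<open>l\<close>.
\<close>

definition linked_weight :: "nat \<Rightarrow> (nat \<Rightarrow> complex) \<Rightarrow> (nat \<Rightarrow> nat) \<Rightarrow> nat \<Rightarrow> complex" where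
  "linked_weight n l \<pi> i = rho_shift n l (\<pi> i) - of_nat (n - i)"

lemma has_weight_cong: "has_weight n l M f \<Longrightarrow> (\<And>i. i \<in> {1..n} \<Longrightarrow> M i = M' i) \<Longrightarrow> has_weight n l M' f"
  by (auto simp: has_weight_def)

lemma refl_linked_weight:
  assumes "1 \<le> i" "i < n"
  shows "refl_wt i (linked_weight n l \<pi>) k = linked_weight n l (\<pi> \<circ> adj_swap i) k"
proof -
  have "of_nat (n - i) = of_nat (n - Suc i) + (1 :: complex)"
    using assms by (metis Suc_diff_Suc of_nat_Suc add.commute)
  then show ?thesis
    by (auto simp: refl_wt_def linked_weight_def Transposition.transpose_def)
qed

text \<open>
  Normalising a pure coefficient shows that the series is nonzero and fixes it in its weight.
\<close>

definition orbit_sol :: "nat \<Rightarrow> (nat \<Rightarrow> complex) \<Rightarrow> (nat \<Rightarrow> nat) \<Rightarrow> series \<Rightarrow> bool" where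
  "orbit_sol n l \<pi> z \<longleftrightarrow> singular n l z \<and> has_weight n l (linked_weight n l \<pi>) z \<and> (\<exists>e. pure n e \<and> z e = 1)"

lemma orbit_sol_fone: "orbit_sol n l id fone"
proof -
  have "has_weight n l (linked_weight n l id) fone"
    by (rule has_weight_cong[OF has_weight_fone]) (simp add: linked_weight_def rho_shift_def)
  moreover have "pure n (\<lambda>_. 0)" "fone (\<lambda>_. 0) = 1"
    by (auto simp: pure_def fone_def fmonom_def)
  ultimately show ?thesis
    using singular_fone unfolding orbit_sol_def by blast
qed

lemma orbit_sol_eta:
  assumes "orbit_sol n l \<pi> z" "1 \<le> i" "i < n"
  shows "orbit_sol n l (\<pi> \<circ> adj_swap i) (eta i (linked_weight n l \<pi> i - linked_weight n l \<pi> (Suc i) + 1) z)"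
proof -
  have z: "singular n l z" "has_weight n l (linked_weight n l \<pi>) z" using assms(1) by (auto simp: orbit_sol_def)
  have supported: "supported n z" using z(2) by (simp add: has_weight_def)
  obtain e where e: "pure n e" "z e = 1" using assms(1) by (auto simp: orbit_sol_def)
  show ?thesis
    unfolding orbit_sol_def
  proof (intro conjI)
    show "singular n l (eta i (linked_weight n l \<pi> i - linked_weight n l \<pi> (Suc i) + 1) z)"
      by (rule singular_eta(1)[OF z assms(2,3)])
    show "has_weight n l (linked_weight n l (\<pi> \<circ> adj_swap i)) (eta i (linked_weight n l \<pi> i - linked_weight n l \<pi> (Suc i) + 1) z)"
      by (rule has_weight_cong[OF singular_eta(2)[OF z assms(2,3)]]) (rule refl_linked_weight[OF assms(2,3)])
    show "\<exists>e. pure n e \<and> eta i (linked_weight n l \<pi> i - linked_weight n l \<pi> (Suc i) + 1) z e = 1"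
      using eta_pure_coeff[OF supported assms(2,3) e(1)] pure_upd[OF e(1)] e(2) by metis
  qed
qed

text \<open>
  The inverse of \<open>word_perm w\<close>: permutations act on the positions of a weight, from the right.
\<close>

fun word_refl :: "nat list \<Rightarrow> nat \<Rightarrow> nat" where
  "word_refl [] = id"
| "word_refl (i # w) = word_refl w \<circ> adj_swap i"

lemma orbit_sol_word:
  assumes "set w \<subseteq> {1..<n}"
  shows "orbit_sol n (gl_weight n lam) (word_refl w) (foldr (sigma n lam) w fone)"
  using assms
proof (induction w)
  case Nil
  have "foldr (sigma n lam) [] fone = fone" by simp
  then show ?case by (simp only: word_refl.simps orbit_sol_fone)
next
  case (Cons i w)
  let ?p = "word_refl w" and ?z = "foldr (sigma n lam) w fone"
  have IH: "orbit_sol n (gl_weight n lam) ?p ?z" and i: "1 \<le> i" "i < n" using Cons by auto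
  have eq: "sigma n lam i ?z = eta i (linked_weight n (gl_weight n lam) ?p i - linked_weight n (gl_weight n lam) ?p (Suc i) + 1) ?z"
    using IH i by (intro sigma_has_weight) (auto simp: orbit_sol_def)
  have fold: "foldr (sigma n lam) (i # w) fone = sigma n lam i ?z" by simp
  show ?case
    unfolding fold eq word_refl.simps by (rule orbit_sol_eta[OF IH i])
qed

text \<open>
  Bubble sort. Undoing a descent \<open>\<pi> (i + 1) < \<pi> i\<close> increases \<open>\<Sum>i. i * \<pi> i\<close>, which is bounded,
  and a permutation without descents is the identity. Each step starts from an ascent; for a
  dominant weight this makes the exponent of the reflection a natural number.
\<close>

lemma permutation_ascent_induct:
  assumes "\<pi> permutes {1..n}" and base: "Q id"
    and step: "\<And>\<pi> i. \<pi> permutes {1..n} \<Longrightarrow> 1 \<le> i \<Longrightarrow> i < n \<Longrightarrow> \<pi> i < \<pi> (Suc i) \<Longrightarrow> Q \<pi> \<Longrightarrow>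
      Q (\<pi> \<circ> adj_swap i)"
  shows "Q \<pi>"
  using assms(1)
proof (induction "n * (n * n) - (\<Sum>i\<in>{1..n}. i * \<pi> i)" arbitrary: \<pi> rule: less_induct)
  case less
  show ?case
  proof (cases "\<pi> = id")
    case True
    then show ?thesis using base by simp
  next
    case False
    have "\<exists>i. 1 \<le> i \<and> i < n \<and> \<pi> (Suc i) < \<pi> i"
    proof (rule ccontr)
      assume "\<not> ?thesis"
      then have asc: "\<pi> i \<le> \<pi> (Suc i)" if "1 \<le> i" "i < n" for i
        using that by (meson not_le)
      have inj: "inj \<pi>" using less.prems by (rule permutes_inj)
      have "i \<le> \<pi> i" if "1 \<le> i" "i \<le> n" for i
        using that
      proof (induction i rule: nat_induct_at_least)
        case base
        have "\<pi> 1 \<in> {1..n}"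
          unfolding permutes_in_image[OF less.prems] using base by simp
        then show ?case by (rule atLeastAtMost_iff[THEN iffD1, THEN conjunct1])
      next
        case (Suc i)
        have "\<pi> i \<noteq> \<pi> (Suc i)"
          using injD[OF inj, of i "Suc i"] by (metis n_not_Suc_n)
        moreover have "\<pi> i \<le> \<pi> (Suc i)" "i \<le> \<pi> i"
          using Suc asc[of i] by linarith+
        ultimately show ?case by linarith
      qed
      then have "\<pi> = id"
        using permutes_natset_ge[OF less.prems] by auto
      then show False using False by simp
    qed
    then obtain i where i: "1 \<le> i" "i < n" "\<pi> (Suc i) < \<pi> i" by blast
    define \<rho> where "\<rho> = \<pi> \<circ> adj_swap i"
    have "adj_swap i permutes {1..n}"
      using i by (intro permutes_swap_id) auto
    then have \<rho>: "\<rho> permutes {1..n}"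
      unfolding \<rho>_def using less.prems by (intro permutes_compose)
    have \<pi>\<rho>: "\<pi> = \<rho> \<circ> adj_swap i"
      by (simp add: \<rho>_def comp_assoc)
    have val: "\<rho> i = \<pi> (Suc i)" "\<rho> (Suc i) = \<pi> i" by (simp_all add: \<rho>_def)
    have oth: "\<rho> k = \<pi> k" if "k \<noteq> i" "k \<noteq> Suc i" for k
      using that by (simp add: \<rho>_def Transposition.transpose_def)
    have sum: "(\<Sum>k\<in>{1..n}. k * \<sigma> k) = i * \<sigma> i + (Suc i * \<sigma> (Suc i) + (\<Sum>k\<in>{1..n} - {i} - {Suc i}. k * \<sigma> k))" for \<sigma> :: "nat \<Rightarrow> nat"
      using i by (simp add: sum.remove[of "{1..n}" i] sum.remove[of "{1..n} - {i}" "Suc i"])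
    have rest: "(\<Sum>k\<in>{1..n} - {i} - {Suc i}. k * \<rho> k) = (\<Sum>k\<in>{1..n} - {i} - {Suc i}. k * \<pi> k)"
      by (intro sum.cong) (auto simp: oth)
    have "(\<Sum>k\<in>{1..n}. k * \<pi> k) < (\<Sum>k\<in>{1..n}. k * \<rho> k)"
      unfolding sum[of \<pi>] sum[of \<rho>] rest val using i by simp
    moreover have "(\<Sum>k\<in>{1..n}. k * \<rho> k) \<le> n * (n * n)"
    proof -
      have "(\<Sum>k\<in>{1..n}. k * \<rho> k) \<le> (\<Sum>k\<in>{1..n}. n * n)"
        using permutes_in_image[OF \<rho>] by (intro sum_mono mult_mono) auto
      then show ?thesis by simp
    qed
    ultimately have "n * (n * n) - (\<Sum>k\<in>{1..n}. k * \<rho> k) < n * (n * n) - (\<Sum>k\<in>{1..n}. k * \<pi> k)"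
      by linarith
    then have Q: "Q \<rho>"
      using \<rho> by (rule less.hyps)
    show ?thesis
      unfolding \<pi>\<rho> by (rule step[OF \<rho> i(1,2) _ Q]) (simp only: val i(3))
  qed
qed

lemma permutation_word:
  assumes "\<pi> permutes {1..n}"
  shows "\<exists>w. set w \<subseteq> {1..<n} \<and> word_refl w = \<pi>"
  using assms
proof (rule permutation_ascent_induct)
  show "\<exists>w. set w \<subseteq> {1..<n} \<and> word_refl w = id"
    by (rule exI[of _ "[]"]) simp
next
  fix \<pi> i
  assume i: "1 \<le> i" "i < n" and "\<exists>w. set w \<subseteq> {1..<n} \<and> word_refl w = \<pi>"
  then obtain w where "set w \<subseteq> {1..<n}" "word_refl w = \<pi>" by blast
  then show "\<exists>w. set w \<subseteq> {1..<n} \<and> word_refl w = \<pi> \<circ> adj_swap i"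
    using i by (intro exI[of _ "i # w"]) auto
qed

lemma word_permutes: "set w \<subseteq> {1..<n} \<Longrightarrow> word_refl w permutes {1..n}"
proof (induction w)
  case (Cons i w)
  have "adj_swap i permutes {1..n}"
    using Cons.prems by (intro permutes_swap_id) auto
  moreover have "word_refl w permutes {1..n}" using Cons by simp
  ultimately show ?case
    unfolding word_refl.simps by (rule permutes_compose)
qed (simp add: permutes_id)

lemma word_perm_permutes: "set w \<subseteq> {1..<n} \<Longrightarrow> word_perm w permutes {1..n}"
proof (induction w)
  case (Cons i w)
  have "Transposition.transpose i (i + 1) permutes {1..n}"
    using Cons.prems by (intro permutes_swap_id) auto
  moreover have "word_perm w permutes {1..n}" using Cons by simp
  ultimately have "Transposition.transpose i (i + 1) \<circ> word_perm w permutes {1..n}"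
    by (intro permutes_compose)
  moreover have "word_perm (i # w) = Transposition.transpose i (i + 1) \<circ> word_perm w"
    by (simp add: word_perm_def)
  ultimately show ?case by (simp only:)
qed (simp add: word_perm_def permutes_id)

lemma orbit_one_iff: "z \<in> orbit_one n lam \<longleftrightarrow> (\<exists>w. set w \<subseteq> {1..<n} \<and> z = foldr (sigma n lam) w fone)"
  unfolding orbit_one_def perm_acts_def using word_perm_permutes by blast

lemma orbit_one_orbit_sol:
  assumes "z \<in> orbit_one n lam"
  obtains \<pi> where "\<pi> permutes {1..n}" "orbit_sol n (gl_weight n lam) \<pi> z"
  using assms orbit_sol_word word_permutes unfolding orbit_one_iff by blast

lemma orbit_sol_orbit_one:
  assumes "\<pi> permutes {1..n}"
  obtains z where "z \<in> orbit_one n lam" "orbit_sol n (gl_weight n lam) \<pi> z"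
proof -
  obtain w where w: "set w \<subseteq> {1..<n}" "word_refl w = \<pi>"
    using permutation_word[OF assms] by blast
  show ?thesis
    using that[of "foldr (sigma n lam) w fone"] w orbit_sol_word[OF w(1), of lam] by (auto simp: orbit_one_iff)
qed

lemma orbit_sol_solution: "orbit_sol n (gl_weight n lam) \<pi> z \<Longrightarrow> z \<in> solutions n lam"
  by (auto simp: orbit_sol_def solutions_iff intro: has_weight_A1)

lemma linked:
  assumes "singular n l z" "has_weight n l M z" "z \<noteq> 0"
  obtains \<pi> where "\<pi> permutes {1..n}" "\<And>i. i \<in> {1..n} \<Longrightarrow> M i = linked_weight n l \<pi> i"
proof -
  obtain \<pi> where \<pi>: "\<pi> permutes {1..n}" "\<And>i. i \<in> {1..n} \<Longrightarrow> rho_shift n M i = rho_shift n l (\<pi> i)"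
    using weight_linkage[OF assms] by blast
  have "M i = linked_weight n l \<pi> i" if "i \<in> {1..n}" for i
    using \<pi>(2)[OF that] by (simp add: linked_weight_def rho_shift_def[of n M] eq_diff_eq)
  then show ?thesis using that \<pi>(1) by blast
qed

text \<open>
  The weight of a nonzero singular series is linked to \<open>lam\<close>; the orbit of the constant contains
  a singular series of each linked weight, and it is unique up to scalars.
\<close>

lemma singular_has_weight_orbit:
  assumes "singular n (gl_weight n lam) z" "has_weight n (gl_weight n lam) M z"
  obtains c y where "y \<in> orbit_one n lam" "z = fscale c y"
proof (cases "z = 0")
  case True
  obtain y where "y \<in> orbit_one n lam"
    using orbit_sol_orbit_one[OF permutes_id] by blast
  then show ?thesis using that[of y 0] True by (simp add: fscale_null)
next
  case False
  obtain \<pi> where \<pi>: "\<pi> permutes {1..n}" "\<And>i. i \<in> {1..n} \<Longrightarrow> M i = linked_weight n (gl_weight n lam) \<pi> i"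
    using linked[OF assms False] by blast
  obtain y where y: "y \<in> orbit_one n lam" "orbit_sol n (gl_weight n lam) \<pi> y"
    by (rule orbit_sol_orbit_one[OF \<pi>(1)])
  obtain e where e: "pure n e" "y e = 1" using y(2) by (auto simp: orbit_sol_def)
  have "z = fscale (z e) y"
  proof (rule singular_unique[where e = e])
    show "has_weight n (gl_weight n lam) (linked_weight n (gl_weight n lam) \<pi>) z"
      by (rule has_weight_cong[OF assms(2) \<pi>(2)])
  qed (use assms(1) y(2) e in \<open>auto simp: orbit_sol_def\<close>)
  then show ?thesis using that y(1) by blast
qed

lemma weighted_has_weight:
  assumes "weighted n lam z" "supported n z"
  obtains M where "has_weight n (gl_weight n lam) M z"
proof (cases "z = 0")
  case True
  then show ?thesis using that[of "\<lambda>_. 0"] by (simp add: has_weight_def supported_zero)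
next
  case False
  then obtain e0 where e0: "z e0 \<noteq> 0" by (auto simp: fun_eq_iff)
  obtain mu where mu: "\<And>i. i \<in> {1..<n} \<Longrightarrow> zeta n lam i z = fscale (mu i) z"
    using assms(1) unfolding weighted_def by blast
  have d: "weight_of n (gl_weight n lam) e i - weight_of n (gl_weight n lam) e (Suc i) = mu i" if "z e \<noteq> 0" "i \<in> {1..<n}" for e i
  proof -
    have "zeta n lam i z e = fscale (mu i) z e" using mu[OF that(2)] by simp
    then show ?thesis using that by (simp add: zeta_apply fscale_def)
  qed
  have "has_weight n (gl_weight n lam) (weight_of n (gl_weight n lam) e0) z"
    unfolding has_weight_def using assms(2) d[OF e0] d by (auto intro!: weight_of_eqI)
  then show ?thesis by (rule that)
qed

lemma has_weight_weighted:
  assumes "has_weight n (gl_weight n lam) M z"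
  shows "weighted n lam z"
  unfolding weighted_def
proof (intro exI ballI)
  fix i assume i: "i \<in> {1..<n}"
  show "zeta n lam i z = fscale (M i - M (Suc i)) z"
  proof
    fix e
    show "zeta n lam i z e = fscale (M i - M (Suc i)) z e"
      using i assms by (cases "z e = 0") (auto simp: zeta_apply fscale_def has_weight_def)
  qed
qed

text \<open>
  The components of a solution in the various weights are again solutions, and only the finitely
  many linked weights can occur.
\<close>

lemma solutions_subset_span: "solutions n lam \<subseteq> formal.span (orbit_one n lam)"
proof
  let ?l = "gl_weight n lam"
  fix z assume z: "z \<in> solutions n lam"
  then have singular: "singular n ?l z" and supported: "supported n z"
    by (auto simp: solutions_iff A1_supported)
  define W where "W = (\<lambda>\<pi>. restrict (linked_weight n ?l \<pi>) {1..n}) ` {\<pi>. \<pi> permutes {1..n}}"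
  have fW: "finite W" unfolding W_def by (intro finite_imageI finite_permutations) simp
  have "z e = (\<Sum>M\<in>W. weight_part n ?l M z e)" for e
  proof (cases "z e = 0")
    case True
    then have "weight_part n ?l M z e = 0" for M by (simp add: weight_part_def)
    then show ?thesis using True by simp
  next
    case False
    define M where "M = restrict (weight_of n ?l e) {1..n}"
    have "weight_part n ?l M z e = z e" by (simp add: weight_part_def M_def)
    then have "weight_part n ?l M z \<noteq> 0" using False by (metis zero_fun_apply)
    then obtain \<pi> where \<pi>: "\<pi> permutes {1..n}" "\<And>i. i \<in> {1..n} \<Longrightarrow> M i = linked_weight n ?l \<pi> i"
      using linked[OF singular_weight_part[OF singular] has_weight_weight_part[OF supported]] by metis
    have "M = restrict (linked_weight n ?l \<pi>) {1..n}"
      using \<pi>(2) by (auto simp: M_def restrict_def fun_eq_iff)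
    then have "M \<in> W" using \<pi>(1) by (auto simp: W_def)
    have "weight_part n ?l M' z e = (if M' = M then z e else 0)" if "M' \<in> W" for M'
    proof -
      have "(\<forall>k\<in>{1..n}. weight_of n ?l e k = M' k) \<longleftrightarrow> M' = M"
        using that unfolding W_def M_def by (auto simp: restrict_def fun_eq_iff split: if_splits)
      then show ?thesis by (simp add: weight_part_def)
    qed
    then have "(\<Sum>M'\<in>W. weight_part n ?l M' z e) = (\<Sum>M'\<in>W. if M' = M then z e else 0)"
      by (intro sum.cong refl)
    then show ?thesis using fW \<open>M \<in> W\<close> by simp
  qed
  then have "z = (\<Sum>M\<in>W. weight_part n ?l M z)"
    by (simp add: fun_eq_iff sum_apply)
  also have "\<dots> \<in> formal.span (orbit_one n lam)"
  proof (rule formal.span_sum)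
    fix M
    obtain c y where "y \<in> orbit_one n lam" "weight_part n ?l M z = fscale c y"
      by (rule singular_has_weight_orbit[OF singular_weight_part[OF singular] has_weight_weight_part[OF supported]])
    then show "weight_part n ?l M z \<in> formal.span (orbit_one n lam)"
      by (auto intro: formal.span_scale formal.span_base)
  qed
  finally show "z \<in> formal.span (orbit_one n lam)" .
qed

lemma solutions_eq_span: "solutions n lam = formal.span (orbit_one n lam)"
proof
  have "orbit_one n lam \<subseteq> solutions n lam"
    by (auto elim!: orbit_one_orbit_sol intro: orbit_sol_solution)
  then show "formal.span (orbit_one n lam) \<subseteq> solutions n lam"
    by (intro formal.span_minimal subspace_solutions)
qed (rule solutions_subset_span)

lemma weighted_solutions_eq:
  "{z \<in> solutions n lam. weighted n lam z} = {fscale c z | c z. z \<in> orbit_one n lam}"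
proof (rule equalityI; rule subsetI)
  fix z assume "z \<in> {z \<in> solutions n lam. weighted n lam z}"
  then have z: "singular n (gl_weight n lam) z" "supported n z" "weighted n lam z"
    by (auto simp: solutions_iff A1_supported)
  obtain M where "has_weight n (gl_weight n lam) M z" by (rule weighted_has_weight[OF z(3,2)])
  from singular_has_weight_orbit[OF z(1) this] show "z \<in> {fscale c z | c z. z \<in> orbit_one n lam}"
    by blast
next
  fix z assume "z \<in> {fscale c z | c z. z \<in> orbit_one n lam}"
  then obtain c y where y: "z = fscale c y" "y \<in> orbit_one n lam" by blast
  obtain \<pi> where \<pi>: "orbit_sol n (gl_weight n lam) \<pi> y" by (rule orbit_one_orbit_sol[OF y(2)])
  have "y \<in> solutions n lam" using \<pi> by (rule orbit_sol_solution)
  then have "z \<in> solutions n lam"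
    unfolding y(1) by (rule formal.subspace_scale[OF subspace_solutions])
  moreover have "has_weight n (gl_weight n lam) (linked_weight n (gl_weight n lam) \<pi>) z"
    using \<pi> unfolding y(1) by (auto simp: orbit_sol_def has_weight_def supported_fscale) (auto simp: fscale_def)
  ultimately show "z \<in> {z \<in> solutions n lam. weighted n lam z}"
    by (auto intro: has_weight_weighted)
qed

section \<open>The action of sl(n)\<close>

definition mat_op :: "nat \<Rightarrow> (nat \<Rightarrow> complex) \<Rightarrow> complex mat \<Rightarrow> linop" where
  "mat_op n l A = (\<Sum>(i, j)\<in>{1..n} \<times> {1..n}. scop (A $$ (i - 1, j - 1)) * gl n l 1 i j)"

lemma scop_add: "scop (a + b) = scop a + scop b"
  by (rule linop_eqI) (simp add: fscale_def fun_eq_iff algebra_simps)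

lemma scop_diff: "scop (a - b) = scop a - scop b"
  by (rule linop_eqI) (simp add: fscale_def fun_eq_iff algebra_simps)

lemma scop_mult: "scop (a * b) = scop a * scop b"
  by (rule linop_eqI) (simp add: fscale_def fun_eq_iff algebra_simps)

lemma scop_zero: "scop 0 = 0"
  by (rule linop_eqI) (simp add: fscale_null)

lemma scop_one: "scop 1 = 1"
  by (rule linop_eqI) (simp add: fscale_def)

lemma scop_sum: "scop (sum f I) = (\<Sum>i\<in>I. scop (f i))"
  by (induction I rule: infinite_finite_induct) (simp_all add: scop_zero scop_add)

lemma scop_comm: "U * scop c = scop c * U"
  using comm_scop_right[of U c] by (simp add: comm_eq_zero_iff)

lemma mat_op_linear:
  assumes "A \<in> carrier_mat n n" "B \<in> carrier_mat n n"
  shows "mat_op n l (c \<cdot>\<^sub>m A + B) = scop c * mat_op n l A + mat_op n l B"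
  unfolding mat_op_def sum_distrib_left sum.distrib[symmetric]
  using assms by (intro sum.cong) (auto simp: scop_add scop_mult algebra_simps)

lemma mat_op_minus:
  assumes "A \<in> carrier_mat n n" "B \<in> carrier_mat n n"
  shows "mat_op n l (A - B) = mat_op n l A - mat_op n l B"
  unfolding mat_op_def sum_subtractf[symmetric]
  using assms by (intro sum.cong) (auto simp: scop_diff algebra_simps)

lemma mat_mult_entry:
  assumes "A \<in> carrier_mat n n" "B \<in> carrier_mat n n" "i \<in> {1..n}" "j \<in> {1..n}"
  shows "(A * B) $$ (i - 1, j - 1) = (\<Sum>k\<in>{1..n}. A $$ (i - 1, k - 1) * B $$ (k - 1, j - 1))"
proof -
  have "(A * B) $$ (i - 1, j - 1) = (\<Sum>k\<in>{0..<n}. A $$ (i - 1, k) * B $$ (k, j - 1))"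
    using assms by (auto simp: scalar_prod_def intro!: sum.cong)
  also have "\<dots> = (\<Sum>k\<in>{1..n}. A $$ (i - 1, k - 1) * B $$ (k - 1, j - 1))"
    by (rule sum.reindex_bij_witness[of _ "\<lambda>k. k - 1" Suc]) auto
  finally show ?thesis .
qed

lemma mat_op_mult:
  assumes "A \<in> carrier_mat n n" "B \<in> carrier_mat n n"
  shows "mat_op n l (A * B) = (\<Sum>i\<in>{1..n}. \<Sum>b\<in>{1..n}. \<Sum>j\<in>{1..n}.
    scop (A $$ (i - 1, j - 1) * B $$ (j - 1, b - 1)) * gl n l 1 i b)"
  unfolding mat_op_def sum.cartesian_product[symmetric]
  by (intro sum.cong refl) (simp only: mat_mult_entry[OF assms] scop_sum sum_distrib_right)

text \<open>
  Expanding both factors in matrix units reduces this to the relations of gl(n); the two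
  families of Kronecker deltas then produce the two matrix products.
\<close>

lemma mat_op_bracket:
  assumes "A \<in> carrier_mat n n" "B \<in> carrier_mat n n"
  shows "mat_op n l (A * B - B * A) = comm (mat_op n l A) (mat_op n l B)"
proof -
  let ?g = "gl n l 1" and ?a = "\<lambda>i j. A $$ (i - 1, j - 1)" and ?b = "\<lambda>i j. B $$ (i - 1, j - 1)"
  let ?I = "{1..n}"
  have br: "comm (scop x * U) (scop y * V) = scop (x * y) * comm U V" for x y U V
  proof -
    have "comm (scop x * U) (scop y * V) = scop y * (scop x * comm U V)"
      by (simp add: comm_mult_left comm_mult_right comm_scop comm_scop_right)
    also have "\<dots> = scop (x * y) * comm U V"
      by (metis scop_mult mult.assoc mult.commute)
    finally show ?thesis .
  qed
  have "comm (mat_op n l A) (mat_op n l B) =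
      (\<Sum>i\<in>?I. \<Sum>j\<in>?I. \<Sum>c\<in>?I. \<Sum>e\<in>?I. scop (?a i j * ?b c e) * comm (?g i j) (?g c e))"
    unfolding mat_op_def[of n l A] sum.cartesian_product[symmetric] comm_sum_left
    unfolding mat_op_def[of n l B] sum.cartesian_product[symmetric] comm_sum_right br ..
  also have "\<dots> = (\<Sum>i\<in>?I. \<Sum>j\<in>?I. \<Sum>c\<in>?I. \<Sum>e\<in>?I.
      (if j = c then scop (?a i j * ?b c e) * ?g i e else 0) - (if i = e then scop (?a i j * ?b c e) * ?g c j else 0))"
  proof (intro sum.cong refl)
    fix i j c e assume "i \<in> ?I" "j \<in> ?I" "c \<in> ?I" "e \<in> ?I"
    then have "comm (?g i j) (?g c e) = (if j = c then ?g i e else 0) - (if e = i then ?g c j else 0)"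
      by (intro comm_gl) auto
    then show "scop (?a i j * ?b c e) * comm (?g i j) (?g c e) =
      (if j = c then scop (?a i j * ?b c e) * ?g i e else 0) - (if i = e then scop (?a i j * ?b c e) * ?g c j else 0)"
      by (simp add: right_diff_distrib)
  qed
  also have "\<dots> = (\<Sum>i\<in>?I. \<Sum>j\<in>?I. \<Sum>c\<in>?I. \<Sum>e\<in>?I. if j = c then scop (?a i j * ?b c e) * ?g i e else 0)
      - (\<Sum>i\<in>?I. \<Sum>j\<in>?I. \<Sum>c\<in>?I. \<Sum>e\<in>?I. if i = e then scop (?a i j * ?b c e) * ?g c j else 0)"
    by (simp only: sum_subtractf)
  also have "(\<Sum>i\<in>?I. \<Sum>j\<in>?I. \<Sum>c\<in>?I. \<Sum>e\<in>?I. if j = c then scop (?a i j * ?b c e) * ?g i e else 0)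
      = (\<Sum>i\<in>?I. \<Sum>j\<in>?I. \<Sum>e\<in>?I. scop (?a i j * ?b j e) * ?g i e)"
  proof (rule sum.cong[OF refl], rule sum.cong[OF refl])
    fix i j assume j: "j \<in> ?I"
    have "(\<Sum>c\<in>?I. \<Sum>e\<in>?I. if j = c then scop (?a i j * ?b c e) * ?g i e else 0) =
        (\<Sum>e\<in>?I. \<Sum>c\<in>?I. if j = c then scop (?a i j * ?b c e) * ?g i e else 0)"
      by (rule sum.swap)
    then show "(\<Sum>c\<in>?I. \<Sum>e\<in>?I. if j = c then scop (?a i j * ?b c e) * ?g i e else 0) =
        (\<Sum>e\<in>?I. scop (?a i j * ?b j e) * ?g i e)"
      using j by simp
  qed
  also have "\<dots> = mat_op n l (A * B)"
    unfolding mat_op_mult[OF assms] by (rule sum.cong[OF refl], rule sum.swap)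
  also have "(\<Sum>i\<in>?I. \<Sum>j\<in>?I. \<Sum>c\<in>?I. \<Sum>e\<in>?I. if i = e then scop (?a i j * ?b c e) * ?g c j else 0)
      = (\<Sum>i\<in>?I. \<Sum>j\<in>?I. \<Sum>c\<in>?I. scop (?b c i * ?a i j) * ?g c j)"
    by (intro sum.cong refl) (simp add: mult.commute)
  also have "\<dots> = (\<Sum>i\<in>?I. \<Sum>c\<in>?I. \<Sum>j\<in>?I. scop (?b c i * ?a i j) * ?g c j)"
    by (rule sum.cong[OF refl], rule sum.swap)
  also have "\<dots> = (\<Sum>c\<in>?I. \<Sum>i\<in>?I. \<Sum>j\<in>?I. scop (?b c i * ?a i j) * ?g c j)"
    by (rule sum.swap)
  also have "\<dots> = mat_op n l (B * A)"
    unfolding mat_op_mult[OF assms(2,1)] by (rule sum.cong[OF refl], rule sum.swap)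
  finally have "comm (mat_op n l A) (mat_op n l B) = mat_op n l (A * B) - mat_op n l (B * A)" .
  then show ?thesis
    using assms by (simp add: mat_op_minus)
qed

lemma E_carrier: "E n i j \<in> carrier_mat n n"
  by (simp add: E_def)

lemma h_carrier: "h n i \<in> carrier_mat n n"
  unfolding h_def by (intro minus_carrier_mat E_carrier)

lemma mat_op_E:
  assumes "i \<in> {1..n}" "j \<in> {1..n}"
  shows "mat_op n l (E n i j) = gl n l 1 i j"
proof -
  have "mat_op n l (E n i j) = (\<Sum>q\<in>{1..n} \<times> {1..n}. if q = (i, j) then gl n l 1 i j else 0)"
    unfolding mat_op_def by (intro sum.cong refl) (auto simp: E_def scop_zero scop_one split: if_splits)
  then show ?thesis using assms by simp
qed

lemma mat_op_h: "1 \<le> i \<Longrightarrow> i < n \<Longrightarrow> mat_op n l (h n i) = coroot_op n l i"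
  unfolding h_def by (subst mat_op_minus) (auto simp: E_carrier mat_op_E coroot_op_def simp flip: Suc_eq_plus1)

lemma preserves_mat_op: "preserves n (mat_op n l A)"
  unfolding mat_op_def by (intro preserves_sum) (auto intro!: preserves_mult preserves_scop preserves_gl)

section \<open>The free algebra acting on the constant\<close>

definition word_op :: "nat \<Rightarrow> (nat \<Rightarrow> complex) \<Rightarrow> complex mat list \<Rightarrow> linop" where
  "word_op n l w = prod_list (map (mat_op n l) w)"

definition free_op :: "nat \<Rightarrow> (nat \<Rightarrow> complex) \<Rightarrow> free_alg \<Rightarrow> linop" where
  "free_op n l u = (\<Sum>w\<in>Poly_Mapping.keys u. scop (Poly_Mapping.lookup u w) * word_op n l w)"

lemma free_op_superset:
  assumes "finite S" "Poly_Mapping.keys u \<subseteq> S"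
  shows "free_op n l u = (\<Sum>w\<in>S. scop (Poly_Mapping.lookup u w) * word_op n l w)"
  unfolding free_op_def using assms
  by (intro sum.mono_neutral_left) (auto simp: in_keys_iff scop_zero)

lemma free_op_add: "free_op n l (u + v) = free_op n l u + free_op n l v"
proof -
  let ?S = "Poly_Mapping.keys u \<union> Poly_Mapping.keys v"
  have "free_op n l (u + v) = (\<Sum>w\<in>?S. scop (Poly_Mapping.lookup (u + v) w) * word_op n l w)"
    using keys_add[of u v] by (intro free_op_superset) auto
  also have "\<dots> = free_op n l u + free_op n l v"
    by (simp add: free_op_superset[of ?S] lookup_add scop_add distrib_right sum.distrib)
  finally show ?thesis .
qed

lemma free_op_zero: "free_op n l 0 = 0"
  by (simp add: free_op_def)

lemma free_op_diff: "free_op n l (u - v) = free_op n l u - free_op n l v"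
  using free_op_add[of n l "u - v" v] by simp

lemma free_op_sum: "free_op n l (sum f I) = (\<Sum>i\<in>I. free_op n l (f i))"
  by (induction I rule: infinite_finite_induct) (simp_all add: free_op_zero free_op_add)

lemma free_op_single: "free_op n l (Poly_Mapping.single w c) = scop c * word_op n l w"
  using free_op_superset[of "{w}" "Poly_Mapping.single w c" n l] by (simp split: if_splits)

lemma sum_single: "(\<Sum>w\<in>Poly_Mapping.keys u. Poly_Mapping.single w (Poly_Mapping.lookup u w)) = u"
  by (rule poly_mapping_eqI) (simp add: lookup_sum lookup_single in_keys_iff when_def)

lemma word_op_append: "word_op n l (v + w) = word_op n l v * word_op n l w"
  by (simp add: word_op_def plus_list_def)

lemma free_op_mult: "free_op n l (u * v) = free_op n l u * free_op n l v"
proof -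
  have "u * v = (\<Sum>w\<in>Poly_Mapping.keys u. \<Sum>w'\<in>Poly_Mapping.keys v.
      Poly_Mapping.single (w + w') (Poly_Mapping.lookup u w * Poly_Mapping.lookup v w'))"
    by (subst (1) sum_single[of u, symmetric], subst (1) sum_single[of v, symmetric])
       (simp add: sum_product mult_single)
  then have "free_op n l (u * v) = (\<Sum>w\<in>Poly_Mapping.keys u. \<Sum>w'\<in>Poly_Mapping.keys v.
      scop (Poly_Mapping.lookup u w * Poly_Mapping.lookup v w') * (word_op n l w * word_op n l w'))"
    by (simp add: free_op_sum free_op_single word_op_append)
  also have "\<dots> = free_op n l u * free_op n l v"
    unfolding free_op_def sum_product
  proof (intro sum.cong refl)
    fix w w'
    let ?a = "Poly_Mapping.lookup u w" and ?b = "Poly_Mapping.lookup v w'"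
    have "scop (?a * ?b) * (word_op n l w * word_op n l w') = scop ?a * (scop ?b * word_op n l w) * word_op n l w'"
      by (simp add: scop_mult mult.assoc)
    also have "\<dots> = scop ?a * (word_op n l w * scop ?b) * word_op n l w'"
      by (simp only: scop_comm)
    finally show "scop (?a * ?b) * (word_op n l w * word_op n l w') = scop ?a * word_op n l w * (scop ?b * word_op n l w')"
      by (simp add: mult.assoc)
  qed
  finally show ?thesis .
qed

lemma free_op_gen: "free_op n l (gen A) = mat_op n l A"
  by (simp add: gen_def free_op_single word_op_def scop_one)

lemma free_op_scal: "free_op n l (scal c) = scop c"
  by (simp add: scal_def free_op_single word_op_def)

lemma scal_one: "scal 1 = 1"
  unfolding scal_def zero_list_def[symmetric] by simp

lemma free_op_one: "free_op n l 1 = 1"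
  unfolding scal_one[symmetric] free_op_scal by (rule scop_one)

lemma free_op_power: "free_op n l (u ^ k) = free_op n l u ^ k"
  by (induction k) (simp_all add: free_op_one free_op_mult)

lemma sl_carrier: "A \<in> sl n \<Longrightarrow> A \<in> carrier_mat n n"
  by (simp add: sl_def)

lemma free_op_U_ideal: "u \<in> U_ideal n \<Longrightarrow> free_op n l u = 0"
proof (induction rule: U_ideal.induct)
  case (linear A B c)
  then show ?case
    by (simp add: free_op_diff free_op_add free_op_mult free_op_gen free_op_scal mat_op_linear sl_carrier)
next
  case (bracket A B)
  then show ?case
    by (simp add: free_op_diff free_op_mult free_op_gen mat_op_bracket sl_carrier comm_def)
qed (simp_all add: free_op_add free_op_mult)

text \<open>
  The element \<open>u v_\<lambda>\<close> of the Verma module, written as a polynomial.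
\<close>

definition Phi :: "nat \<Rightarrow> (nat \<Rightarrow> complex) \<Rightarrow> free_alg \<Rightarrow> series" where
  "Phi n l u = app (free_op n l u) fone"

lemma Phi_add: "Phi n l (u + v) = Phi n l u + Phi n l v"
  and Phi_diff: "Phi n l (u - v) = Phi n l u - Phi n l v"
  and Phi_mult: "Phi n l (u * v) = app (free_op n l u) (Phi n l v)"
  and Phi_zero: "Phi n l 0 = 0"
  and Phi_sum: "Phi n l (sum f I) = (\<Sum>i\<in>I. Phi n l (f i))"
  by (simp_all add: Phi_def free_op_add free_op_diff free_op_mult free_op_zero free_op_sum)

lemma Phi_scal: "Phi n l (scal c * u) = fscale c (Phi n l u)"
  by (simp add: Phi_mult free_op_scal)

lemma supported_Phi: "supported n (Phi n l u)"
proof -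
  have "preserves n (word_op n l w)" for w
  proof (induction w)
    case Nil
    then show ?case by (simp add: word_op_def preserves_def)
  next
    case (Cons A w)
    then show ?case by (simp add: word_op_def preserves_mult preserves_mat_op)
  qed
  then have "preserves n (free_op n l u)"
    unfolding free_op_def by (intro preserves_sum preserves_mult preserves_scop)
  then show ?thesis
    using supported_fone by (simp add: Phi_def preserves_def)
qed

lemma Phi_verma_ideal:
  assumes "u \<in> verma_ideal n lam"
  shows "Phi n (gl_weight n lam) u = 0"
  using assms
proof (induction rule: verma_ideal.induct)
  case (U u)
  then show ?case by (simp add: Phi_def free_op_U_ideal)
next
  case (pos i j)
  then show ?case
    using singular_all[OF singular_fone, of i j n "gl_weight n lam"] by (simp add: Phi_def free_op_gen mat_op_E)
next
  case (cartan i)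
  have "app (coroot_op n (gl_weight n lam) i) fone = fscale (lam i) fone"
    using cartan app_gl_diagonal_has_weight[OF has_weight_fone, of i n "gl_weight n lam"] app_gl_diagonal_has_weight[OF has_weight_fone, of "Suc i" n "gl_weight n lam"]
      gl_weight_diff[of i n lam]
    by (simp add: coroot_op_def fscale_def fun_eq_iff flip: left_diff_distrib)
  then show ?case
    using cartan by (simp add: Phi_def free_op_diff free_op_gen free_op_scal mat_op_h)
next
  case (add u v)
  then show ?case by (simp add: Phi_add)
next
  case (mult u a)
  then show ?case by (simp only: Phi_mult app_zero_arg)
qed

section \<open>Membership in the tensor algebra\<close>

lemma T_add: "u \<in> T n \<Longrightarrow> v \<in> T n \<Longrightarrow> u + v \<in> T n"
  unfolding T_def using keys_add[of u v] by blast

lemma T_diff: "u \<in> T n \<Longrightarrow> v \<in> T n \<Longrightarrow> u - v \<in> T n"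
  unfolding T_def using keys_diff[of u v] by blast

lemma T_mult: "u \<in> T n \<Longrightarrow> v \<in> T n \<Longrightarrow> u * v \<in> T n"
  unfolding T_def using keys_mult[of u v] by (fastforce simp: plus_list_def)

lemma T_single: "w \<in> lists (sl n) \<Longrightarrow> Poly_Mapping.single w c \<in> T n"
  by (simp add: T_def)

lemma T_gen: "A \<in> sl n \<Longrightarrow> gen A \<in> T n"
  unfolding gen_def by (rule T_single) simp

lemma T_scal: "scal c \<in> T n"
  unfolding scal_def by (rule T_single) simp

lemma T_zero: "0 \<in> T n"
  by (simp add: T_def)

lemma T_power: "u \<in> T n \<Longrightarrow> u ^ k \<in> T n"
proof (induction k)
  case 0
  then show ?case using T_scal[of 1 n] by (simp add: scal_one)
qed (simp add: T_mult)

lemma scal_uminus_one: "scal (- 1) * u = - u"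
proof -
  have "scal (- 1) = - 1"
    unfolding scal_one[symmetric] by (simp add: scal_def single_uminus)
  then show ?thesis by simp
qed

lemma zero_sl: "0\<^sub>m n n \<in> sl n"
  by (simp add: sl_def)

lemma E_sl: "i \<noteq> j \<Longrightarrow> E n i j \<in> sl n"
  by (auto simp: sl_def E_def intro!: sum.neutral)

lemma h_sl: "1 \<le> i \<Longrightarrow> i < n \<Longrightarrow> h n i \<in> sl n"
proof -
  assume i: "1 \<le> i" "i < n"
  have "(\<Sum>k<n. h n i $$ (k, k)) = (\<Sum>k<n. (if k = i - 1 then 1 else 0) - (if k = i then 1 else 0))"
    using i by (intro sum.cong refl) (auto simp: h_def E_def)
  then show ?thesis using i by (simp add: sl_def h_carrier sum_subtractf)
qed

lemma linear_sl: "A \<in> sl n \<Longrightarrow> B \<in> sl n \<Longrightarrow> c \<cdot>\<^sub>m A + B \<in> sl n"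
  by (auto simp: sl_def sum.distrib simp flip: sum_distrib_left)

lemma bracket_sl:
  assumes "A \<in> sl n" "B \<in> sl n"
  shows "A * B - B * A \<in> sl n"
proof -
  have c: "A \<in> carrier_mat n n" "B \<in> carrier_mat n n" using assms by (auto simp: sl_def)
  have "(\<Sum>k<n. (A * B) $$ (k, k)) = (\<Sum>k<n. \<Sum>m<n. A $$ (k, m) * B $$ (m, k))"
    using c by (intro sum.cong refl) (auto simp: scalar_prod_def lessThan_atLeast0 intro!: sum.cong)
  also have "\<dots> = (\<Sum>m<n. \<Sum>k<n. A $$ (k, m) * B $$ (m, k))"
    by (rule sum.swap)
  also have "\<dots> = (\<Sum>k<n. (B * A) $$ (k, k))"
    using c by (intro sum.cong refl) (auto simp: scalar_prod_def lessThan_atLeast0 mult.commute intro!: sum.cong)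
  finally have "(\<Sum>k<n. (A * B) $$ (k, k)) = (\<Sum>k<n. (B * A) $$ (k, k))" .
  moreover have "(\<Sum>k<n. (A * B - B * A) $$ (k, k)) = (\<Sum>k<n. (A * B) $$ (k, k) - (B * A) $$ (k, k))"
    using c by (intro sum.cong refl) auto
  moreover have "A * B - B * A \<in> carrier_mat n n"
    by (intro minus_carrier_mat mult_carrier_mat[OF c(2,1)])
  ultimately show ?thesis
    by (simp only: sl_def mem_Collect_eq sum_subtractf) simp
qed

lemma verma_ideal_zero: "0 \<in> verma_ideal n lam"
  using verma_ideal.mult[OF verma_ideal.U[OF U_ideal.linear[OF zero_sl zero_sl]] T_zero] by simp

lemma verma_ideal_uminus: "u \<in> verma_ideal n lam \<Longrightarrow> - u \<in> verma_ideal n lam"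
  using verma_ideal.mult[OF _ T_scal, of u n lam "- 1"] by (simp add: scal_uminus_one)

section \<open>Spanning by ordered words\<close>

text \<open>
  One list for every multiset of positions, sorted by rows, so that the words built from these
  lists give each ordered monomial exactly once.
\<close>

definition canon_list :: "(nat \<times> nat) multiset \<Rightarrow> (nat \<times> nat) list" where
  "canon_list M = (SOME ps. mset ps = M \<and> sorted (map fst ps))"

lemma canon_list: "mset (canon_list M) = M" "sorted (map fst (canon_list M))"
proof -
  obtain ps where "mset ps = M" using ex_mset by blast
  then have "\<exists>ps. mset ps = M \<and> sorted (map fst ps)"
    by (intro exI[of _ "sort_key fst ps"]) simp
  then have "mset (canon_list M) = M \<and> sorted (map fst (canon_list M))"
    unfolding canon_list_def by (rule someI_ex)
  then show "mset (canon_list M) = M" "sorted (map fst (canon_list M))" by auto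
qed

definition root_word :: "nat \<Rightarrow> (nat \<times> nat) list \<Rightarrow> complex mat list" where
  "root_word n ps = map (\<lambda>(i, j). E n i j) ps"

lemma Phi_root_word:
  assumes "set ps \<subseteq> tri n"
  shows "Phi n l (Poly_Mapping.single (root_word n ps) c) = fscale c (lower_word n l ps fone)"
proof -
  have "app (word_op n l (root_word n ps)) fone = lower_word n l ps fone"
    using assms
  proof (induction ps)
    case Nil
    then show ?case by (simp add: word_op_def root_word_def)
  next
    case (Cons q ps)
    then show ?case
      by (cases q) (auto simp: word_op_def root_word_def mat_op_E tri_def)
  qed
  then show ?thesis by (simp add: Phi_def free_op_single)
qed

definition pbw_normal :: "nat \<Rightarrow> free_alg set" where
  "pbw_normal n = {v. \<forall>w\<in>Poly_Mapping.keys v. \<exists>M. set_mset M \<subseteq> tri n \<and> w = root_word n (canon_list M)}"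

text \<open>
  Canonical words act on the constant as pairwise distinct monomials, so a combination of them
  that acts as zero is zero.
\<close>

lemma Phi_pbw_normal:
  assumes v: "v \<in> pbw_normal n" and zero: "Phi n l v = 0"
  shows "v = 0"
proof (rule ccontr)
  assume "v \<noteq> 0"
  then obtain w0 where w0: "w0 \<in> Poly_Mapping.keys v" by (metis keys_eq_empty ex_in_conv)
  obtain M where M: "\<And>w. w \<in> Poly_Mapping.keys v \<Longrightarrow> set_mset (M w) \<subseteq> tri n \<and> w = root_word n (canon_list (M w))"
    using v unfolding pbw_normal_def by (simp only: mem_Collect_eq) metis
  define e :: "complex mat list \<Rightarrow> exponents" where "e w = (\<lambda>q. of_nat (count (M w) q))" for w
  have single: "Phi n l (Poly_Mapping.single w c) = fscale c (fmonom (e w))" if "w \<in> Poly_Mapping.keys v" for w c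
  proof -
    have "set (canon_list (M w)) \<subseteq> tri n"
      using M[OF that] canon_list(1)[of "M w"] by (metis set_mset_mset)
    then have "Phi n l (Poly_Mapping.single (root_word n (canon_list (M w))) c) = fscale c (fmonom (e w))"
      using Phi_root_word[of "canon_list (M w)" n l c] lower_word_fone[OF canon_list(2), of "M w" n l] unfolding canon_list(1) e_def by simp
    then show ?thesis using M[OF that] by simp
  qed
  have inj: "w = w0" if "w \<in> Poly_Mapping.keys v" "e w0 = e w" for w
  proof -
    have "M w0 = M w"
      using that(2) unfolding e_def by (intro multiset_eqI) (metis of_nat_eq_iff)
    then show ?thesis using M[OF that(1)] M[OF w0] by metis
  qed
  have "Phi n l v = (\<Sum>w\<in>Poly_Mapping.keys v. fscale (Poly_Mapping.lookup v w) (fmonom (e w)))"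
    by (subst sum_single[of v, symmetric]) (simp only: Phi_sum single cong: sum.cong)
  then have "Phi n l v (e w0) = (\<Sum>w\<in>Poly_Mapping.keys v. fscale (Poly_Mapping.lookup v w) (fmonom (e w)) (e w0))"
    by (simp add: sum_apply)
  also have "\<dots> = (\<Sum>w\<in>Poly_Mapping.keys v. if w = w0 then Poly_Mapping.lookup v w else 0)"
    by (intro sum.cong refl) (auto simp: fscale_def fmonom_def dest: inj)
  also have "\<dots> = Poly_Mapping.lookup v w0"
    using w0 by simp
  finally show False
    using w0 zero by (simp add: in_keys_iff)
qed

definition pbw_spanned :: "nat \<Rightarrow> (nat \<Rightarrow> complex) \<Rightarrow> free_alg set" where
  "pbw_spanned n lam = {u \<in> T n. \<exists>v\<in>pbw_normal n. u - v \<in> verma_ideal n lam}"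

lemma pbw_normal_add: "u \<in> pbw_normal n \<Longrightarrow> v \<in> pbw_normal n \<Longrightarrow> u + v \<in> pbw_normal n"
  unfolding pbw_normal_def using keys_add[of u v] by blast

lemma keys_scal_mult: "Poly_Mapping.keys (scal c * u) \<subseteq> Poly_Mapping.keys u"
  using keys_mult[of "scal c" u] by (auto simp: scal_def plus_list_def split: if_splits)

lemma pbw_normal_scal: "u \<in> pbw_normal n \<Longrightarrow> scal c * u \<in> pbw_normal n"
  unfolding pbw_normal_def using keys_scal_mult[of c u] by blast

lemma pbw_spanned_add: "u \<in> pbw_spanned n lam \<Longrightarrow> v \<in> pbw_spanned n lam \<Longrightarrow> u + v \<in> pbw_spanned n lam"
proof -
  assume "u \<in> pbw_spanned n lam" "v \<in> pbw_spanned n lam"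
  then obtain u' v' where *: "u \<in> T n" "v \<in> T n" "u' \<in> pbw_normal n" "v' \<in> pbw_normal n"
    "u - u' \<in> verma_ideal n lam" "v - v' \<in> verma_ideal n lam" by (auto simp: pbw_spanned_def)
  have "(u + v) - (u' + v') = (u - u') + (v - v')" by simp
  moreover have "(u - u') + (v - v') \<in> verma_ideal n lam"
    using * by (intro verma_ideal.add)
  ultimately have "(u + v) - (u' + v') \<in> verma_ideal n lam" by (simp only:)
  then show ?thesis
    unfolding pbw_spanned_def using * by (blast intro: T_add pbw_normal_add)
qed

lemma pbw_spanned_scal: "u \<in> pbw_spanned n lam \<Longrightarrow> scal c * u \<in> pbw_spanned n lam"
proof -
  assume "u \<in> pbw_spanned n lam"
  then obtain u' where *: "u \<in> T n" "u' \<in> pbw_normal n" "u - u' \<in> verma_ideal n lam" by (auto simp: pbw_spanned_def)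
  have "scal c * u - scal c * u' = scal c * (u - u')" by (simp add: right_diff_distrib)
  then show ?thesis
    unfolding pbw_spanned_def using * by (auto intro!: T_mult T_scal pbw_normal_scal verma_ideal.mult bexI[of _ "scal c * u'"])
qed

lemma pbw_spanned_ideal: "u \<in> verma_ideal n lam \<Longrightarrow> u \<in> T n \<Longrightarrow> u \<in> pbw_spanned n lam"
proof -
  assume "u \<in> verma_ideal n lam" "u \<in> T n"
  moreover have "0 \<in> pbw_normal n" by (simp add: pbw_normal_def)
  ultimately show ?thesis
    unfolding pbw_spanned_def by (auto intro!: bexI[of _ 0])
qed

lemma pbw_spanned_cong: "u - v \<in> pbw_spanned n lam \<Longrightarrow> v \<in> pbw_spanned n lam \<Longrightarrow> u \<in> pbw_spanned n lam"
  using pbw_spanned_add[of "u - v" n lam v] by simp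

lemma pbw_spanned_keys:
  assumes "\<And>w. w \<in> Poly_Mapping.keys u \<Longrightarrow> Poly_Mapping.single w 1 \<in> pbw_spanned n lam"
  shows "u \<in> pbw_spanned n lam"
proof -
  have *: "Poly_Mapping.single w (Poly_Mapping.lookup u w) \<in> pbw_spanned n lam" if "w \<in> Poly_Mapping.keys u" for w
  proof -
    have "Poly_Mapping.single w (Poly_Mapping.lookup u w) = scal (Poly_Mapping.lookup u w) * Poly_Mapping.single w 1"
      by (simp add: scal_def mult_single plus_list_def)
    then show ?thesis using pbw_spanned_scal[OF assms[OF that]] by simp
  qed
  have "(\<Sum>w\<in>S. Poly_Mapping.single w (Poly_Mapping.lookup u w)) \<in> pbw_spanned n lam" if "S \<subseteq> Poly_Mapping.keys u" for S
    using finite_subset[OF that finite_keys] that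
  proof (induction S rule: finite_induct)
    case empty
    then show ?case using pbw_spanned_ideal[OF verma_ideal_zero T_zero] by simp
  next
    case (insert x F)
    then show ?case using * by (auto intro: pbw_spanned_add)
  qed
  from this[OF subset_refl] show ?thesis by (simp add: sum_single)
qed

lemma single_split: "Poly_Mapping.single (xs @ ys) (1::complex) = Poly_Mapping.single xs 1 * Poly_Mapping.single ys 1"
  by (simp add: mult_single plus_list_def)

text \<open>
  A property that survives exchanges of neighbours survives all rearrangements; the first letter
  \<open>y\<close> of the target is moved to the front, and the prefix \<open>us\<close> collects the letters that are in
  place.
\<close>

lemma mset_swap_induct:
  assumes swap: "\<And>xs a b ys. Q (xs @ b # a # ys) \<Longrightarrow> Q (xs @ a # b # ys)"
    and "mset xs = mset ys" "Q (us @ xs)"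
  shows "Q (us @ ys)"
  using assms(2,3)
proof (induction ys arbitrary: us xs)
  case Nil
  then show ?case by simp
next
  case (Cons y ys)
  then have "y \<in> set xs" by (metis list.set_intros(1) set_mset_mset)
  then obtain as bs where xs: "xs = as @ y # bs" by (meson split_list)
  have move: "Q (us @ as @ y # bs) \<Longrightarrow> Q (us @ y # as @ bs)" for as bs
  proof (induction as arbitrary: bs rule: rev_induct)
    case (snoc a as)
    have "Q ((us @ as) @ a # y # bs)" using snoc.prems by simp
    then have "Q ((us @ as) @ y # a # bs)" by (rule swap)
    then have "Q (us @ as @ y # (a # bs))" by simp
    from snoc.IH[OF this] show ?case by simp
  qed simp
  have "Q ((us @ [y]) @ (as @ bs))"
    using move[of as bs] Cons.prems(2) xs by simp
  moreover have "mset (as @ bs) = mset ys"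
    using Cons.prems(1) xs by simp
  ultimately show ?case
    using Cons.IH[of "as @ bs" "us @ [y]"] by simp
qed

text \<open>
  The matrices \<open>E_{i,j}\<close>, \<open>i \<noteq> j\<close>, and \<open>h_i\<close> span sl(n). The coefficient of \<open>h_i\<close> is the sum of
  the first \<open>i\<close> diagonal entries, and the last diagonal entry comes out right because the trace
  is zero.
\<close>

lemma sl_span_induct:
  assumes A: "A \<in> sl n"
    and zero: "Q (0\<^sub>m n n)"
    and lin: "\<And>c C D. C \<in> sl n \<Longrightarrow> D \<in> sl n \<Longrightarrow> Q C \<Longrightarrow> Q D \<Longrightarrow> Q (c \<cdot>\<^sub>m C + D)"
    and off: "\<And>i j. i \<in> {1..n} \<Longrightarrow> j \<in> {1..n} \<Longrightarrow> i \<noteq> j \<Longrightarrow> Q (E n i j)"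
    and cart: "\<And>i. 1 \<le> i \<Longrightarrow> i < n \<Longrightarrow> Q (h n i)"
  shows "Q A"
proof -
  have gen: "mat n n (\<lambda>rs. \<Sum>b\<in>I. c b * B b $$ rs) \<in> sl n \<and> Q (mat n n (\<lambda>rs. \<Sum>b\<in>I. c b * B b $$ rs))"
    if "finite I" "\<And>b. b \<in> I \<Longrightarrow> B b \<in> sl n" "\<And>b. b \<in> I \<Longrightarrow> Q (B b)"
    for I :: "'x set" and c B
    using that
  proof (induction I rule: finite_induct)
    case empty
    have "mat n n (\<lambda>rs. \<Sum>b\<in>{}. c b * B b $$ rs) = 0\<^sub>m n n" by auto
    then show ?case using zero zero_sl by (simp only:)
  next
    case (insert x F)
    let ?S = "mat n n (\<lambda>rs. \<Sum>b\<in>F. c b * B b $$ rs)"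
    have "B x \<in> carrier_mat n n" using insert.prems(1)[of x] by (simp add: sl_carrier)
    then have eq: "mat n n (\<lambda>rs. \<Sum>b\<in>insert x F. c b * B b $$ rs) = c x \<cdot>\<^sub>m B x + ?S"
      using insert.hyps by auto
    have "?S \<in> sl n" "Q ?S" using insert by auto
    then show ?case
      unfolding eq using insert.prems by (auto intro!: lin linear_sl)
  qed
  have c: "A \<in> carrier_mat n n" using A by (rule sl_carrier)
  define J where "J = {(i, j). i \<in> {1..n} \<and> j \<in> {1..n} \<and> i \<noteq> j}"
  have fJ: "finite J" by (rule finite_subset[of _ "{1..n} \<times> {1..n}"]) (auto simp: J_def)
  define O1 where "O1 = mat n n (\<lambda>rs. \<Sum>b\<in>J. (A $$ (fst b - 1, snd b - 1)) * (E n (fst b) (snd b)) $$ rs)"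
  have O1: "O1 \<in> sl n \<and> Q O1"
    unfolding O1_def by (rule gen[OF fJ]) (auto simp: J_def intro: E_sl off)
  define D1 where "D1 = mat n n (\<lambda>rs. \<Sum>i\<in>{1..<n}. (\<Sum>k<i. A $$ (k, k)) * h n i $$ rs)"
  have D1: "D1 \<in> sl n \<and> Q D1"
    unfolding D1_def by (rule gen) (auto intro: h_sl cart)
  have "A = 1 \<cdot>\<^sub>m O1 + D1"
  proof (rule eq_matI)
    fix r s assume "r < dim_row (1 \<cdot>\<^sub>m O1 + D1)" "s < dim_col (1 \<cdot>\<^sub>m O1 + D1)"
    then have rs: "r < n" "s < n" by (auto simp: D1_def)
    have o: "O1 $$ (r, s) = (if r = s then 0 else A $$ (r, s))"
    proof -
      have "O1 $$ (r, s) = (\<Sum>b\<in>J. if b = (Suc r, Suc s) then A $$ (r, s) else 0)"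
        unfolding O1_def using rs by (auto simp: E_def intro!: sum.cong)
      then show ?thesis using fJ rs by (simp add: J_def)
    qed
    have "D1 $$ (r, s) = (\<Sum>i\<in>{1..<n}. (\<Sum>k<i. A $$ (k, k)) * h n i $$ (r, s))"
      unfolding D1_def using rs by simp
    also have "\<dots> = (\<Sum>i\<in>{1..<n}. (if i = Suc r then if r = s then \<Sum>k<i. A $$ (k, k) else 0 else 0)
        - (if i = r then if r = s then \<Sum>k<i. A $$ (k, k) else 0 else 0))"
      using rs by (intro sum.cong refl) (auto simp: h_def E_def)
    also have "\<dots> = (if r = s then (if Suc r < n then \<Sum>k<Suc r. A $$ (k, k) else 0) - (if 1 \<le> r then \<Sum>k<r. A $$ (k, k) else 0) else 0)"
      using rs by (simp add: sum_subtractf)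
    also have "\<dots> = (if r = s then A $$ (r, s) else 0)"
    proof (cases "Suc r < n")
      case True
      then show ?thesis by (cases r) auto
    next
      case False
      then have n: "n = Suc r" using rs by simp
      have "(\<Sum>k<Suc r. A $$ (k, k)) = 0" using A unfolding n by (simp add: sl_def)
      then show ?thesis using n by (cases r) (auto simp: add_eq_0_iff2 algebra_simps)
    qed
    finally show "A $$ (r, s) = (1 \<cdot>\<^sub>m O1 + D1) $$ (r, s)"
      using rs o by (simp add: D1_def O1_def)
  qed (use c in \<open>auto simp: O1_def D1_def\<close>)
  then show ?thesis
    using lin[of O1 D1 1] O1 D1 by simp
qed


text \<open>
  Exchanging neighbouring letters changes a word by a shorter one, which is spanned by
  hypothesis. So in a word in the basis of sl(n), a letter \<open>E_{i,j}\<close>, \<open>i < j\<close>, or \<open>h_i\<close> may be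
  moved to the right end, where it annihilates the highest-weight vector or acts as a scalar; if
  there is no such letter, the word may be sorted. Words in arbitrary elements of sl(n) follow
  by linearity in each letter.
\<close>

lemma word_pbw_spanned:
  assumes IH: "\<And>u. u \<in> T n \<Longrightarrow> (\<And>w. w \<in> Poly_Mapping.keys u \<Longrightarrow> length w < k) \<Longrightarrow> u \<in> pbw_spanned n lam"
    and w: "w \<in> lists (sl n)" "length w = k"
  shows "Poly_Mapping.single w 1 \<in> pbw_spanned n lam"
proof -
  let ?s = "\<lambda>w. Poly_Mapping.single w (1::complex)"
  have short: "?s v \<in> pbw_spanned n lam" if "v \<in> lists (sl n)" "length v < k" for v
    using that by (intro IH T_single) auto
  define Q where "Q v \<longleftrightarrow> v \<in> lists (sl n) \<and> length v = k \<and> ?s v \<in> pbw_spanned n lam" for v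
  have swap: "Q (xs @ a # b # ys)" if Q: "Q (xs @ b # a # ys)" for xs a b ys
  proof -
    have sl: "xs \<in> lists (sl n)" "ys \<in> lists (sl n)" "a \<in> sl n" "b \<in> sl n" and len: "length (xs @ a # b # ys) = k"
      using Q by (auto simp: Q_def)
    have gens: "?s (xs @ c # e # ys) = ?s xs * (gen c * gen e) * ?s ys" for c e
      by (simp add: gen_def mult_single plus_list_def)
    have gens1: "?s (xs @ c # ys) = ?s xs * gen c * ?s ys" for c
      by (simp add: gen_def mult_single plus_list_def)
    have "?s xs * (gen a * gen b - gen b * gen a - gen (a * b - b * a)) * ?s ys \<in> verma_ideal n lam"
      using sl by (intro verma_ideal.U U_ideal.mult U_ideal.bracket T_single)
    moreover have "?s xs * (gen a * gen b - gen b * gen a - gen (a * b - b * a)) * ?s ys \<in> T n"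
      using sl by (intro T_mult T_diff T_gen T_single bracket_sl)
    ultimately have "?s xs * (gen a * gen b - gen b * gen a - gen (a * b - b * a)) * ?s ys \<in> pbw_spanned n lam"
      by (rule pbw_spanned_ideal)
    moreover have "?s xs * (gen a * gen b - gen b * gen a - gen (a * b - b * a)) * ?s ys =
       ?s (xs @ a # b # ys) - ?s (xs @ b # a # ys) - ?s (xs @ (a * b - b * a) # ys)"
      unfolding gens gens1 by (simp add: algebra_simps)
    moreover have "?s (xs @ (a * b - b * a) # ys) \<in> pbw_spanned n lam"
      using sl len bracket_sl[OF sl(3,4)] by (intro short) auto
    moreover have "?s (xs @ b # a # ys) \<in> pbw_spanned n lam" using Q by (simp add: Q_def)
    ultimately have "?s (xs @ a # b # ys) \<in> pbw_spanned n lam"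
      by (metis pbw_spanned_cong)
    then show ?thesis using sl len by (simp add: Q_def)
  qed
  have perm: "Q xs \<Longrightarrow> mset xs = mset ys \<Longrightarrow> Q ys" for xs ys
    using mset_swap_induct[of Q xs ys "[]"] swap by simp
  have idl: "Q w" if "w \<in> lists (sl n)" "length w = k" "?s w \<in> verma_ideal n lam" for w
    using that by (auto simp: Q_def intro!: pbw_spanned_ideal T_single)
  define B where "B = {E n i j | i j. i \<in> {1..n} \<and> j \<in> {1..n} \<and> i \<noteq> j} \<union> {h n i | i. 1 \<le> i \<and> i < n}"
  have Bsl: "B \<subseteq> sl n" by (auto simp: B_def intro: E_sl h_sl)
  (* A letter that is not a negative root vector is moved to the right end; a word in negative
     root vectors is sorted. *)
  have basis: "Q v" if v: "v \<in> lists B" "length v = k" for v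
  proof (cases "v \<in> lists ((\<lambda>(i, j). E n i j) ` tri n)")
    case True
    then have "v \<in> map (\<lambda>(i, j). E n i j) ` lists (tri n)" by (simp only: lists_image)
    then obtain ps where ps: "set ps \<subseteq> tri n" "v = root_word n ps"
      by (auto simp: root_word_def)
    let ?c = "root_word n (canon_list (mset ps))"
    have "mset ?c = mset v" using canon_list(1)[of "mset ps"] ps(2) by (simp add: root_word_def)
    moreover have "Q ?c"
    proof -
      have mem: "?c \<in> lists (sl n)"
        using \<open>mset ?c = mset v\<close> v(1) Bsl by (metis in_lists_conv_set set_mset_mset subsetD)
      have "length ?c = k" using \<open>mset ?c = mset v\<close> v(2) by (metis size_mset)
      moreover have "?s ?c \<in> pbw_normal n"
        using ps(1) by (auto simp: pbw_normal_def intro!: exI[of _ "mset ps"])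
      then have "?s ?c \<in> pbw_spanned n lam"
        unfolding pbw_spanned_def using T_single[OF mem] verma_ideal_zero by (auto intro!: bexI[of _ "?s ?c"])
      ultimately show ?thesis using mem by (simp add: Q_def)
    qed
    ultimately show ?thesis using perm by blast
  next
    case False
    then obtain b where b: "b \<in> set v" "b \<notin> (\<lambda>(i, j). E n i j) ` tri n" by auto
    then obtain xs ys where v2: "v = xs @ b # ys" by (meson split_list)
    have sl: "xs @ ys \<in> lists (sl n)" "b \<in> sl n" using v(1) Bsl v2 by auto
    have gb: "?s ((xs @ ys) @ [b]) = ?s (xs @ ys) * gen b"
      unfolding gen_def by (rule single_split)
    have "Q ((xs @ ys) @ [b])"
    proof -
      have "b \<in> B" using v(1) b(1) by auto
      then consider i j where "b = E n i j" "1 \<le> i" "i < j" "j \<le> n" | i where "b = h n i" "1 \<le> i" "i < n"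
        using b(2) unfolding B_def tri_def by (force simp: nat_neq_iff)
      then show ?thesis
      proof cases
        case (1 i j)
        have "?s ((xs @ ys) @ [b]) \<in> verma_ideal n lam"
          unfolding gb unfolding 1(1) using 1 sl(1) by (intro verma_ideal.mult verma_ideal.pos T_single)
        then show ?thesis using sl v2 v(2) by (intro idl) auto
      next
        case (2 i)
        have "?s (xs @ ys) * (gen b - scal (lam i)) \<in> verma_ideal n lam"
          unfolding 2(1) using 2 sl(1) by (intro verma_ideal.mult verma_ideal.cartan T_single)
        moreover have "?s (xs @ ys) * (gen b - scal (lam i)) \<in> T n"
          using sl by (intro T_mult T_diff T_gen T_scal T_single)
        ultimately have "?s (xs @ ys) * (gen b - scal (lam i)) \<in> pbw_spanned n lam"
          by (rule pbw_spanned_ideal)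
        moreover have "?s (xs @ ys) * (gen b - scal (lam i)) = ?s ((xs @ ys) @ [b]) - scal (lam i) * ?s (xs @ ys)"
          unfolding gb by (simp add: right_diff_distrib scal_def mult_single plus_list_def)
        moreover have "scal (lam i) * ?s (xs @ ys) \<in> pbw_spanned n lam"
          using sl v2 v(2) by (intro pbw_spanned_scal short) auto
        ultimately have "?s ((xs @ ys) @ [b]) \<in> pbw_spanned n lam"
          by (metis pbw_spanned_cong)
        then show ?thesis using sl v2 v(2) by (simp add: Q_def)
      qed
    qed
    then show ?thesis
      by (rule perm) (simp add: v2)
  qed
  (* The letters are replaced by basis elements from left to right. *)
  have "Q (us @ vs)" if "us \<in> lists B" "vs \<in> lists (sl n)" "length (us @ vs) = k" for us vs
    using that
  proof (induction vs arbitrary: us)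
    case Nil
    then show ?case using basis[of us] by simp
  next
    case (Cons A vs)
    have us: "us \<in> lists (sl n)" and vs: "vs \<in> lists (sl n)" and A: "A \<in> sl n"
      using Cons.prems Bsl by auto
    have len: "length (us @ C # vs) = k" for C using Cons.prems by simp
    have bas: "Q (us @ C # vs)" if "C \<in> B" for C
      using Cons.IH[of "us @ [C]"] that Cons.prems by simp
    have g: "?s (us @ C # vs) = ?s us * gen C * ?s vs" for C
      by (simp add: gen_def mult_single plus_list_def)
    have linear: "?s us * (gen (c \<cdot>\<^sub>m C + D) - (scal c * gen C + gen D)) * ?s vs \<in> verma_ideal n lam"
      if "C \<in> sl n" "D \<in> sl n" for c C D
      using that us vs by (intro verma_ideal.U U_ideal.mult U_ideal.linear T_single)
    have scal_comm: "?s us * (scal c * gen C) * ?s vs = scal c * ?s (us @ C # vs)" for c C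
      by (simp add: gen_def scal_def mult_single plus_list_def)
    from A show ?case
    proof (rule sl_span_induct)
      have z: "1 \<cdot>\<^sub>m 0\<^sub>m n n + 0\<^sub>m n n = (0\<^sub>m n n :: complex mat)" by auto
      have "- (?s us * gen (0\<^sub>m n n) * ?s vs) \<in> verma_ideal n lam"
        using linear[OF zero_sl zero_sl, of 1] unfolding z scal_one by simp
      then have "?s (us @ 0\<^sub>m n n # vs) \<in> verma_ideal n lam"
        unfolding g using verma_ideal_uminus by fastforce
      then show "Q (us @ 0\<^sub>m n n # vs)"
        using us vs zero_sl len by (intro idl) auto
    next
      fix c C D
      assume CD: "C \<in> sl n" "D \<in> sl n" and Q: "Q (us @ C # vs)" "Q (us @ D # vs)"
      have mem: "us @ (c \<cdot>\<^sub>m C + D) # vs \<in> lists (sl n)"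
        using us vs linear_sl[OF CD] by auto
      have "?s us * (gen (c \<cdot>\<^sub>m C + D) - (scal c * gen C + gen D)) * ?s vs \<in> T n"
        using us vs CD linear_sl[OF CD] by (intro T_mult T_diff T_add T_gen T_scal T_single)
      with linear[OF CD] have "?s us * (gen (c \<cdot>\<^sub>m C + D) - (scal c * gen C + gen D)) * ?s vs \<in> pbw_spanned n lam"
        by (rule pbw_spanned_ideal)
      moreover have "?s us * (gen (c \<cdot>\<^sub>m C + D) - (scal c * gen C + gen D)) * ?s vs =
          ?s (us @ (c \<cdot>\<^sub>m C + D) # vs) - (scal c * ?s (us @ C # vs) + ?s (us @ D # vs))"
        unfolding scal_comm[symmetric] unfolding g by (simp add: algebra_simps)
      moreover have "scal c * ?s (us @ C # vs) + ?s (us @ D # vs) \<in> pbw_spanned n lam"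
        using Q by (auto simp: Q_def intro!: pbw_spanned_add pbw_spanned_scal)
      ultimately have "?s (us @ (c \<cdot>\<^sub>m C + D) # vs) \<in> pbw_spanned n lam"
        by (metis pbw_spanned_cong)
      then show "Q (us @ (c \<cdot>\<^sub>m C + D) # vs)"
        using mem len by (simp only: Q_def)
    next
      fix i j assume "i \<in> {1..n}" "j \<in> {1..n}" "i \<noteq> j"
      then show "Q (us @ E n i j # vs)" by (intro bas) (auto simp: B_def)
    next
      fix i assume "1 \<le> i" "i < n"
      then show "Q (us @ h n i # vs)" by (intro bas) (auto simp: B_def)
    qed
  qed
  from this[of "[]" w] show ?thesis
    using w by (simp add: Q_def)
qed

lemma T_pbw_spanned:
  assumes "u \<in> T n"
  shows "u \<in> pbw_spanned n lam"
proof -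
  have "u \<in> pbw_spanned n lam" if "u \<in> T n" "\<And>w. w \<in> Poly_Mapping.keys u \<Longrightarrow> length w < k" for u k
    using that
  proof (induction k arbitrary: u)
    case 0
    show ?case
    proof (rule pbw_spanned_keys)
      fix w assume "w \<in> Poly_Mapping.keys u"
      then have "length w < 0" by (rule 0(2))
      then show "Poly_Mapping.single w 1 \<in> pbw_spanned n lam" by simp
    qed
  next
    case (Suc k)
    show ?case
    proof (rule pbw_spanned_keys)
      fix w assume w: "w \<in> Poly_Mapping.keys u"
      have mem: "w \<in> lists (sl n)" using Suc.prems(1) w by (auto simp: T_def)
      have "length w < k \<or> length w = k" using Suc.prems(2)[OF w] by auto
      then show "Poly_Mapping.single w 1 \<in> pbw_spanned n lam"
      proof
        assume "length w < k"
        then show ?thesis using mem by (intro Suc.IH T_single) auto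
      next
        assume "length w = k"
        with mem show ?thesis by (intro word_pbw_spanned[OF Suc.IH]) auto
      qed
    qed
  qed
  moreover have "length w < Suc (Max (length ` Poly_Mapping.keys u))" if "w \<in> Poly_Mapping.keys u" for w
    using that by (intro le_imp_less_Suc Max_ge) auto
  ultimately show ?thesis using assms by blast
qed

text \<open>
  Modulo the annihilator of the highest-weight vector, \<open>u\<close> is a combination of canonical words,
  and these act independently. So the Verma module is faithfully represented by polynomials.
\<close>

lemma Phi_kernel:
  assumes "u \<in> T n" "Phi n (gl_weight n lam) u = 0"
  shows "u \<in> verma_ideal n lam"
proof -
  obtain v where v: "v \<in> pbw_normal n" "u - v \<in> verma_ideal n lam"
    using T_pbw_spanned[OF assms(1), of lam] by (auto simp: pbw_spanned_def)
  have "Phi n (gl_weight n lam) (u - v) = 0" using v(2) by (rule Phi_verma_ideal)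
  then have "Phi n (gl_weight n lam) v = 0" using assms(2) by (simp add: Phi_diff)
  then have "v = 0" by (rule Phi_pbw_normal[OF v(1)])
  then show ?thesis using v(2) by simp
qed

section \<open>Counting singular vectors\<close>

definition verma_class :: "nat \<Rightarrow> (nat \<Rightarrow> complex) \<Rightarrow> free_alg \<Rightarrow> free_alg set" where
  "verma_class n lam u = verma_rel n lam `` {u}"

lemma verma_rel_iff:
  "(u, v) \<in> verma_rel n lam \<longleftrightarrow> u \<in> T n \<and> v \<in> T n \<and> Phi n (gl_weight n lam) u = Phi n (gl_weight n lam) v"
  unfolding verma_rel_def using Phi_kernel[of "u - v" n lam] Phi_verma_ideal[of "u - v" n lam]
  by (auto simp: Phi_diff T_diff)

lemma verma_class_eq_iff: "u \<in> T n \<Longrightarrow> v \<in> T n \<Longrightarrow> verma_class n lam u = verma_class n lam v \<longleftrightarrow> Phi n (gl_weight n lam) u = Phi n (gl_weight n lam) v"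
  unfolding verma_class_def by (auto simp: verma_rel_iff set_eq_iff Image_singleton)

lemma verma_iff: "C \<in> verma n lam \<longleftrightarrow> (\<exists>u\<in>T n. C = verma_class n lam u)"
  by (auto simp: verma_def quotient_def verma_class_def)

lemma verma_zero_verma_class: "verma_zero n lam = verma_class n lam 0"
  by (simp add: verma_zero_def verma_class_def)

lemma verma_act_verma_class:
  assumes "a \<in> T n" "u \<in> T n"
  shows "verma_act n lam a (verma_class n lam u) = verma_class n lam (a * u)"
proof (rule equalityI; rule subsetI)
  fix v assume "v \<in> verma_act n lam a (verma_class n lam u)"
  then obtain u' where "u' \<in> T n" "v \<in> T n" "Phi n (gl_weight n lam) u = Phi n (gl_weight n lam) u'"
      "Phi n (gl_weight n lam) (a * u') = Phi n (gl_weight n lam) v"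
    by (auto simp: verma_act_def verma_class_def verma_rel_iff)
  then show "v \<in> verma_class n lam (a * u)"
    using assms by (simp add: verma_class_def verma_rel_iff T_mult Phi_mult)
next
  fix v assume "v \<in> verma_class n lam (a * u)"
  then have "(a * u, v) \<in> verma_rel n lam" by (simp add: verma_class_def)
  moreover have "u \<in> verma_class n lam u" using assms by (simp add: verma_class_def verma_rel_iff)
  ultimately show "v \<in> verma_act n lam a (verma_class n lam u)"
    unfolding verma_act_def by blast
qed

lemma coroot_op_zeta:
  assumes "i \<in> {1..<n}"
  shows "app (coroot_op n (gl_weight n lam) i) f = zeta n lam i f"
proof
  fix e
  show "app (coroot_op n (gl_weight n lam) i) f e = zeta n lam i f e"
    using assms by (simp add: coroot_op_def app_gl_diagonal zeta_apply left_diff_distrib)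
qed

lemma singular_iff:
  assumes u: "u \<in> T n"
  shows "verma_class n lam u \<in> singular_vectors n lam \<longleftrightarrow>
    Phi n (gl_weight n lam) u \<noteq> 0 \<and> weighted n lam (Phi n (gl_weight n lam) u) \<and> singular n (gl_weight n lam) (Phi n (gl_weight n lam) u)"
proof -
  let ?P = "Phi n (gl_weight n lam)"
  have z: "verma_class n lam u = verma_zero n lam \<longleftrightarrow> ?P u = 0"
    unfolding verma_zero_verma_class verma_class_eq_iff[OF u T_zero] by (simp add: Phi_zero)
  have w: "verma_act n lam (gen (h n i)) (verma_class n lam u) = verma_act n lam (scal c) (verma_class n lam u) \<longleftrightarrow>
      zeta n lam i (?P u) = fscale c (?P u)" if i: "i \<in> {1..<n}" for i c
  proof -
    have hT: "gen (h n i) \<in> T n" using i by (intro T_gen h_sl) auto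
    show ?thesis
      unfolding verma_act_verma_class[OF hT u] verma_act_verma_class[OF T_scal u] verma_class_eq_iff[OF T_mult[OF hT u] T_mult[OF T_scal u]]
        Phi_mult free_op_gen free_op_scal app_scop
      using i by (simp add: mat_op_h coroot_op_zeta)
  qed
  have e: "verma_act n lam (gen (E n i (i + 1))) (verma_class n lam u) = verma_zero n lam \<longleftrightarrow>
      app (gl n (gl_weight n lam) 1 i (Suc i)) (?P u) = 0" if i: "i \<in> {1..<n}" for i
  proof -
    have ET: "gen (E n i (i + 1)) \<in> T n" by (intro T_gen E_sl) simp
    have mE: "mat_op n (gl_weight n lam) (E n i (i + 1)) = gl n (gl_weight n lam) 1 i (Suc i)"
      using i by (simp add: mat_op_E flip: Suc_eq_plus1)
    show ?thesis
      unfolding verma_act_verma_class[OF ET u] verma_zero_verma_class verma_class_eq_iff[OF T_mult[OF ET u] T_zero]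
        Phi_mult free_op_gen mE Phi_zero ..
  qed
  have "verma_class n lam u \<in> verma n lam" using u by (auto simp: verma_iff)
  then show ?thesis
    unfolding singular_vectors_def weighted_def singular_def using z w e by auto
qed

lemma proportional_iff:
  assumes "u \<in> T n" "v \<in> T n"
  shows "(verma_class n lam u, verma_class n lam v) \<in> proportional n lam \<longleftrightarrow>
    verma_class n lam u \<in> singular_vectors n lam \<and> verma_class n lam v \<in> singular_vectors n lam \<and>
    (\<exists>c. c \<noteq> 0 \<and> Phi n (gl_weight n lam) v = fscale c (Phi n (gl_weight n lam) u))"
proof -
  have "verma_class n lam v = verma_act n lam (scal c) (verma_class n lam u) \<longleftrightarrow>
      Phi n (gl_weight n lam) v = fscale c (Phi n (gl_weight n lam) u)" for c
    unfolding verma_act_verma_class[OF T_scal assms(1)] verma_class_eq_iff[OF assms(2) T_mult[OF T_scal assms(1)]] Phi_scal ..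
  then show ?thesis by (simp add: proportional_def)
qed

lemma singular_verma_class:
  assumes "C \<in> singular_vectors n lam"
  obtains u where "u \<in> T n" "C = verma_class n lam u"
  using assms by (auto simp: singular_vectors_def verma_iff)

text \<open>
  On classes of elements of \<open>T n\<close>, proportionality is that of the representing polynomials.
\<close>

lemma equiv_proportional: "equiv (singular_vectors n lam) (proportional n lam)"
proof (rule equivI)
  show "proportional n lam \<subseteq> singular_vectors n lam \<times> singular_vectors n lam"
    by (auto simp: proportional_def)
  show "refl_on (singular_vectors n lam) (proportional n lam)"
  proof (rule refl_onI)
    fix C assume C: "C \<in> singular_vectors n lam"
    obtain u where u: "u \<in> T n" "C = verma_class n lam u" by (rule singular_verma_class[OF C])
    have "Phi n (gl_weight n lam) u = fscale 1 (Phi n (gl_weight n lam) u)" by (simp add: fscale_def)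
    then show "(C, C) \<in> proportional n lam"
      using C unfolding u(2) proportional_iff[OF u(1) u(1)] by (metis one_neq_zero)
  qed
  show "sym (proportional n lam)"
  proof (rule symI)
    fix C D assume CD: "(C, D) \<in> proportional n lam"
    then have s: "C \<in> singular_vectors n lam" "D \<in> singular_vectors n lam" by (auto simp: proportional_def)
    obtain u where u: "u \<in> T n" "C = verma_class n lam u" by (rule singular_verma_class[OF s(1)])
    obtain v where v: "v \<in> T n" "D = verma_class n lam v" by (rule singular_verma_class[OF s(2)])
    obtain c where c: "c \<noteq> 0" "Phi n (gl_weight n lam) v = fscale c (Phi n (gl_weight n lam) u)"
      using CD unfolding u(2) v(2) proportional_iff[OF u(1) v(1)] by blast
    have "Phi n (gl_weight n lam) u = fscale (inverse c) (Phi n (gl_weight n lam) v)"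
      unfolding c(2) using c(1) by (intro ext) (simp add: fscale_def flip: mult.assoc)
    then show "(D, C) \<in> proportional n lam"
      using s c(1) unfolding u(2) v(2) proportional_iff[OF v(1) u(1)] by (metis inverse_nonzero_iff_nonzero)
  qed
  show "trans (proportional n lam)"
  proof (rule transI)
    fix C D F assume CD: "(C, D) \<in> proportional n lam" and DF: "(D, F) \<in> proportional n lam"
    then have s: "C \<in> singular_vectors n lam" "D \<in> singular_vectors n lam" "F \<in> singular_vectors n lam"
      by (auto simp: proportional_def)
    obtain u where u: "u \<in> T n" "C = verma_class n lam u" by (rule singular_verma_class[OF s(1)])
    obtain v where v: "v \<in> T n" "D = verma_class n lam v" by (rule singular_verma_class[OF s(2)])
    obtain w where w: "w \<in> T n" "F = verma_class n lam w" by (rule singular_verma_class[OF s(3)])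
    obtain c where c: "c \<noteq> 0" "Phi n (gl_weight n lam) v = fscale c (Phi n (gl_weight n lam) u)"
      using CD unfolding u(2) v(2) proportional_iff[OF u(1) v(1)] by blast
    obtain c' where c': "c' \<noteq> 0" "Phi n (gl_weight n lam) w = fscale c' (Phi n (gl_weight n lam) v)"
      using DF unfolding w(2) v(2) proportional_iff[OF v(1) w(1)] by blast
    have "Phi n (gl_weight n lam) w = fscale (c' * c) (Phi n (gl_weight n lam) u)"
      unfolding c'(2) c(2) by (simp add: fscale_def mult.assoc)
    then show "(C, F) \<in> proportional n lam"
      using s c(1) c'(1) unfolding u(2) w(2) proportional_iff[OF u(1) w(1)] by (metis mult_eq_0_iff)
  qed
qed

lemma rho_shift_diff:
  assumes "i < j" "j \<le> n"
  shows "rho_shift n (gl_weight n lam) i - rho_shift n (gl_weight n lam) j = (\<Sum>k\<in>{i..<j}. lam k) + of_nat (j - i)"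
proof -
  have "{i..<n} = {i..<j} \<union> {j..<n}" using assms by auto
  then have "gl_weight n lam i = (\<Sum>k\<in>{i..<j}. lam k) + gl_weight n lam j"
    by (simp add: gl_weight_def sum.union_disjoint)
  moreover have "of_nat (n - i) = of_nat (n - j) + (of_nat (j - i) :: complex)"
    using assms by (simp flip: of_nat_add)
  ultimately show ?thesis by (simp add: rho_shift_def)
qed

lemma dominant_rho_shift_diff:
  assumes dom: "\<forall>i\<in>{1..<n}. lam i \<in> \<nat>" and ij: "1 \<le> i" "i < j" "j \<le> n"
  shows "\<exists>k. rho_shift n (gl_weight n lam) i - rho_shift n (gl_weight n lam) j = of_nat (Suc k)"
proof -
  have "(\<Sum>k\<in>{i..<j}. lam k) \<in> \<nat>" using dom ij by (intro Nats_sum) auto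
  then obtain m where "(\<Sum>k\<in>{i..<j}. lam k) = of_nat m" by (auto elim: Nats_cases)
  moreover have "m + (j - i) = Suc (m + (j - i) - 1)" using ij by simp
  ultimately show ?thesis
    unfolding rho_shift_diff[OF ij(2,3)] by (metis of_nat_add)
qed

lemma dominant_inj:
  assumes dom: "\<forall>i\<in>{1..<n}. lam i \<in> \<nat>"
  shows "inj_on (rho_shift n (gl_weight n lam)) {1..n}"
proof (rule linorder_inj_onI)
  fix i j :: nat assume "i < j" "i \<in> {1..n}" "j \<in> {1..n}"
  then obtain k where "rho_shift n (gl_weight n lam) i - rho_shift n (gl_weight n lam) j = of_nat (Suc k)"
    using dominant_rho_shift_diff[OF dom, of i j] by auto
  then show "rho_shift n (gl_weight n lam) i \<noteq> rho_shift n (gl_weight n lam) j"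
    by (metis eq_iff_diff_eq_0 of_nat_eq_0_iff nat.distinct(1))
qed auto

text \<open>
  For a dominant weight the shifted weight is strictly decreasing with integral differences.
  Along an ascent \<open>\<pi> i < \<pi> (i + 1)\<close> the exponent of \<open>eta\<close> is therefore a natural number, and
  \<open>eta\<close> is a power of \<open>E_{i+1,i}\<close>, which acts inside the Verma module.
\<close>

lemma dominant_orbit_polynomial:
  assumes dom: "\<forall>i\<in>{1..<n}. lam i \<in> \<nat>" and "\<pi> permutes {1..n}"
  shows "\<exists>u\<in>T n. orbit_sol n (gl_weight n lam) \<pi> (Phi n (gl_weight n lam) u)"
  using assms(2)
proof (rule permutation_ascent_induct)
  have "Phi n (gl_weight n lam) 1 = fone" by (simp add: Phi_def free_op_one)
  moreover have "1 \<in> T n" using T_scal[of 1 n] by (simp add: scal_one)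
  ultimately show "\<exists>u\<in>T n. orbit_sol n (gl_weight n lam) id (Phi n (gl_weight n lam) u)"
    using orbit_sol_fone[of n "gl_weight n lam"] by metis
next
  fix \<pi> i
  assume \<pi>: "\<pi> permutes {1..n}" and i: "1 \<le> i" "i < n" and asc: "\<pi> i < \<pi> (Suc i)"
    and "\<exists>u\<in>T n. orbit_sol n (gl_weight n lam) \<pi> (Phi n (gl_weight n lam) u)"
  then obtain u where u: "u \<in> T n" "orbit_sol n (gl_weight n lam) \<pi> (Phi n (gl_weight n lam) u)" by blast
  have "\<pi> i \<in> {1..n}" "\<pi> (Suc i) \<in> {1..n}"
    unfolding permutes_in_image[OF \<pi>] using i by auto
  then obtain k where k: "rho_shift n (gl_weight n lam) (\<pi> i) - rho_shift n (gl_weight n lam) (\<pi> (Suc i)) = of_nat (Suc k)"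
    using dominant_rho_shift_diff[OF dom _ asc] by auto
  have "of_nat (n - i) = of_nat (n - Suc i) + (1 :: complex)"
    using i by (metis Suc_diff_Suc of_nat_Suc add.commute)
  then have exp: "linked_weight n (gl_weight n lam) \<pi> i - linked_weight n (gl_weight n lam) \<pi> (Suc i) + 1 = of_nat (Suc k)"
    using k by (simp add: linked_weight_def)
  let ?v = "gen (E n (Suc i) i) ^ Suc k * u"
  have "mat_op n (gl_weight n lam) (E n (Suc i) i) = gl n (gl_weight n lam) 1 (Suc i) i"
    using i by (intro mat_op_E) auto
  then have "free_op n (gl_weight n lam) (gen (E n (Suc i) i) ^ Suc k) = gl n (gl_weight n lam) 1 (Suc i) i ^ Suc k"
    unfolding free_op_power free_op_gen by (simp only:)
  then have "Phi n (gl_weight n lam) ?v = eta i (of_nat (Suc k)) (Phi n (gl_weight n lam) u)"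
    unfolding Phi_mult eta_of_nat[OF supported_Phi i, of "Suc k" "gl_weight n lam" u "gl_weight n lam"] by (simp only:)
  then have "orbit_sol n (gl_weight n lam) (\<pi> \<circ> adj_swap i) (Phi n (gl_weight n lam) ?v)"
    using orbit_sol_eta[OF u(2) i] unfolding exp by (simp only:)
  moreover have "?v \<in> T n"
    using u(1) by (intro T_mult T_power T_gen E_sl) auto
  ultimately show "\<exists>u\<in>T n. orbit_sol n (gl_weight n lam) (\<pi> \<circ> adj_swap i) (Phi n (gl_weight n lam) u)"
    by blast
qed

text \<open>
  Lines of singular vectors correspond to permutations: each linked weight carries exactly one
  line, and the linked weights are distinct because the shifted dominant weight has distinct
  entries.
\<close>

lemma card_singular_lines:
  assumes dom: "\<forall>i\<in>{1..<n}. lam i \<in> \<nat>"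
  shows "card (singular_vectors n lam // proportional n lam) = fact n"
proof -
  let ?P = "Phi n (gl_weight n lam)"
  let ?S = "{\<pi>. \<pi> permutes {1..n}}"
  obtain U where U: "\<And>\<pi>. \<pi> permutes {1..n} \<Longrightarrow> U \<pi> \<in> T n \<and> orbit_sol n (gl_weight n lam) \<pi> (?P (U \<pi>))"
    using dominant_orbit_polynomial[OF dom] by metis
  define L where "L \<pi> = proportional n lam `` {verma_class n lam (U \<pi>)}" for \<pi>
  have sg: "verma_class n lam (U \<pi>) \<in> singular_vectors n lam" if "\<pi> permutes {1..n}" for \<pi>
  proof -
    have "?P (U \<pi>) \<noteq> 0" using U[OF that] by (auto simp: orbit_sol_def)
    then show ?thesis
      using U[OF that] by (auto simp: singular_iff orbit_sol_def intro: has_weight_weighted)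
  qed
  have "inj_on L ?S"
  proof (rule inj_onI)
    fix \<pi> \<rho> assume "\<pi> \<in> ?S" "\<rho> \<in> ?S" and eq: "L \<pi> = L \<rho>"
    then have \<pi>: "\<pi> permutes {1..n}" and \<rho>: "\<rho> permutes {1..n}" by auto
    have "(verma_class n lam (U \<rho>), verma_class n lam (U \<pi>)) \<in> proportional n lam"
      using eq_equiv_class[OF eq[unfolded L_def, symmetric] equiv_proportional sg[OF \<pi>]] .
    then obtain c where c: "?P (U \<pi>) = fscale c (?P (U \<rho>))"
      using proportional_iff U[OF \<pi>] U[OF \<rho>] by blast
    obtain e where e: "?P (U \<pi>) e = 1" using U[OF \<pi>] by (auto simp: orbit_sol_def)
    then have "?P (U \<rho>) e \<noteq> 0" unfolding c by (auto simp: fscale_def)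
    then have M: "linked_weight n (gl_weight n lam) \<pi> i = linked_weight n (gl_weight n lam) \<rho> i" if "i \<in> {1..n}" for i
      using e that U[OF \<pi>] U[OF \<rho>] unfolding orbit_sol_def has_weight_def by (metis zero_neq_one)
    have "\<pi> i = \<rho> i" for i
    proof (cases "i \<in> {1..n}")
      case True
      then have "rho_shift n (gl_weight n lam) (\<pi> i) = rho_shift n (gl_weight n lam) (\<rho> i)" using M[OF True] by (simp add: linked_weight_def)
      moreover have "\<pi> i \<in> {1..n}" "\<rho> i \<in> {1..n}"
        unfolding permutes_in_image[OF \<pi>] permutes_in_image[OF \<rho>] using True by simp_all
      ultimately show ?thesis using dominant_inj[OF dom] by (meson inj_onD)
    next
      case False
      then show ?thesis using permutes_not_in[OF \<pi>] permutes_not_in[OF \<rho>] by metis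
    qed
    then show "\<pi> = \<rho>" by (rule ext)
  qed
  moreover have "L ` ?S = singular_vectors n lam // proportional n lam"
  proof (rule equalityI; rule subsetI)
    fix C assume "C \<in> L ` ?S"
    then show "C \<in> singular_vectors n lam // proportional n lam"
      unfolding L_def using sg by (auto intro: quotientI)
  next
    fix Q assume "Q \<in> singular_vectors n lam // proportional n lam"
    then obtain C where C: "C \<in> singular_vectors n lam" "Q = proportional n lam `` {C}" by (rule quotientE)
    obtain u where u: "u \<in> T n" "C = verma_class n lam u" by (rule singular_verma_class[OF C(1)])
    have nz: "?P u \<noteq> 0" and wt: "weighted n lam (?P u)" and singular: "singular n (gl_weight n lam) (?P u)"
      using C(1) unfolding u(2) singular_iff[OF u(1)] by auto
    obtain M where M: "has_weight n (gl_weight n lam) M (?P u)" by (rule weighted_has_weight[OF wt supported_Phi])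
    obtain \<pi> where \<pi>: "\<pi> permutes {1..n}" "\<And>i. i \<in> {1..n} \<Longrightarrow> M i = linked_weight n (gl_weight n lam) \<pi> i"
      using linked[OF singular M nz] by blast
    obtain e where e: "pure n e" "?P (U \<pi>) e = 1" using U[OF \<pi>(1)] by (auto simp: orbit_sol_def)
    have "has_weight n (gl_weight n lam) (linked_weight n (gl_weight n lam) \<pi>) (?P u)"
      by (rule has_weight_cong[OF M \<pi>(2)])
    then have eq: "?P u = fscale (?P u e) (?P (U \<pi>))"
      using singular_unique[where e = e and y = "?P (U \<pi>)", OF singular] U[OF \<pi>(1)] e
      by (auto simp: orbit_sol_def)
    then have "?P u e \<noteq> 0" using nz by (metis fscale_null)
    then have "(verma_class n lam (U \<pi>), C) \<in> proportional n lam"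
      using eq C(1) sg[OF \<pi>(1)] U[OF \<pi>(1)] u by (auto simp: proportional_iff)
    then have "Q = L \<pi>"
      unfolding C(2) L_def using equiv_class_eq[OF equiv_proportional] by metis
    then show "Q \<in> L ` ?S" using \<pi>(1) by blast
  qed
  ultimately have "card (singular_vectors n lam // proportional n lam) = card ?S"
    by (metis card_image)
  then show ?thesis by (simp add: card_permutations)
qed

theorem theorem3p1:
  fixes n :: nat and lam :: "nat \<Rightarrow> complex"
  assumes "n \<ge> 2"
  shows "solutions n lam = formal.span (orbit_one n lam)
    \<and> {z \<in> solutions n lam. weighted n lam z} = {fscale c z | c z. z \<in> orbit_one n lam}
    \<and> ((\<forall>i\<in>{1..<n}. lam i \<in> \<nat>) \<longrightarrow>
         card (singular_vectors n lam // proportional n lam) = fact n)"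
  using solutions_eq_span weighted_solutions_eq card_singular_lines by blast

end
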